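(* Let $(H_{\mathbb R},H_{\mathbb C},F^\bullet,W_\bullet,M,S)$ be a Steenbrink PMHS of weight $m$ which is split, i.e. $I^{q,p}=\overline{I^{p,q}}$ for all $p,q$. For $p,q,\lambda$ with $(I^{p,q}_0)_\lambda\ne\{0\}$ put $l:=p+q-m-\theta(\lambda)\ge0$, and let $\alpha\in\mathbb{R}$ be the number with $e^{-2\pi i\alpha}=\lambda$ and $\lfloor m-\alpha\rfloor=p$. (a) The sum $(H_{\mathbb R}\cap H_{\ne1},M,S)\oplus(H_{\mathbb R}\cap H_1,M,S)$ of isometric triples decomposes into the isometric triples whose complexified underlying spaces are $$\sum_{j=0}^lN^j(I_0^{p,q})_\lambda+\sum_{j=0}^lN^j(I_0^{q,p})_{\overline\lambda}\qquad(A)$$ for $p,q,\lambda$ with $(I_0^{p,q})_\lambda\neq\{0\}$, $(p,\lambda)\ne(q,\overline\lambda)$, $\mathrm{Im}((-1)^{m+1}\lambda)\ge0$ (for real $\lambda$ the triples $(p,q,\lambda)$ and $(q,p,\lambda)$ give the same space, which is taken once), and $$\sum_{j=0}^lN^j(I_0^{p,p})_\lambda\qquad(B)$$ for $p,\lambda$ with $\lambda=\pm1$, $(I_0^{p,p})_\lambda\ne\{0\}$. (b) Each of the isometric triples in (A) decomposes into $\dim(I_0^{p,q})_\lambda$ many copies of $$\mathrm{Tr}\bigl(\lambda,2,l+1,[m+\theta(\lambda)]_2,(-1)^{\lceil\alpha\rceil-1-\frac12(m-\theta(\lambda)+[m+\theta(\lambda)]_2)}\bigr).$$ Each of the isometric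 triples in (B) decomposes into $\dim(I_0^{p,p})_\lambda$ many copies of $$\mathrm{Tr}\bigl(\lambda,1,l+1,(-1)^{\lceil\alpha\rceil-\frac12(m-\theta(\lambda)-l)}\bigr),$$ and then $(-1)^{m+1}\lambda=(-1)^l$.
   Context: Notation: $\theta(1)=1$, $\theta(\lambda)=0$ for $\lambda\in S^1\setminus\{1\}$; $[n]_2\in\{0,1\}$ with $[n]_2\equiv n\bmod 2$. For an automorphism $M$ of a finite dimensional real space $H_{\mathbb R}$ with complexification $H_{\mathbb C}$: $M=M_sM_u=M_uM_s$ (semisimple, unipotent), $N=\log M_u$, $H_\lambda=\ker(M_s-\lambda\,\mathrm{id})\subset H_{\mathbb C}$, $H_{\ne1}=\bigoplus_{\lambda\ne1}H_\lambda$. For a nilpotent $N$ and $w\in\mathbb{Z}$, $W^{(N,w)}_\bullet$ is the unique increasing filtration with $N(W_k)\subset W_{k-2}$ and $N^l:\mathrm{Gr}^W_{w+l}\to\mathrm{Gr}^W_{w-l}$ an isomorphism for $l\ge0$; $P_{w+l}=\ker(N^{l+1}:\mathrm{Gr}^W_{w+l}\to\mathrm{Gr}^W_{w-l-2})$ for $l\geq 0$. If $N$ is an infinitesimal isometry of a nondegenerate $(-1)^w$-symmetric form $S$, then $S_l(a,b)=S(\tilde a,N^l\tilde b)$ ($\tilde a,\tilde b\in W_{w+l}$ representatives) is a well defined form on $\mathrm{Gr}^W_{w+l}$. A mixed Hodge structure (MHS) $(H_{\mathbb R},H_{\mathbb C},F^\bullet,W_\bullet)$: decreasing filtration $F^\bullet$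 of $H_{\mathbb C}$, increasing filtration $W_\bullet$ of $H_{\mathbb R}$, such that $F^\bullet\mathrm{Gr}^W_k$ is a pure Hodge structure of weight $k$. A polarized MHS (PMHS) of weight $w$ $(H_{\mathbb R},H_{\mathbb C},F^\bullet,W_\bullet,N,S)$: a MHS with $W_\bullet=W_\bullet^{(N,w)}$, $S$ nondegenerate $(-1)^w$-symmetric on $H_{\mathbb R}$, $N$ a nilpotent infinitesimal isometry of $S$, $N(F^p)\subset F^{p-1}$, $S(F^p,F^{w+1-p})=0$, and $i^{2p-w-l}S_l(a,\overline a)>0$ for $0\ne a\in F^pP_{w+l}\cap\overline{F^{w+l-p}P_{w+l}}$. A Steenbrink MHS of weight $m$: a MHS with an automorphism $M$ of $(H_{\mathbb R},H_{\mathbb C},W_\bullet)$ such that $M_s(F^p)\subset F^p$, $N(F^p)\subset F^{p-1}$, $W_\bullet=W_\bullet^{(N,m)}$ on $H_{\ne1}$, $W_\bullet=W_\bullet^{(N,m+1)}$ on $H_1$. A Steenbrink PMHS of weight $m$: a Steenbrink MHS with a nondegenerate $M$-invariant bilinear form $S$ on $H_{\mathbb R}$ such that the restriction to $H_{\ne1}$ is a PMHS of weight $m$ and the restriction to $H_1$ is a PMHS of weight $m+1$. (All eigenvalues of $M$ are then in $S^1$.) Deligne's subspaces: $I^{p,q}=(F^p\cap W_{p+q})\cap\bigl(\overline F^q\cap W_{p+q}+\sum_{j>0}\overline F^{q-j}\cap W_{p+q-j-1}\bigr)$. For $p+q\ge m+\theta(\lambda)$: $(I_0^{p,q})_\lambda=\{a\in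 I^{p,q}\cap H_\lambda: N^{p+q-m-\theta(\lambda)+1}a=0\}$. An isometric triple $(H_{\mathbb R},M,S)$ is a finite dimensional real vector space with a nondegenerate symmetric or antisymmetric form $S$ and an isometry $M$; decompositions are into $S$-orthogonal $M$-invariant real subspaces. Let $J_n=(\delta_{j,k+1})_{j,k=1,\dots,n}$, $E_n^{per}=((-1)^{j-1}\delta_{j,n+1-k})_{j,k=1,\dots,n}$; $N\underline a=\underline aJ_n$ means $Na_k=a_{k+1}$ ($k<n$), $Na_n=0$; $S(\underline a^t,\underline b)=(S(a_j,b_k))$. $\mathrm{Tr}(\lambda,1,n,\varepsilon)$ ($\lambda,\varepsilon\in\{\pm1\}$): basis $\underline a=(a_1,\dots,a_n)$ of $H_{\mathbb R}$, $M_s=\lambda\,\mathrm{id}$, $N\underline a=\underline aJ_n$, $S(\underline a^t,\underline a)=\varepsilon E_n^{per}$. $\mathrm{Tr}(\lambda,2,n,\mu,\varepsilon)$ ($\lambda\in S^1$, $\mu\in\{0,1\}$, $\varepsilon\in\{\pm1\}$): $\dim H_{\mathbb R}=2n$, $H_{\mathbb C}=H^{(1)}\oplus\overline{H^{(1)}}$, $\underline a$ a basis of $H^{(1)}$, $M_s=\lambda$ on $H^{(1)}$ and $\overline\lambda$ on $\overline{H^{(1)}}$, $N\underline a=\underline aJ_n$, $N\overline{\underline a}=\overline{\underline a}J_n$, $S(\underline a^t,\underline a)=0=S(\overline{\underline a}^t,\overline{\underline a})$, $S(\underline a^t,\overline{\underline a})=i^{n+\mu+1}\varepsilon E_n^{per}$,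 $S(\overline{\underline a}^t,\underline a)=i^{n+\mu+1}\varepsilon(-1)^{n+\mu+1}E_n^{per}$. *)

theory Defs
  imports "HOL-Analysis.Analysis"
begin

section \<open>Complexification of a real vector space\<close>

text \<open>The complexification of a real vector space \<open>'a\<close> is \<open>'a \<times> 'a\<close>, where \<open>(x, y)\<close> stands for
  \<open>x + i y\<close>. Sums of two subspaces are written with the elementwise \<open>+\<close> on sets.\<close>

definition cscale :: "complex \<Rightarrow> 'a \<times> 'a \<Rightarrow> 'a \<times> 'a::real_vector" where
  "cscale c z = (Re c *\<^sub>R fst z - Im c *\<^sub>R snd z, Re c *\<^sub>R snd z + Im c *\<^sub>R fst z)"

interpretation cx: vector_space "cscale :: complex \<Rightarrow> 'a \<times> 'a \<Rightarrow> 'a \<times> 'a::real_vector"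
  by unfold_locales
    (auto simp: cscale_def prod_eq_iff scaleR_add_left scaleR_diff_left scaleR_add_right
      scaleR_diff_right mult.commute)

definition cconj :: "'a \<times> 'a \<Rightarrow> 'a \<times> 'a::real_vector" where
  "cconj z = (fst z, - snd z)"

definition cpx :: "'a set \<Rightarrow> ('a \<times> 'a) set" where
  "cpx V = V \<times> V"

definition cmap :: "('a \<Rightarrow> 'a) \<Rightarrow> 'a \<times> 'a \<Rightarrow> 'a \<times> 'a" where
  "cmap f = map_prod f f"

text \<open>The complex bilinear (not sesquilinear) extension of a real bilinear form.\<close>

definition cform :: "('a \<Rightarrow> 'a \<Rightarrow> real) \<Rightarrow> 'a \<times> 'a \<Rightarrow> 'a \<times> 'a \<Rightarrow> complex" where
  "cform S z w = Complex (S (fst z) (fst w) - S (snd z) (snd w)) (S (fst z) (snd w) + S (snd z) (fst w))"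

definition real_pts :: "('a \<times> 'a) set \<Rightarrow> 'a::real_vector set" where
  "real_pts C = {x. (x, 0) \<in> C}"

definition findim_subspace :: "'a::real_vector set \<Rightarrow> bool" where
  "findim_subspace V \<longleftrightarrow> (\<exists>B. finite B \<and> V = span B)"


section \<open>Semisimple part and logarithm of the unipotent part\<close>

definition nilpotent_on :: "'a::real_vector set \<Rightarrow> ('a \<Rightarrow> 'a) \<Rightarrow> bool" where
  "nilpotent_on V f \<longleftrightarrow> (\<exists>k. \<forall>x\<in>V. (f ^^ k) x = 0)"

text \<open>Semisimple means diagonalizable over the complex numbers. Eigenvalues are called \<open>\<zeta>\<close>.\<close>

definition semisimple_on :: "'a::real_vector set \<Rightarrow> ('a \<Rightarrow> 'a) \<Rightarrow> bool" where
  "semisimple_on V f \<longleftrightarrow> cx.span {z \<in> cpx V. \<exists>c. cmap f z = cscale c z} = cpx V"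

text \<open>The logarithm series, restricted at each vector to its nonzero terms.\<close>

definition unip_log :: "('a \<Rightarrow> 'a) \<Rightarrow> 'a \<Rightarrow> 'a::real_vector" where
  "unip_log u x =
    (\<Sum>k | 1 \<le> k \<and> ((\<lambda>y. u y - y) ^^ k) x \<noteq> 0. ((-1) ^ (k + 1) / real k) *\<^sub>R ((\<lambda>y. u y - y) ^^ k) x)"

text \<open>On the invariant subspace \<open>V\<close>: \<open>M = Ms Mu = Mu Ms\<close> and \<open>N = log Mu\<close>. By the Jordan-Chevalley
  decomposition, an automorphism of a finite dimensional \<open>V\<close> has exactly one such pair
  \<open>(Ms, N)\<close> on \<open>V\<close>.\<close>

definition monodromy_parts ::
    "'a::real_vector set \<Rightarrow> ('a \<Rightarrow> 'a) \<Rightarrow> ('a \<Rightarrow> 'a) \<Rightarrow> ('a \<Rightarrow> 'a) \<Rightarrow> bool" where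
  "monodromy_parts V M Ms N \<longleftrightarrow>
    linear Ms \<and> linear N \<and> Ms ` V \<subseteq> V \<and> semisimple_on V Ms \<and>
    (\<exists>Mu. linear Mu \<and> Mu ` V \<subseteq> V \<and> nilpotent_on V (\<lambda>x. Mu x - x) \<and>
      (\<forall>x\<in>V. M x = Ms (Mu x) \<and> M x = Mu (Ms x) \<and> N x = unip_log Mu x))"

definition eigsp :: "('a \<Rightarrow> 'a) \<Rightarrow> complex \<Rightarrow> ('a \<times> 'a::real_vector) set" where
  "eigsp Ms \<zeta> = {z. cmap Ms z = cscale \<zeta> z}"

definition eigsp_ne1 :: "('a \<Rightarrow> 'a) \<Rightarrow> ('a \<times> 'a::real_vector) set" where
  "eigsp_ne1 Ms = cx.span (\<Union>\<zeta>\<in>-{1}. eigsp Ms \<zeta>)"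

definition theta :: "complex \<Rightarrow> int" where
  "theta \<zeta> = (if \<zeta> = 1 then 1 else 0)"


section \<open>Filtrations and mixed Hodge structures\<close>

text \<open>A subspace of a quotient \<open>A/B\<close> is represented by its preimage, a subspace between \<open>B\<close>
  and \<open>A\<close>. Filtrations are finite: exhaustive and separated.\<close>

definition inc_filtration :: "'a::real_vector set \<Rightarrow> (int \<Rightarrow> 'a set) \<Rightarrow> bool" where
  "inc_filtration V W \<longleftrightarrow>
    (\<forall>k. subspace (W k) \<and> W k \<subseteq> V) \<and> mono W \<and> (\<exists>k. W k = V) \<and> (\<exists>k. W k = {0})"

definition dec_filtration ::
    "('a \<times> 'a::real_vector) set \<Rightarrow> ('a \<times> 'a) set \<Rightarrow> (int \<Rightarrow> ('a \<times> 'a) set) \<Rightarrow> bool" where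
  "dec_filtration A B F \<longleftrightarrow>
    (\<forall>p. cx.subspace (F p) \<and> B \<subseteq> F p \<and> F p \<subseteq> A) \<and> antimono F \<and> (\<exists>p. F p = A) \<and> (\<exists>p. F p = B)"

text \<open>\<open>F\<close> is a pure Hodge structure of weight \<open>k\<close> on \<open>A/B\<close>, that is,
  \<open>A/B\<close> is the direct sum of \<open>F p\<close> and the conjugate of \<open>F (k + 1 - p)\<close> for all \<open>p\<close>.\<close>

definition pure_hodge ::
    "('a \<times> 'a::real_vector) set \<Rightarrow> ('a \<times> 'a) set \<Rightarrow> int \<Rightarrow> (int \<Rightarrow> ('a \<times> 'a) set) \<Rightarrow> bool" where
  "pure_hodge A B k F \<longleftrightarrow> dec_filtration A B F \<and>
    (\<forall>p. F p + cconj ` F (k + 1 - p) = A \<and> F p \<inter> cconj ` F (k + 1 - p) = B)"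

definition F_gr :: "(int \<Rightarrow> ('a \<times> 'a::real_vector) set) \<Rightarrow> (int \<Rightarrow> 'a set) \<Rightarrow> int \<Rightarrow> int \<Rightarrow> ('a \<times> 'a) set" where
  "F_gr F W k p = F p \<inter> cpx (W k) + cpx (W (k - 1))"

definition mhs :: "'a::real_vector set \<Rightarrow> (int \<Rightarrow> ('a \<times> 'a) set) \<Rightarrow> (int \<Rightarrow> 'a set) \<Rightarrow> bool" where
  "mhs V F W \<longleftrightarrow> findim_subspace V \<and> dec_filtration (cpx V) {0} F \<and> inc_filtration V W \<and>
    (\<forall>k. pure_hodge (cpx (W k)) (cpx (W (k - 1))) k (F_gr F W k))"

text \<open>\<open>f\<close> induces an isomorphism from \<open>A/B\<close> to \<open>A'/B'\<close>.\<close>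

definition subquotient_iso ::
    "('a \<Rightarrow> 'a) \<Rightarrow> 'a set \<Rightarrow> 'a set \<Rightarrow> 'a set \<Rightarrow> 'a::real_vector set \<Rightarrow> bool" where
  "subquotient_iso f A B A' B' \<longleftrightarrow> f ` A \<subseteq> A' \<and> f ` B \<subseteq> B' \<and>
    (\<forall>x\<in>A. f x \<in> B' \<longrightarrow> x \<in> B) \<and> (\<forall>y\<in>A'. \<exists>x\<in>A. y - f x \<in> B')"

definition weight_filtration ::
    "'a::real_vector set \<Rightarrow> ('a \<Rightarrow> 'a) \<Rightarrow> int \<Rightarrow> (int \<Rightarrow> 'a set) \<Rightarrow> bool" where
  "weight_filtration V N w W \<longleftrightarrow> inc_filtration V W \<and> (\<forall>k. N ` W k \<subseteq> W (k - 2)) \<and>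
    (\<forall>l::nat. subquotient_iso (N ^^ l)
      (W (w + int l)) (W (w + int l - 1)) (W (w - int l)) (W (w - int l - 1)))"

text \<open>The preimages in \<open>W (w + l)\<close> of the complexified primitive subspace of weight \<open>w + l\<close> and,
  below, of the filtration that \<open>F\<close> induces on it.\<close>

definition prim :: "('a \<Rightarrow> 'a) \<Rightarrow> (int \<Rightarrow> 'a::real_vector set) \<Rightarrow> int \<Rightarrow> nat \<Rightarrow> ('a \<times> 'a) set" where
  "prim N W w l =
    {z \<in> cpx (W (w + int l)). (cmap N ^^ (l + 1)) z \<in> cpx (W (w - int l - 3))}"

definition F_prim :: "(int \<Rightarrow> ('a \<times> 'a::real_vector) set) \<Rightarrow> (int \<Rightarrow> 'a set) \<Rightarrow> ('a \<Rightarrow> 'a) \<Rightarrow>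
    int \<Rightarrow> nat \<Rightarrow> int \<Rightarrow> ('a \<times> 'a) set" where
  "F_prim F W N w l p = F_gr F W (w + int l) p \<inter> prim N W w l"

definition nondegenerate_on :: "'a::real_vector set \<Rightarrow> ('a \<Rightarrow> 'a \<Rightarrow> real) \<Rightarrow> bool" where
  "nondegenerate_on V S \<longleftrightarrow> (\<forall>x\<in>V. (\<forall>y\<in>V. S x y = 0) \<longrightarrow> x = 0)"

text \<open>In the last condition \<open>a\<close> is a representative of a class in the graded piece of weight \<open>w + l\<close>;
  the class is nonzero if and only if \<open>a\<close> is not in \<open>W (w + l - 1)\<close>.\<close>

definition pmhs :: "'a::real_vector set \<Rightarrow> int \<Rightarrow> (int \<Rightarrow> ('a \<times> 'a) set) \<Rightarrow> (int \<Rightarrow> 'a set) \<Rightarrow>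
    ('a \<Rightarrow> 'a) \<Rightarrow> ('a \<Rightarrow> 'a \<Rightarrow> real) \<Rightarrow> bool" where
  "pmhs V w F W N S \<longleftrightarrow>
    mhs V F W \<and> weight_filtration V N w W \<and>
    bilinear S \<and> nondegenerate_on V S \<and> (\<forall>x\<in>V. \<forall>y\<in>V. S y x = (-1) powi w * S x y) \<and>
    linear N \<and> N ` V \<subseteq> V \<and> nilpotent_on V N \<and> (\<forall>x\<in>V. \<forall>y\<in>V. S (N x) y + S x (N y) = 0) \<and>
    (\<forall>p. cmap N ` F p \<subseteq> F (p - 1)) \<and>
    (\<forall>p. \<forall>a\<in>F p. \<forall>b\<in>F (w + 1 - p). cform S a b = 0) \<and>
    (\<forall>l p. \<forall>a \<in> F_prim F W N w l p \<inter> cconj ` F_prim F W N w l (w + int l - p).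
      a \<notin> cpx (W (w + int l - 1)) \<longrightarrow>
      (\<exists>r>0. \<i> powi (2 * p - w - int l) * cform S a ((cmap N ^^ l) (cconj a)) = complex_of_real r))"


section \<open>Steenbrink (polarized) mixed Hodge structures\<close>

text \<open>The real space is the whole type \<open>'a\<close>, of finite dimension by \<^const>\<open>mhs\<close>.\<close>

definition steenbrink_mhs :: "int \<Rightarrow> (int \<Rightarrow> ('a \<times> 'a) set) \<Rightarrow> (int \<Rightarrow> 'a::real_vector set) \<Rightarrow>
    ('a \<Rightarrow> 'a) \<Rightarrow> ('a \<Rightarrow> 'a) \<Rightarrow> ('a \<Rightarrow> 'a) \<Rightarrow> bool" where
  "steenbrink_mhs m F W M Ms N \<longleftrightarrow>
    mhs UNIV F W \<and> linear M \<and> bij M \<and> (\<forall>k. M ` W k = W k) \<and> monodromy_parts UNIV M Ms N \<and>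
    (\<forall>p. cmap Ms ` F p \<subseteq> F p) \<and> (\<forall>p. cmap N ` F p \<subseteq> F (p - 1)) \<and>
    weight_filtration (real_pts (eigsp_ne1 Ms)) N m (\<lambda>k. W k \<inter> real_pts (eigsp_ne1 Ms)) \<and>
    weight_filtration (real_pts (eigsp Ms 1)) N (m + 1) (\<lambda>k. W k \<inter> real_pts (eigsp Ms 1))"

definition pmhs_restriction :: "'a::real_vector set \<Rightarrow> int \<Rightarrow> (int \<Rightarrow> ('a \<times> 'a) set) \<Rightarrow>
    (int \<Rightarrow> 'a set) \<Rightarrow> ('a \<Rightarrow> 'a) \<Rightarrow> ('a \<Rightarrow> 'a \<Rightarrow> real) \<Rightarrow> bool" where
  "pmhs_restriction V w F W N S \<longleftrightarrow> pmhs V w (\<lambda>p. F p \<inter> cpx V) (\<lambda>k. W k \<inter> V) N S"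

definition steenbrink_pmhs :: "int \<Rightarrow> (int \<Rightarrow> ('a \<times> 'a) set) \<Rightarrow> (int \<Rightarrow> 'a::real_vector set) \<Rightarrow>
    ('a \<Rightarrow> 'a) \<Rightarrow> ('a \<Rightarrow> 'a) \<Rightarrow> ('a \<Rightarrow> 'a) \<Rightarrow> ('a \<Rightarrow> 'a \<Rightarrow> real) \<Rightarrow> bool" where
  "steenbrink_pmhs m F W M Ms N S \<longleftrightarrow>
    steenbrink_mhs m F W M Ms N \<and>
    bilinear S \<and> nondegenerate_on UNIV S \<and> (\<forall>x y. S (M x) (M y) = S x y) \<and>
    pmhs_restriction (real_pts (eigsp_ne1 Ms)) m F W N S \<and>
    pmhs_restriction (real_pts (eigsp Ms 1)) (m + 1) F W N S"

definition deligne :: "(int \<Rightarrow> ('a \<times> 'a) set) \<Rightarrow> (int \<Rightarrow> 'a::real_vector set) \<Rightarrow> int \<Rightarrow> int \<Rightarrow> ('a \<times> 'a) set" where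
  "deligne F W p q =
    F p \<inter> cpx (W (p + q)) \<inter>
    cx.span ((cconj ` F q \<inter> cpx (W (p + q))) \<union>
      (\<Union>j\<in>{0<..}. cconj ` F (q - j) \<inter> cpx (W (p + q - j - 1))))"

definition split_mhs :: "(int \<Rightarrow> ('a \<times> 'a) set) \<Rightarrow> (int \<Rightarrow> 'a::real_vector set) \<Rightarrow> bool" where
  "split_mhs F W \<longleftrightarrow> (\<forall>p q. deligne F W q p = cconj ` deligne F W p q)"

definition ell :: "int \<Rightarrow> int \<Rightarrow> int \<Rightarrow> complex \<Rightarrow> int" where
  "ell m p q \<zeta> = p + q - m - theta \<zeta>"

text \<open>The \<open>\<zeta>\<close>-part of the primitive subspace of \<open>deligne F W p q\<close>. It is of interest only if \<open>0 \<le> ell m p q \<zeta>\<close>, otherwise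
  the formula gives \<open>{0}\<close>.\<close>

definition deligne0 :: "int \<Rightarrow> (int \<Rightarrow> ('a \<times> 'a) set) \<Rightarrow> (int \<Rightarrow> 'a::real_vector set) \<Rightarrow>
    ('a \<Rightarrow> 'a) \<Rightarrow> ('a \<Rightarrow> 'a) \<Rightarrow> int \<Rightarrow> int \<Rightarrow> complex \<Rightarrow> ('a \<times> 'a) set" where
  "deligne0 m F W Ms N p q \<zeta> =
    {a \<in> deligne F W p q \<inter> eigsp Ms \<zeta>. (cmap N ^^ nat (ell m p q \<zeta> + 1)) a = 0}"


section \<open>Isometric triples\<close>

definition isometric_triple :: "'a::real_vector set \<Rightarrow> ('a \<Rightarrow> 'a) \<Rightarrow> ('a \<Rightarrow> 'a \<Rightarrow> real) \<Rightarrow> bool" where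
  "isometric_triple V M S \<longleftrightarrow>
    findim_subspace V \<and> bilinear S \<and> nondegenerate_on V S \<and>
    ((\<forall>x\<in>V. \<forall>y\<in>V. S y x = S x y) \<or> (\<forall>x\<in>V. \<forall>y\<in>V. S y x = - S x y)) \<and>
    linear M \<and> M ` V = V \<and> (\<forall>x\<in>V. \<forall>y\<in>V. S (M x) (M y) = S x y)"

text \<open>\<open>V\<close> is the \<open>S\<close>-orthogonal direct sum of the isometric triples on the subspaces \<open>U i\<close>, \<open>i \<in> I\<close>.
  The form need not be symmetric or antisymmetric on all of \<open>V\<close>.\<close>

definition orth_decomp :: "'a::real_vector set \<Rightarrow> ('a \<Rightarrow> 'a) \<Rightarrow> ('a \<Rightarrow> 'a \<Rightarrow> real) \<Rightarrow>
    'i set \<Rightarrow> ('i \<Rightarrow> 'a set) \<Rightarrow> bool" where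
  "orth_decomp V M S I U \<longleftrightarrow>
    finite I \<and> (\<forall>i\<in>I. isometric_triple (U i) M S) \<and>
    V = span (\<Union>i\<in>I. U i) \<and>
    (\<forall>x. (\<forall>i\<in>I. x i \<in> U i) \<and> (\<Sum>i\<in>I. x i) = 0 \<longrightarrow> (\<forall>i\<in>I. x i = 0)) \<and>
    (\<forall>i\<in>I. \<forall>j\<in>I. i \<noteq> j \<longrightarrow> (\<forall>x\<in>U i. \<forall>y\<in>U j. S x y = 0))"

text \<open>Entries of the \<open>n \<times> n\<close> matrix \<open>E\<^sub>n\<^bsup>per\<^esup>\<close>, for indices in \<open>{1..n}\<close>.\<close>

definition Eper :: "nat \<Rightarrow> nat \<Rightarrow> nat \<Rightarrow> real" where
  "Eper n j k = (if j + k = n + 1 then (-1) ^ (j - 1) else 0)"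

text \<open>The isometric triple \<open>(V, M, S)\<close> is isomorphic to \<open>Tr(\<zeta>,1,n,\<epsilon>)\<close>.\<close>

definition is_Tr1 :: "'a::real_vector set \<Rightarrow> ('a \<Rightarrow> 'a) \<Rightarrow> ('a \<Rightarrow> 'a \<Rightarrow> real) \<Rightarrow>
    real \<Rightarrow> nat \<Rightarrow> real \<Rightarrow> bool" where
  "is_Tr1 V M S \<zeta> n \<epsilon> \<longleftrightarrow>
    isometric_triple V M S \<and> \<zeta> \<in> {1, -1} \<and> \<epsilon> \<in> {1, -1} \<and> 1 \<le> n \<and>
    (\<exists>Ms N a. monodromy_parts V M Ms N \<and>
      inj_on a {1..n} \<and> independent (a ` {1..n}) \<and> span (a ` {1..n}) = V \<and>
      (\<forall>x\<in>V. Ms x = \<zeta> *\<^sub>R x) \<and>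
      (\<forall>k\<in>{1..n}. N (a k) = (if k < n then a (k + 1) else 0)) \<and>
      (\<forall>j\<in>{1..n}. \<forall>k\<in>{1..n}. S (a j) (a k) = \<epsilon> * Eper n j k))"

text \<open>The isometric triple \<open>(V, M, S)\<close> is isomorphic to \<open>Tr(\<zeta>,2,n,\<mu>,\<epsilon>)\<close>; \<open>H\<close> is \<open>H\<^bsup>(1)\<^esup>\<close>.\<close>

definition is_Tr2 :: "'a::real_vector set \<Rightarrow> ('a \<Rightarrow> 'a) \<Rightarrow> ('a \<Rightarrow> 'a \<Rightarrow> real) \<Rightarrow>
    complex \<Rightarrow> nat \<Rightarrow> nat \<Rightarrow> real \<Rightarrow> bool" where
  "is_Tr2 V M S \<zeta> n \<mu> \<epsilon> \<longleftrightarrow>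
    isometric_triple V M S \<and> cmod \<zeta> = 1 \<and> \<mu> \<in> {0, 1} \<and> \<epsilon> \<in> {1, -1} \<and> 1 \<le> n \<and> dim V = 2 * n \<and>
    (\<exists>Ms N H a. monodromy_parts V M Ms N \<and>
      cx.subspace H \<and> H + cconj ` H = cpx V \<and> H \<inter> cconj ` H = {0} \<and>
      inj_on a {1..n} \<and> cx.independent (a ` {1..n}) \<and> cx.span (a ` {1..n}) = H \<and>
      (\<forall>z\<in>H. cmap Ms z = cscale \<zeta> z) \<and> (\<forall>z\<in>cconj ` H. cmap Ms z = cscale (cnj \<zeta>) z) \<and>
      (\<forall>k\<in>{1..n}. cmap N (a k) = (if k < n then a (k + 1) else 0) \<and>
        cmap N (cconj (a k)) = (if k < n then cconj (a (k + 1)) else 0)) \<and>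
      (\<forall>j\<in>{1..n}. \<forall>k\<in>{1..n}.
        cform S (a j) (a k) = 0 \<and> cform S (cconj (a j)) (cconj (a k)) = 0 \<and>
        cform S (a j) (cconj (a k)) = \<i> ^ (n + \<mu> + 1) * of_real (\<epsilon> * Eper n j k) \<and>
        cform S (cconj (a j)) (a k) =
          \<i> ^ (n + \<mu> + 1) * of_real (\<epsilon> * (-1) ^ (n + \<mu> + 1) * Eper n j k)))"


section \<open>The pieces of the decomposition\<close>

definition spaceB :: "int \<Rightarrow> (int \<Rightarrow> ('a \<times> 'a) set) \<Rightarrow> (int \<Rightarrow> 'a::real_vector set) \<Rightarrow>
    ('a \<Rightarrow> 'a) \<Rightarrow> ('a \<Rightarrow> 'a) \<Rightarrow> int \<Rightarrow> complex \<Rightarrow> ('a \<times> 'a) set" where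
  "spaceB m F W Ms N p \<zeta> =
    cx.span (\<Union>j\<in>{..nat (ell m p p \<zeta>)}. (cmap N ^^ j) ` deligne0 m F W Ms N p p \<zeta>)"

definition spaceA :: "int \<Rightarrow> (int \<Rightarrow> ('a \<times> 'a) set) \<Rightarrow> (int \<Rightarrow> 'a::real_vector set) \<Rightarrow>
    ('a \<Rightarrow> 'a) \<Rightarrow> ('a \<Rightarrow> 'a) \<Rightarrow> int \<Rightarrow> int \<Rightarrow> complex \<Rightarrow> ('a \<times> 'a) set" where
  "spaceA m F W Ms N p q \<zeta> =
    cx.span ((\<Union>j\<in>{..nat (ell m p q \<zeta>)}. (cmap N ^^ j) ` deligne0 m F W Ms N p q \<zeta>) \<union>
             (\<Union>j\<in>{..nat (ell m p q \<zeta>)}. (cmap N ^^ j) ` deligne0 m F W Ms N q p (cnj \<zeta>)))"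

definition indexA :: "int \<Rightarrow> (int \<Rightarrow> ('a \<times> 'a) set) \<Rightarrow> (int \<Rightarrow> 'a::real_vector set) \<Rightarrow>
    ('a \<Rightarrow> 'a) \<Rightarrow> ('a \<Rightarrow> 'a) \<Rightarrow> (int \<times> int \<times> complex) set" where
  "indexA m F W Ms N =
    {(p, q, \<zeta>). 0 \<le> ell m p q \<zeta> \<and> deligne0 m F W Ms N p q \<zeta> \<noteq> {0} \<and>
      (p, \<zeta>) \<noteq> (q, cnj \<zeta>) \<and> 0 \<le> Im ((-1) powi (m + 1) * \<zeta>)}"

text \<open>One representative of each pair \<open>(p, q, \<zeta>)\<close>, \<open>(q, p, \<zeta>)\<close> with \<open>\<zeta>\<close> real; then \<open>p \<noteq> q\<close>.\<close>

definition indexA_once :: "int \<Rightarrow> (int \<Rightarrow> ('a \<times> 'a) set) \<Rightarrow> (int \<Rightarrow> 'a::real_vector set) \<Rightarrow>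
    ('a \<Rightarrow> 'a) \<Rightarrow> ('a \<Rightarrow> 'a) \<Rightarrow> (int \<times> int \<times> complex) set" where
  "indexA_once m F W Ms N = {(p, q, \<zeta>) \<in> indexA m F W Ms N. \<zeta> \<in> \<real> \<longrightarrow> p < q}"

definition indexB :: "int \<Rightarrow> (int \<Rightarrow> ('a \<times> 'a) set) \<Rightarrow> (int \<Rightarrow> 'a::real_vector set) \<Rightarrow>
    ('a \<Rightarrow> 'a) \<Rightarrow> ('a \<Rightarrow> 'a) \<Rightarrow> (int \<times> complex) set" where
  "indexB m F W Ms N =
    {(p, \<zeta>). 0 \<le> ell m p p \<zeta> \<and> \<zeta> \<in> {1, -1} \<and> deligne0 m F W Ms N p p \<zeta> \<noteq> {0}}"

text \<open>For \<open>\<zeta>\<close> on the unit circle there is exactly one such number.\<close>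

definition alpha :: "int \<Rightarrow> int \<Rightarrow> complex \<Rightarrow> real" where
  "alpha m p \<zeta> = (THE \<alpha>. exp (- 2 * of_real pi * \<i> * of_real \<alpha>) = \<zeta> \<and> \<lfloor>of_int m - \<alpha>\<rfloor> = p)"

text \<open>In both exponents the division by 2 is exact.\<close>

definition signA :: "int \<Rightarrow> int \<Rightarrow> complex \<Rightarrow> real" where
  "signA m p \<zeta> = (-1) powi (\<lceil>alpha m p \<zeta>\<rceil> - 1 - (m - theta \<zeta> + (m + theta \<zeta>) mod 2) div 2)"

definition signB :: "int \<Rightarrow> int \<Rightarrow> complex \<Rightarrow> real" where
  "signB m p \<zeta> = (-1) powi (\<lceil>alpha m p \<zeta>\<rceil> - (m - theta \<zeta> - ell m p p \<zeta>) div 2)"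

end

theory Submission
  imports Defs
begin

text \<open>
The splitting assumption turns Deligne's subspace of type \<open>(p, q)\<close> into the intersection of \<open>F\<^sup>p\<close>,
of the conjugate of \<open>F\<^sup>q\<close> and of the weight \<open>p + q\<close> part (\<open>deligne_eq\<close>), so that conjugation
exchanges the types \<open>(p, q)\<close> and \<open>(q, p)\<close>. These subspaces still span everything, because
Deligne's lifting argument produces an element of the subspace in every class of the right Hodge type
(\<open>deligne_lift\<close>), and the powers of \<open>N\<close> that are bijective from one graded piece to
another are also surjective between these subspaces. Hence the whole space is spanned by the strings
\<open>a, N a, ..., N\<^sup>l a\<close> that start at primitive vectors \<open>a\<close> (\<open>primitive_span\<close>). The filtrations are compatible with the
eigenspaces of the semisimple part of \<open>M\<close> (\<open>eigen_graded_stable\<close>), so \<open>a\<close> can be chosen to be an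
eigenvector, of eigenvalue \<open>\<zeta>\<close> say (\<open>strings_span\<close>).

The form is then computed on strings. Pairings of \<open>F\<^sup>p\<close> with \<open>F\<^sup>q\<close> vanish for \<open>p + q\<close> larger than the
weight, the same holds for the conjugate filtration, a string of length \<open>l + 1\<close> is killed by
\<open>N\<^sup>l\<^sup>+\<^sup>1\<close>, and eigenvalues have to be inverse to each other. Together these constraints only leave the
pairings of \<open>N\<^sup>i a\<close> with \<open>N\<^sup>j b\<close> where \<open>a\<close> has type \<open>(p, q, \<zeta>)\<close>, \<open>b\<close> has the conjugate type
and \<open>i + j = l\<close> (\<open>D_pairing\<close>). For \<open>b\<close> the conjugate of \<open>a\<close> the polarization fixes the phase of this
number (\<open>D_positive\<close>), which forces \<open>\<zeta>\<close> to lie on the unit circle and determines the sign of the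
isometric triple. So the summands for different pairs of conjugate types are orthogonal, and inside one
summand a basis of the primitive space that is orthonormal for the hermitian form given by the
polarization splits it into single strings together with their conjugates
(\<open>blockA_decomposition\<close>). If \<open>p = q\<close> and \<open>\<zeta>\<close> is real, then the basis can be taken real and one
string suffices (\<open>blockB_decomposition\<close>).

Independence of vectors, directness of sums, and finiteness of the set of types are all read off from
nonzero pairings, by means of dual families.
\<close>

section \<open>Dual families and orthonormal bases\<close>

context vector_space
begin

text \<open>The functional with index \<open>k\<close> isolates the \<open>k\<close>-th coefficient of a linear combination of the
  vectors \<open>g\<close>. In applications the functionals are pairings with other vectors, so this gives both
  independence and nondegeneracy.\<close>

lemma dual_family:
  fixes g :: "'k \<Rightarrow> 'b" and \<phi> :: "'k \<Rightarrow> 'b \<Rightarrow> 'a"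
  assumes K: "finite K"
    and add: "\<And>k x y. k \<in> K \<Longrightarrow> \<phi> k (x + y) = \<phi> k x + \<phi> k y"
    and hom: "\<And>k a x. k \<in> K \<Longrightarrow> \<phi> k (scale a x) = a * \<phi> k x"
    and dual: "\<And>k k'. k \<in> K \<Longrightarrow> k' \<in> K \<Longrightarrow> \<phi> k' (g k) = (if k = k' then c k else 0)"
    and c: "\<And>k. k \<in> K \<Longrightarrow> c k \<noteq> 0"
  shows "inj_on g K" "independent (g ` K)"
    "\<And>z. z \<in> span (g ` K) \<Longrightarrow> (\<And>k. k \<in> K \<Longrightarrow> \<phi> k z = 0) \<Longrightarrow> z = 0"
proof -
  show inj: "inj_on g K"
    by (rule inj_onI) (metis dual c)
  have zero: "\<phi> j 0 = 0" if "j \<in> K" for j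
    using hom[OF that, of 0 0] by simp
  have sum: "\<phi> j (sum f A) = (\<Sum>i\<in>A. \<phi> j (f i))" if "j \<in> K" for j A and f :: "'k \<Rightarrow> 'b"
    by (induction A rule: infinite_finite_induct) (auto simp: zero add that)
  have coeff: "\<phi> j (\<Sum>k\<in>K. scale (u k) (g k)) = u j * c j" if "j \<in> K" for u j
  proof -
    have "\<phi> j (\<Sum>k\<in>K. scale (u k) (g k)) = (\<Sum>k\<in>K. if k = j then u j * c j else 0)"
      unfolding sum[OF that] using dual that
      by (intro sum.cong) (auto simp: hom)
    then show ?thesis using K that by simp
  qed
  show "independent (g ` K)"
    unfolding independent_explicit_finite_subsets
  proof (intro allI impI ballI)
    fix A u v assume A: "A \<subseteq> g ` K" "finite A" "(\<Sum>v\<in>A. scale (u v) v) = 0" "v \<in> A"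
    have "(\<Sum>v\<in>A. scale (u v) v) = (\<Sum>v\<in>g ` K. scale (if v \<in> A then u v else 0) v)"
      using A K by (intro sum.mono_neutral_cong_left) auto
    also have "\<dots> = (\<Sum>k\<in>K. scale (if g k \<in> A then u (g k) else 0) (g k))"
      using sum.reindex[OF inj] by (simp add: o_def)
    finally have 0: "(\<Sum>k\<in>K. scale (if g k \<in> A then u (g k) else 0) (g k)) = 0" using A by simp
    obtain j where j: "j \<in> K" "v = g j" using A by auto
    show "u v = 0"
      using coeff[OF j(1), of "\<lambda>k. if g k \<in> A then u (g k) else 0"] 0 j A(4) c[OF j(1)]
      by (simp add: zero)
  qed
  fix z assume z: "z \<in> span (g ` K)" "\<And>k. k \<in> K \<Longrightarrow> \<phi> k z = 0"
  obtain u where "z = (\<Sum>v\<in>g ` K. scale (u v) v)"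
    using z(1) span_finite[of "g ` K"] K by auto
  then have "z = (\<Sum>k\<in>K. scale (u (g k)) (g k))"
    using sum.reindex[OF inj] by (simp add: o_def)
  moreover have "u (g j) = 0" if "j \<in> K" for j
    using z(2)[OF that] coeff[OF that, of "\<lambda>k. u (g k)"] calculation c[OF that] by simp
  ultimately show "z = 0" by simp
qed

text \<open>Gram-Schmidt, for a form that is only linear in its first argument. This covers real scalar
  products and hermitian forms at the same time.\<close>

lemma orthonormal_basis:
  fixes h :: "'b \<Rightarrow> 'b \<Rightarrow> 'a"
  assumes B: "finite B" "U = span B"
    and add: "\<And>x y z. h (x + y) z = h x z + h y z"
    and hom: "\<And>a x z. h (scale a x) z = a * h x z"
    and sym: "\<And>x y. x \<in> U \<Longrightarrow> y \<in> U \<Longrightarrow> h x y = 0 \<Longrightarrow> h y x = 0"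
    and norm: "\<And>x. x \<in> U \<Longrightarrow> x \<noteq> 0 \<Longrightarrow> \<exists>a. h (scale a x) (scale a x) = 1"
  obtains e where "\<And>i. i < dim U \<Longrightarrow> e i \<in> U" "span (e ` {..<dim U}) = U"
    "\<And>i j. i < dim U \<Longrightarrow> j < dim U \<Longrightarrow> h (e i) (e j) = (if i = j then 1 else 0)"
proof -
  have hsum: "h (sum f A) z = (\<Sum>i\<in>A. h (f i) z)" for A z and f :: "nat \<Rightarrow> 'b"
    using hom[of 0 0 z] by (induction A rule: infinite_finite_induct) (auto simp: add)
  have sub: "subspace U" using B by simp
  have "\<exists>(n::nat) e. (\<forall>i<n. e i \<in> U) \<and> (\<forall>i<n. \<forall>j<n. h (e i) (e j) = (if i = j then 1 else 0)) \<and>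
      span (e ` {..<n}) = span A" if "finite A" "A \<subseteq> U" for A
    using that
  proof (induction A rule: finite_induct)
    case empty
    show ?case by (intro exI[of _ 0] exI[of _ "\<lambda>_. 0"]) auto
  next
    case (insert v A)
    then obtain n and e :: "nat \<Rightarrow> 'b" where e: "\<And>i. i < n \<Longrightarrow> e i \<in> U"
      "\<And>i j. i < n \<Longrightarrow> j < n \<Longrightarrow> h (e i) (e j) = (if i = j then 1 else 0)"
      "span (e ` {..<n}) = span A" unfolding insert_subset by blast
    define s where "s = (\<Sum>i<n. scale (h v (e i)) (e i))"
    have s: "s \<in> span A"
      unfolding s_def e(3)[symmetric] by (intro span_sum span_scale span_base) auto
    then have "s \<in> U" using span_minimal[OF _ sub] insert.prems by auto
    then have vU: "v - s \<in> U" using insert.prems by (auto intro: subspace_diff[OF sub])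
    have hvs: "h (v - s) (e j) = 0" if "j < n" for j
    proof -
      have "h s (e j) = (\<Sum>i<n. if i = j then h v (e j) else 0)"
        unfolding s_def hsum using e(2) that by (intro sum.cong) (auto simp: hom)
      then have "h s (e j) = h v (e j)" using that by simp
      moreover have "h (v - s) (e j) = h v (e j) - h s (e j)"
        using add[of "v - s" s "e j"] by simp
      ultimately show ?thesis by simp
    qed
    show ?case
    proof (cases "v = s")
      case True
      then have "span (insert v A) = span A" using s by (simp add: span_redundant)
      then show ?thesis using e by (intro exI[of _ n] exI[of _ e]) auto
    next
      case False
      then obtain a where a: "h (scale a (v - s)) (scale a (v - s)) = 1"
        using norm[OF vU] by auto
      \<comment> \<open>the next orthonormal vector: \<open>v\<close> minus its projection to the span of \<open>A\<close>, normalized\<close>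
      define f where "f = scale a (v - s)"
      have "a \<noteq> 0" using a hom[of 0 "v - s" "0"] by auto
      have fU: "f \<in> U" unfolding f_def by (rule subspace_scale[OF sub vU])
      have hf: "h f (e j) = 0" "h (e j) f = 0" if "j < n" for j
      proof -
        show 0: "h f (e j) = 0" unfolding f_def hom using hvs[OF that] by simp
        show "h (e j) f = 0" using sym[OF fU e(1)[OF that] 0] .
      qed
      have img: "e(n := f) ` {..<Suc n} = insert f (e ` {..<n})"
        by (auto simp: lessThan_Suc)
      have "span (insert f (e ` {..<n})) = span (insert v A)"
      proof
        have sA: "s \<in> span (insert v A)" using s span_mono[of A "insert v A"] by auto
        have "f \<in> span (insert v A)"
          unfolding f_def by (intro span_scale span_diff sA) (simp add: span_base)
        moreover have "e ` {..<n} \<subseteq> span (insert v A)"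
          using e(3) span_mono[of A "insert v A"] span_superset[of "e ` {..<n}"] by auto
        ultimately show "span (insert f (e ` {..<n})) \<subseteq> span (insert v A)"
          by (intro span_minimal) auto
        let ?T = "span (insert f (e ` {..<n}))"
        have AT: "span A \<subseteq> ?T" unfolding e(3)[symmetric] by (rule span_mono) auto
        have "scale (inverse a) f \<in> ?T" by (intro span_scale span_base) simp
        then have "v - s \<in> ?T" using \<open>a \<noteq> 0\<close> by (simp add: f_def)
        then have "v - s + s \<in> ?T" using s AT by (intro span_add) auto
        then show "span (insert v A) \<subseteq> ?T"
          using AT span_superset[of A] by (intro span_minimal) auto
      qed
      with img have sp: "span (e(n := f) ` {..<Suc n}) = span (insert v A)" by simp
      have on: "h ((e(n := f)) i) ((e(n := f)) j) = (if i = j then 1 else 0)"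
        if "i < Suc n" "j < Suc n" for i j
        using that hf e(2) a by (auto simp: f_def less_Suc_eq)
      show ?thesis
        using e(1) fU on sp by (intro exI[of _ "Suc n"] exI[of _ "e(n := f)"]) (auto simp: less_Suc_eq)
    qed
  qed
  from this[OF B(1)] obtain n and e :: "nat \<Rightarrow> 'b" where e: "\<And>i. i < n \<Longrightarrow> e i \<in> U"
    "\<And>i j. i < n \<Longrightarrow> j < n \<Longrightarrow> h (e i) (e j) = (if i = j then 1 else 0)"
    "span (e ` {..<n}) = U"
    using span_superset[of B] unfolding B(2) by blast
  have ind: "inj_on e {..<n}" "independent (e ` {..<n})"
    using dual_family[of "{..<n}" "\<lambda>k x. h x (e k)" e "\<lambda>_. 1"] e(2) by (auto simp: add hom)
  have "dim U = card (e ` {..<n})"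
    using dim_span_eq_card_independent[OF ind(2)] e(3) by simp
  then have "dim U = n" using ind(1) by (simp add: card_image)
  with e that show ?thesis by auto
qed

end

section \<open>Complexification\<close>

lemma cmap_eq: "cmap f z = (f (fst z), f (snd z))"
  by (simp add: cmap_def map_prod_def split_beta)

lemma cmap_add: "linear f \<Longrightarrow> cmap f (x + y) = cmap f x + cmap f y"
  by (simp add: cmap_eq linear_add)

lemma cmap_diff: "linear f \<Longrightarrow> cmap f (x - y) = cmap f x - cmap f y"
  by (simp add: cmap_eq linear_diff)

lemma cmap_zero: "linear f \<Longrightarrow> cmap f 0 = 0"
  by (simp add: cmap_eq linear_0 zero_prod_def)

lemma cmap_cscale: "linear f \<Longrightarrow> cmap f (cscale c x) = cscale c (cmap f x)"
  by (simp add: cmap_eq cscale_def linear_add linear_diff linear_scale)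

lemma cmap_funpow: "(cmap f ^^ k) z = cmap (f ^^ k) z"
  by (induction k) (auto simp: cmap_eq)

lemma linear_funpow: "linear (f :: 'a::real_vector \<Rightarrow> 'a) \<Longrightarrow> linear (f ^^ k)"
  by (induction k) (auto simp: linear_compose linear_id[unfolded id_def] id_def)

lemma cconj_cconj [simp]: "cconj (cconj z) = z"
  by (simp add: cconj_def)

lemma cconj_add: "cconj (x + y) = cconj x + cconj y"
  by (simp add: cconj_def)

lemma cconj_diff: "cconj (x - y) = cconj x - cconj y"
  by (simp add: cconj_def)

lemma cconj_zero [simp]: "cconj 0 = 0"
  by (simp add: cconj_def zero_prod_def)

lemma cconj_cscale: "cconj (cscale c z) = cscale (cnj c) (cconj z)"
  by (simp add: cconj_def cscale_def)

lemma cconj_cmap: "linear f \<Longrightarrow> cconj (cmap f z) = cmap f (cconj z)"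
  by (simp add: cconj_def cmap_eq linear_neg)

lemma cconj_funpow: "linear f \<Longrightarrow> cconj ((cmap f ^^ k) z) = (cmap f ^^ k) (cconj z)"
  by (simp add: cmap_funpow cconj_cmap linear_funpow)

lemma cconj_image_iff: "z \<in> cconj ` A \<longleftrightarrow> cconj z \<in> A"
  by (metis cconj_cconj image_eqI imageE)

lemma cpx_iff: "z \<in> cpx V \<longleftrightarrow> fst z \<in> V \<and> snd z \<in> V"
  by (simp add: cpx_def mem_Times_iff)

lemma cpx_UNIV [simp]: "cpx UNIV = UNIV"
  by (simp add: cpx_def)

lemma cpx_mono: "V \<subseteq> V' \<Longrightarrow> cpx V \<subseteq> cpx V'"
  by (auto simp: cpx_def)

lemma subspace_cpx: "subspace V \<Longrightarrow> cx.subspace (cpx V)"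
  by (rule cx.subspaceI)
    (auto simp: cpx_iff cscale_def subspace_0 subspace_add subspace_diff subspace_scale)

lemma cconj_cpx: "subspace V \<Longrightarrow> z \<in> cpx V \<Longrightarrow> cconj z \<in> cpx V"
  by (simp add: cpx_iff cconj_def subspace_neg)

lemma subspace_cconj: "cx.subspace C \<Longrightarrow> cx.subspace (cconj ` C)"
  by (rule cx.subspaceI)
    (auto simp: cconj_image_iff cconj_add cconj_cscale cx.subspace_0 cx.subspace_add cx.subspace_scale)

lemma subspace_vimage: "linear f \<Longrightarrow> cx.subspace C \<Longrightarrow> cx.subspace {z. cmap f z \<in> C}"
  by (rule cx.subspaceI)
    (auto simp: cmap_zero cmap_add cmap_cscale cx.subspace_0 cx.subspace_add cx.subspace_scale)

lemma cx_subspace_real: "cx.subspace C \<Longrightarrow> subspace C"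
proof (rule subspaceI)
  fix c :: real and x assume "cx.subspace C" "x \<in> C"
  then have "cscale (of_real c) x \<in> C"
    by (rule cx.subspace_scale)
  then show "c *\<^sub>R x \<in> C"
    by (simp add: cscale_def scaleR_prod_def)
qed (auto simp: cx.subspace_0 cx.subspace_add)

text \<open>A complex subspace is defined over the reals as soon as it is closed under conjugation.\<close>

definition conj_stable :: "('a \<times> 'a::real_vector) set \<Rightarrow> bool" where
  "conj_stable C \<longleftrightarrow> (\<forall>z\<in>C. cconj z \<in> C)"

lemma real_pts_iff: "x \<in> real_pts C \<longleftrightarrow> (x, 0) \<in> C"
  by (simp add: real_pts_def)

lemma subspace_real_pts:
  assumes "cx.subspace C"
  shows "subspace (real_pts C)"
proof (rule subspaceI)
  have C: "subspace C" by (rule cx_subspace_real[OF assms])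
  show "0 \<in> real_pts C"
    using subspace_0[OF C] by (simp add: real_pts_iff zero_prod_def)
  show "x + y \<in> real_pts C" if "x \<in> real_pts C" "y \<in> real_pts C" for x y
    using subspace_add[OF C, of "(x, 0)" "(y, 0)"] that by (simp add: real_pts_iff)
  show "c *\<^sub>R x \<in> real_pts C" if "x \<in> real_pts C" for c x
    using subspace_scale[OF C, of "(x, 0)" c] that by (simp add: real_pts_iff)
qed

lemma conj_stable_parts:
  assumes "cx.subspace C" "conj_stable C" "z \<in> C"
  shows "fst z \<in> real_pts C" "snd z \<in> real_pts C"
proof -
  have c: "cconj z \<in> C" using assms by (simp add: conj_stable_def)
  have "cscale (1/2) (z + cconj z) \<in> C"
    using assms c by (simp add: cx.subspace_add cx.subspace_scale)
  moreover have "cscale (1/2) (z + cconj z) = (fst z, 0)"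
    by (simp add: prod_eq_iff cscale_def cconj_def flip: scaleR_2)
  ultimately show "fst z \<in> real_pts C" by (simp add: real_pts_iff)
  have "cscale (-\<i>/2) (z - cconj z) \<in> C"
    using assms c by (simp add: cx.subspace_diff cx.subspace_scale cx.subspace_neg)
  moreover have "cscale (-\<i>/2) (z - cconj z) = (snd z, 0)"
    by (simp add: prod_eq_iff cscale_def cconj_def flip: scaleR_2)
  ultimately show "snd z \<in> real_pts C" by (simp add: real_pts_iff)
qed

lemma cpx_real_pts:
  assumes "cx.subspace C" "conj_stable C"
  shows "cpx (real_pts C) = C"
proof
  show "C \<subseteq> cpx (real_pts C)"
    using conj_stable_parts[OF assms] by (auto simp: cpx_iff)
  show "cpx (real_pts C) \<subseteq> C"
  proof
    fix z assume z: "z \<in> cpx (real_pts C)"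
    then have "(fst z, 0) + cscale \<i> (snd z, 0) \<in> C"
      using assms by (intro cx.subspace_add cx.subspace_scale) (auto simp: cpx_iff real_pts_iff)
    then show "z \<in> C"
      by (simp add: cscale_def)
  qed
qed

lemma real_pts_cpx: "subspace V \<Longrightarrow> real_pts (cpx V) = V"
  by (auto simp: real_pts_iff cpx_iff subspace_0)

lemma span_conj_stable:
  assumes "\<And>g. g \<in> G \<Longrightarrow> cconj g \<in> cx.span G"
  shows "conj_stable (cx.span G)"
proof -
  have "cx.span G \<subseteq> cconj ` cx.span G"
    using assms by (intro cx.span_minimal subspace_cconj) (auto simp: cconj_image_iff)
  then show ?thesis
    by (auto simp: conj_stable_def cconj_image_iff)
qed

lemma cconj_span: "cconj ` cx.span G = cx.span (cconj ` G)"
proof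
  have "cx.span G \<subseteq> cconj ` cx.span (cconj ` G)"
    by (intro cx.span_minimal subspace_cconj) (auto simp: cconj_image_iff intro!: cx.span_base)
  then show "cconj ` cx.span G \<subseteq> cx.span (cconj ` G)"
    by (auto simp: cconj_image_iff)
  show "cx.span (cconj ` G) \<subseteq> cconj ` cx.span G"
    by (intro cx.span_minimal subspace_cconj) (auto intro!: cx.span_base)
qed

lemma span_map_stable:
  assumes "linear f" "\<And>g. g \<in> G \<Longrightarrow> cmap f g \<in> cx.span G" "z \<in> cx.span G"
  shows "cmap f z \<in> cx.span G"
proof -
  have "cx.span G \<subseteq> {z. cmap f z \<in> cx.span G}"
    using assms by (intro cx.span_minimal subspace_vimage) auto
  then show ?thesis using assms by auto
qed

lemma findim_subset:
  assumes "findim_subspace (UNIV :: 'a set)" "subspace (V :: 'a::real_vector set)"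
  shows "findim_subspace V"
proof -
  obtain B0 where B0: "finite B0" "(UNIV :: 'a set) = span B0"
    using assms by (auto simp: findim_subspace_def)
  obtain B where B: "B \<subseteq> V" "independent B" "V \<subseteq> span B" "card B = dim V"
    by (rule basis_exists)
  have "finite B"
    using independent_span_bound[OF B0(1) B(2)] by (simp flip: B0(2))
  moreover have "V = span B"
    using B span_minimal[OF B(1) assms(2)] by auto
  ultimately show ?thesis by (auto simp: findim_subspace_def)
qed

lemma cx_span_real_basis:
  assumes "V = span B"
  shows "cpx V = cx.span ((\<lambda>b. (b, 0)) ` B)"
proof
  let ?G = "(\<lambda>b. (b, 0)) ` B"
  have "cx.subspace (cpx V)" using assms by (simp add: subspace_cpx)
  then show "cx.span ?G \<subseteq> cpx V"
    using assms by (intro cx.span_minimal) (auto simp: cpx_iff span_base span_zero)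
  have cs: "conj_stable (cx.span ?G)"
    by (rule span_conj_stable) (auto simp: cconj_def intro: cx.span_base)
  have "V \<subseteq> real_pts (cx.span ?G)"
    unfolding assms
    by (intro span_minimal subspace_real_pts) (auto simp: real_pts_iff intro!: cx.span_base)
  then have "cpx V \<subseteq> cpx (real_pts (cx.span ?G))"
    by (rule cpx_mono)
  also have "\<dots> = cx.span ?G"
    using cs by (intro cpx_real_pts) auto
  finally show "cpx V \<subseteq> cx.span ?G" .
qed

text \<open>The real and imaginary parts of the coefficients of a complex relation between real vectors
  are two real relations.\<close>

lemma cx_independent_real:
  assumes "independent B"
  shows "cx.independent ((\<lambda>b. (b, 0)) ` B)"
proof -
  show ?thesis
  proof (subst cx.independent_explicit_module, intro allI impI)
    fix t u v
    assume t: "finite t" "t \<subseteq> (\<lambda>b. (b, 0)) ` B" "(\<Sum>v\<in>t. cscale (u v) v) = 0" "v \<in> t"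
    then obtain T where T: "T \<subseteq> B" "finite T" "t = (\<lambda>b. (b, 0)) ` T"
      by (meson finite_subset_image)
    have iT: "inj_on (\<lambda>b::'a. (b, 0::'a)) T" by (auto intro: inj_onI)
    have "(\<Sum>v\<in>t. cscale (u v) v) = (\<Sum>b\<in>T. cscale (u (b, 0)) (b, 0))"
      using T(3) sum.reindex[OF iT, of "\<lambda>v. cscale (u v) v"] by (simp add: o_def)
    then have s: "(\<Sum>b\<in>T. cscale (u (b, 0)) (b, 0)) = 0" using t by simp
    have s1: "(\<Sum>b\<in>T. Re (u (b, 0)) *\<^sub>R b) = 0"
      using arg_cong[OF s, of fst] by (simp add: fst_sum cscale_def)
    have s2: "(\<Sum>b\<in>T. Im (u (b, 0)) *\<^sub>R b) = 0"
      using arg_cong[OF s, of snd] by (simp add: snd_sum cscale_def)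
    obtain b where b: "b \<in> T" "v = (b, 0)" using t T by auto
    have "Re (u (b, 0)) = 0"
      using independentD[OF assms, of T "\<lambda>b. Re (u (b, 0))" b] T b s1 by simp
    moreover have "Im (u (b, 0)) = 0"
      using independentD[OF assms, of T "\<lambda>b. Im (u (b, 0))" b] T b s2 by simp
    ultimately show "u v = 0" using b by (simp add: complex_eq_iff)
  qed
qed

lemma dim_cpx: "dim V = cx.dim (cpx V)" if "subspace V"
proof -
  obtain B where B: "B \<subseteq> V" "independent B" "V \<subseteq> span B" "card B = dim V"
    by (rule basis_exists)
  have VB: "V = span B" using B span_minimal[OF B(1) that] by auto
  have "cx.dim (cpx V) = card ((\<lambda>b. (b, 0::'a)) ` B)"
    using cx_span_real_basis[OF VB] cx_independent_real[OF B(2)]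
    by (metis cx.dim_span_eq_card_independent)
  also have "\<dots> = card B"
    by (rule card_image) (auto intro: inj_onI)
  finally show ?thesis using B by simp
qed

section \<open>The complexified form\<close>

lemma cform_add_left: "bilinear S \<Longrightarrow> cform S (x + y) z = cform S x z + cform S y z"
  and cform_add_right: "bilinear S \<Longrightarrow> cform S z (x + y) = cform S z x + cform S z y"
  by (simp_all add: cform_def bilinear_ladd bilinear_radd bilinear_rsub complex_eq_iff)

lemma cform_scale_left: "bilinear S \<Longrightarrow> cform S (cscale c x) z = c * cform S x z"
  and cform_scale_right: "bilinear S \<Longrightarrow> cform S z (cscale c x) = c * cform S z x"
  by (simp_all add: cform_def cscale_def bilinear_ladd bilinear_radd bilinear_lsub bilinear_rsub
      bilinear_lmul bilinear_rmul complex_eq_iff algebra_simps)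

lemma cform_zero_left: "bilinear S \<Longrightarrow> cform S 0 z = 0"
  and cform_zero_right: "bilinear S \<Longrightarrow> cform S z 0 = 0"
  by (simp_all add: cform_def bilinear_lzero bilinear_rzero complex_eq_iff)

lemma cform_sum_left: "bilinear S \<Longrightarrow> cform S (sum g A) z = (\<Sum>i\<in>A. cform S (g i) z)"
  by (induction A rule: infinite_finite_induct) (auto simp: cform_zero_left cform_add_left)

lemma cform_cconj: "bilinear S \<Longrightarrow> cform S (cconj x) (cconj y) = cnj (cform S x y)"
  by (simp add: cform_def cconj_def bilinear_lneg bilinear_rneg complex_eq_iff)

lemma cform_real: "bilinear S \<Longrightarrow> cform S (x, 0) (y, 0) = of_real (S x y)"
  by (simp add: cform_def bilinear_lzero bilinear_rzero complex_eq_iff)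

lemma cform_span_zero:
  assumes "bilinear S" "\<And>x y. x \<in> A \<Longrightarrow> y \<in> B \<Longrightarrow> cform S x y = 0"
    and "x \<in> cx.span A" "y \<in> cx.span B"
  shows "cform S x y = 0"
proof -
  have 1: "cx.span B \<subseteq> {y. cform S x y = 0}" if "x \<in> A" for x
    using assms(1) assms(2)[OF that]
    by (intro cx.span_minimal cx.subspaceI)
      (auto simp: cform_zero_right cform_add_right cform_scale_right)
  have "cx.span A \<subseteq> {x. cform S x y = 0}"
    using assms(1,4) 1
    by (intro cx.span_minimal cx.subspaceI subsetI)
      (auto simp: cform_zero_left cform_add_left cform_scale_left)
  then show ?thesis using assms by auto
qed

definition cnondeg :: "('a \<Rightarrow> 'a \<Rightarrow> real) \<Rightarrow> ('a \<times> 'a::real_vector) set \<Rightarrow> bool" where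
  "cnondeg S C \<longleftrightarrow> (\<forall>z\<in>C. (\<forall>y\<in>C. cform S z y = 0) \<longrightarrow> z = 0)"

lemma span_Union_sum:
  assumes "finite I" "\<And>i. i \<in> I \<Longrightarrow> cx.subspace (C i)" "z \<in> cx.span (\<Union>i\<in>I. C i)"
  obtains c where "\<And>i. i \<in> I \<Longrightarrow> c i \<in> C i" "z = (\<Sum>i\<in>I. c i)"
proof -
  let ?T = "{z. \<exists>c. (\<forall>i\<in>I. c i \<in> C i) \<and> z = (\<Sum>i\<in>I. c i)}"
  have "cx.span (\<Union>i\<in>I. C i) \<subseteq> ?T"
  proof (rule cx.span_minimal)
    show "cx.subspace ?T"
    proof (rule cx.subspaceI)
      show "0 \<in> ?T"
        using assms by (auto simp: cx.subspace_0 intro!: exI[of _ "\<lambda>_. 0"])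
      show "x + y \<in> ?T" if xy: "x \<in> ?T" "y \<in> ?T" for x y
      proof -
        obtain c c' where "\<forall>i\<in>I. c i \<in> C i" "x = sum c I" "\<forall>i\<in>I. c' i \<in> C i" "y = sum c' I"
          using xy by auto
        then show ?thesis
          using assms by (auto simp: cx.subspace_add sum.distrib intro!: exI[of _ "\<lambda>i. c i + c' i"])
      qed
      show "cscale a x \<in> ?T" if x: "x \<in> ?T" for a x
      proof -
        obtain c where "\<forall>i\<in>I. c i \<in> C i" "x = sum c I"
          using x by auto
        then show ?thesis
          using assms
          by (auto simp: cx.subspace_scale cx.scale_sum_right intro!: exI[of _ "\<lambda>i. cscale a (c i)"])
      qed
    qed
    show "(\<Union>i\<in>I. C i) \<subseteq> ?T"
    proof clarify
      fix i z assume "i \<in> I" "z \<in> C i"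
      then show "\<exists>c. (\<forall>i\<in>I. c i \<in> C i) \<and> z = sum c I"
        using assms by (intro exI[of _ "\<lambda>j. if j = i then z else 0"]) (auto simp: cx.subspace_0)
    qed
  qed
  with assms(3) that show ?thesis by auto
qed

lemma cnondeg_span_Union:
  assumes S: "bilinear S" and I: "finite I" "\<And>i. i \<in> I \<Longrightarrow> cx.subspace (C i)"
    and nd: "\<And>i. i \<in> I \<Longrightarrow> cnondeg S (C i)"
    and orth: "\<And>i j x y. i \<in> I \<Longrightarrow> j \<in> I \<Longrightarrow> i \<noteq> j \<Longrightarrow> x \<in> C i \<Longrightarrow> y \<in> C j \<Longrightarrow> cform S x y = 0"
  shows "cnondeg S (cx.span (\<Union>i\<in>I. C i))"
  unfolding cnondeg_def
proof (intro ballI impI)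
  fix z assume z: "z \<in> cx.span (\<Union>i\<in>I. C i)" "\<forall>y\<in>cx.span (\<Union>i\<in>I. C i). cform S z y = 0"
  obtain c where c: "\<And>i. i \<in> I \<Longrightarrow> c i \<in> C i" "z = (\<Sum>i\<in>I. c i)"
    using span_Union_sum[OF I z(1)] by metis
  have "c j = 0" if j: "j \<in> I" for j
  proof -
    have "cform S (c j) y = 0" if y: "y \<in> C j" for y
    proof -
      have "0 = cform S z y" using z(2) y j by (auto intro: cx.span_base)
      also have "\<dots> = (\<Sum>i\<in>I. if i = j then cform S (c j) y else 0)"
        unfolding c(2) cform_sum_left[OF S] using orth c(1) j y by (intro sum.cong) auto
      also have "\<dots> = cform S (c j) y" using I j by simp
      finally show ?thesis by simp
    qed
    then show ?thesis using nd[OF j] c(1)[OF j] by (auto simp: cnondeg_def)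
  qed
  then show "z = 0" using c(2) by simp
qed

text \<open>Directness of an orthogonal sum follows from nondegeneracy of the summands.\<close>

lemma orth_decompI:
  assumes S: "bilinear S" and I: "finite I"
    and C: "\<And>i. i \<in> I \<Longrightarrow> cx.subspace (C i)" "\<And>i. i \<in> I \<Longrightarrow> conj_stable (C i)"
    and iso: "\<And>i. i \<in> I \<Longrightarrow> isometric_triple (real_pts (C i)) M S"
    and orth: "\<And>i j x y. i \<in> I \<Longrightarrow> j \<in> I \<Longrightarrow> i \<noteq> j \<Longrightarrow> x \<in> C i \<Longrightarrow> y \<in> C j \<Longrightarrow> cform S x y = 0"
    and D: "D = cx.span (\<Union>i\<in>I. C i)"
  shows "orth_decomp (real_pts D) M S I (\<lambda>i. real_pts (C i))"
  unfolding orth_decomp_def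
proof (intro conjI ballI allI impI)
  have orthR: "S x y = 0" if "i \<in> I" "j \<in> I" "i \<noteq> j" "x \<in> real_pts (C i)" "y \<in> real_pts (C j)"
    for i j x y
    using orth[OF that(1-3), of "(x, 0)" "(y, 0)"] that by (auto simp: real_pts_iff cform_real[OF S])
  let ?U = "\<Union>i\<in>I. real_pts (C i)"
  show "finite I" by (rule I)
  show "real_pts D = span ?U"
  proof
    have "D \<subseteq> cpx (span ?U)"
      unfolding D
    proof (intro cx.span_minimal subspace_cpx subspace_span subsetI)
      fix z assume "z \<in> (\<Union>i\<in>I. C i)"
      then obtain i where i: "i \<in> I" "z \<in> C i" by auto
      then show "z \<in> cpx (span ?U)"
        using conj_stable_parts[OF C(1)[OF i(1)] C(2)[OF i(1)] i(2)]
        by (auto simp: cpx_iff intro: span_base)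
    qed
    then show "real_pts D \<subseteq> span ?U" by (auto simp: real_pts_iff cpx_iff)
    show "span ?U \<subseteq> real_pts D"
      unfolding D by (intro span_minimal subspace_real_pts) (auto simp: real_pts_iff intro!: cx.span_base)
  qed
  show "isometric_triple (real_pts (C i)) M S" if "i \<in> I" for i using iso that .
  show "S x y = 0" if "i \<in> I" "j \<in> I" "i \<noteq> j" "x \<in> real_pts (C i)" "y \<in> real_pts (C j)"
    for i j x y using orthR that .
  fix x j assume x: "(\<forall>i\<in>I. x i \<in> real_pts (C i)) \<and> (\<Sum>i\<in>I. x i) = 0" and j: "j \<in> I"
  have "S (x j) y = 0" if y: "y \<in> real_pts (C j)" for y
  proof -
    have "0 = S (\<Sum>i\<in>I. x i) y" using x by (simp add: bilinear_lzero[OF S])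
    also have "\<dots> = (\<Sum>i\<in>I. S (x i) y)"
      using S linear_sum[of "\<lambda>x. S x y" x I] by (simp add: bilinear_def)
    also have "\<dots> = (\<Sum>i\<in>I. if i = j then S (x j) y else 0)"
      using orthR x j y by (intro sum.cong) auto
    also have "\<dots> = S (x j) y" using I j by simp
    finally show ?thesis by simp
  qed
  then show "x j = 0"
    using iso[OF j] x j by (auto simp: isometric_triple_def nondegenerate_on_def)
qed

section \<open>Split mixed Hodge structures with a weight filtration\<close>

text \<open>This is Deligne's subspace if the structure is split. The conjugate filtration is expressed
  by conjugating the element.\<close>

definition hodge_piece ::
    "(int \<Rightarrow> ('a \<times> 'a::real_vector) set) \<Rightarrow> (int \<Rightarrow> 'a set) \<Rightarrow> int \<Rightarrow> int \<Rightarrow> ('a \<times> 'a) set" where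
  "hodge_piece F W p q = {z \<in> F p. cconj z \<in> F q \<and> z \<in> cpx (W (p + q))}"

text \<open>With \<open>l = p + q - w\<close> the condition is \<open>N\<^sup>l\<^sup>+\<^sup>1 z = 0\<close>; for \<open>l < - 1\<close> the exponent is
  truncated to \<open>0\<close> and the piece is zero.\<close>

definition prim_piece :: "(int \<Rightarrow> ('a \<times> 'a::real_vector) set) \<Rightarrow> (int \<Rightarrow> 'a set) \<Rightarrow>
    ('a \<Rightarrow> 'a) \<Rightarrow> int \<Rightarrow> int \<Rightarrow> int \<Rightarrow> ('a \<times> 'a) set" where
  "prim_piece F W N w p q = {z \<in> hodge_piece F W p q. (cmap N ^^ nat (p + q - w + 1)) z = 0}"

text \<open>The last assumption is what the splitting of the whole structure leaves on a subspace such as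
  the generalized eigenspaces of the monodromy.\<close>

locale split_mhs_weight =
  fixes V :: "'a::real_vector set" and F :: "int \<Rightarrow> ('a \<times> 'a) set" and W :: "int \<Rightarrow> 'a set"
    and N :: "'a \<Rightarrow> 'a" and w :: int
  assumes mhs: "mhs V F W" and lin: "linear N" and wf: "weight_filtration V N w W"
    and N_F: "z \<in> F p \<Longrightarrow> cmap N z \<in> F (p - 1)"
    and split: "z \<in> deligne F W p q \<Longrightarrow> cconj z \<in> F q"
begin

abbreviation G :: "int \<Rightarrow> ('a \<times> 'a) set" where "G k \<equiv> cpx (W k)"
abbreviation I :: "int \<Rightarrow> int \<Rightarrow> ('a \<times> 'a) set" where "I \<equiv> hodge_piece F W"

lemma F_filtration: "dec_filtration (cpx V) {0} F" and W_filtration: "inc_filtration V W"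
  using mhs by (auto simp: mhs_def)

lemma F_subspace: "cx.subspace (F p)"
  using F_filtration by (simp add: dec_filtration_def)

lemma F_antimono: "z \<in> F q \<Longrightarrow> p \<le> q \<Longrightarrow> z \<in> F p"
  using F_filtration unfolding dec_filtration_def antimono_def by blast

lemma W_subspace: "subspace (W k)"
  using W_filtration by (simp add: inc_filtration_def)

lemma G_subspace: "cx.subspace (G k)"
  by (rule subspace_cpx[OF W_subspace])

lemma G_mono: "z \<in> G j \<Longrightarrow> j \<le> k \<Longrightarrow> z \<in> G k"
  using W_filtration cpx_mono[of "W j" "W k"] by (auto simp: inc_filtration_def mono_def)

lemma G_cconj: "z \<in> G k \<Longrightarrow> cconj z \<in> G k"
  by (rule cconj_cpx[OF W_subspace])

lemma G_bottom: obtains k0 where "\<And>k z. k \<le> k0 \<Longrightarrow> z \<in> G k \<Longrightarrow> z = 0"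
proof -
  obtain k0 where "W k0 = {0}" using W_filtration by (auto simp: inc_filtration_def)
  then have "z = 0" if "k \<le> k0" "z \<in> G k" for k z
    using G_mono[OF that(2,1)] by (simp add: cpx_iff prod_eq_iff)
  then show ?thesis by (rule that)
qed

lemma G_top: obtains k1 where "\<And>k. k1 \<le> k \<Longrightarrow> G k = cpx V"
proof -
  obtain k1 where k1: "W k1 = V" using W_filtration by (auto simp: inc_filtration_def)
  have "W k = V" if "k1 \<le> k" for k
  proof -
    have "W k1 \<subseteq> W k" "W k \<subseteq> V"
      using W_filtration that by (auto simp: inc_filtration_def mono_def)
    with k1 show ?thesis by auto
  qed
  then show ?thesis by (intro that[of k1]) simp
qed

lemma V_subspace: "subspace V"
  using W_filtration by (auto simp: inc_filtration_def)

lemma F_gr_iff: "z \<in> F_gr F W k p \<longleftrightarrow> (\<exists>a c. a \<in> F p \<and> a \<in> G k \<and> c \<in> G (k - 1) \<and> z = a + c)"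
  unfolding F_gr_def set_plus_def by blast

text \<open>The two halves of purity of the graded pieces, for representatives.\<close>

lemma pure_sum:
  assumes "z \<in> G k"
  obtains a b c where "z = a + b + c" "a \<in> F p" "a \<in> G k" "cconj b \<in> F (k + 1 - p)" "b \<in> G k"
    "c \<in> G (k - 1)"
proof -
  have "F_gr F W k p + cconj ` F_gr F W k (k + 1 - p) = G k"
    using mhs by (auto simp: mhs_def pure_hodge_def)
  then obtain x y where xy: "z = x + y" "x \<in> F_gr F W k p" "cconj y \<in> F_gr F W k (k + 1 - p)"
    using assms unfolding set_plus_def cconj_image_iff[symmetric] by blast
  obtain a c where a: "x = a + c" "a \<in> F p" "a \<in> G k" "c \<in> G (k - 1)"
    using xy(2) by (auto simp: F_gr_iff)
  obtain b d where b: "cconj y = b + d" "b \<in> F (k + 1 - p)" "b \<in> G k" "d \<in> G (k - 1)"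
    using xy(3) by (auto simp: F_gr_iff)
  have "y = cconj b + cconj d"
    by (metis b(1) cconj_add cconj_cconj)
  then show ?thesis
    using a b xy(1)
    by (intro that[of a "cconj b" "c + cconj d"])
      (auto simp: cx.subspace_add[OF G_subspace] G_cconj algebra_simps)
qed

lemma pure_int:
  assumes "a \<in> F p" "a \<in> G k" "cconj b \<in> F (k + 1 - p)" "b \<in> G k" "a - b \<in> G (k - 1)"
  shows "a \<in> G (k - 1)"
proof -
  have "F_gr F W k p \<inter> cconj ` F_gr F W k (k + 1 - p) = G (k - 1)"
    using mhs by (auto simp: mhs_def pure_hodge_def)
  moreover have "a \<in> F_gr F W k p"
    using assms cx.subspace_0[OF G_subspace]
    unfolding F_gr_iff by (intro exI[of _ a] exI[of _ 0]) auto
  moreover have "cconj a \<in> F_gr F W k (k + 1 - p)"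
  proof -
    have "cconj a = cconj b + cconj (a - b)" by (simp add: cconj_diff)
    then show ?thesis
      using assms G_cconj
      unfolding F_gr_iff by (intro exI[of _ "cconj b"] exI[of _ "cconj (a - b)"]) auto
  qed
  ultimately show ?thesis by (auto simp: cconj_image_iff)
qed

lemma piece_subspace: "cx.subspace (I p q)"
proof -
  have "I p q = F p \<inter> cconj ` F q \<inter> G (p + q)"
    by (auto simp: hodge_piece_def cconj_image_iff)
  then show ?thesis
    by (simp only:) (intro cx.subspace_inter F_subspace G_subspace subspace_cconj)
qed

text \<open>On a graded piece of weight less than \<open>p + q\<close>, the filtration step \<open>F\<^sup>p\<close> and the conjugate of
  \<open>F\<^sup>q\<close> meet in zero by purity, so the weight of \<open>z\<close> can be lowered until nothing is left.\<close>

lemma piece_weight: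
  assumes "z \<in> F p" "cconj z \<in> F q" "z \<in> G j" "j < p + q"
  shows "z = 0"
proof -
  obtain k0 where k0: "\<And>k z. k \<le> k0 \<Longrightarrow> z \<in> G k \<Longrightarrow> z = 0" using G_bottom by metis
  have "z \<in> G (j - int n)" for n
  proof (induction n)
    case (Suc n)
    have "cconj z \<in> F (j - int n + 1 - p)" using assms by (auto intro: F_antimono)
    with Suc assms pure_int[of z p "j - int n" z] cx.subspace_0[OF G_subspace]
    show ?case by (simp add: algebra_simps)
  qed (use assms in simp)
  from this[of "nat (j - k0)"] show ?thesis
    by (intro k0[of "j - int (nat (j - k0))"]) auto
qed

text \<open>A vector of \<open>F p\<close> whose class in the graded piece of weight \<open>p + q\<close> also lies in the conjugate of
  \<open>F q\<close> can be corrected, one weight at a time, to an element of Deligne's subspace with the same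
  class. It is here that the definition of that subspace is used.\<close>

lemma deligne_lift:
  assumes x: "x \<in> F p" "x \<in> G (p + q)" and y: "cconj y \<in> F q" "y \<in> G (p + q)"
    and xy: "x - y \<in> G (p + q - 1)"
  obtains z where "z \<in> I p q" "x - z \<in> G (p + q - 1)"
proof -
  define D where "D = cx.span ((cconj ` F q \<inter> G (p + q)) \<union>
      (\<Union>j\<in>{0<..}. cconj ` F (q - j) \<inter> G (p + q - j - 1)))"
  obtain k0 where k0: "\<And>k z. k \<le> k0 \<Longrightarrow> z \<in> G k \<Longrightarrow> z = 0" using G_bottom by metis
  have "\<exists>x' y'. x' \<in> F p \<and> x' \<in> G (p + q) \<and> x - x' \<in> G (p + q - 1) \<and> y' \<in> D \<and>
      x' - y' \<in> G (p + q - 1 - int n)" for n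
  proof (induction n)
    case 0
    have "y \<in> D" unfolding D_def using y by (intro cx.span_base) (auto simp: cconj_image_iff)
    with x xy cx.subspace_0[OF G_subspace] show ?case by (intro exI[of _ x] exI[of _ y]) simp
  next
    case (Suc n)
    then obtain x' y' where 1: "x' \<in> F p" "x' \<in> G (p + q)" "x - x' \<in> G (p + q - 1)" "y' \<in> D"
      "x' - y' \<in> G (p + q - 1 - int n)" by auto
    obtain a b c where 2: "x' - y' = a + b + c" "a \<in> F p" "a \<in> G (p + q - 1 - int n)"
      "cconj b \<in> F (p + q - 1 - int n + 1 - p)" "b \<in> G (p + q - 1 - int n)"
      "c \<in> G (p + q - 1 - int n - 1)"
      using pure_sum[OF 1(5), of p] by metis
    \<comment> \<open>the error in weight \<open>p + q - 1\<close> is absorbed by the first generator of \<open>D\<close>, the later ones by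
      the generator with \<open>j = n\<close>\<close>
    have b: "b \<in> D"
    proof (cases "n = 0")
      case True
      then have "cconj b \<in> F q" "b \<in> G (p + q)" using 2 by (auto intro: G_mono)
      then show ?thesis unfolding D_def by (intro cx.span_base) (auto simp: cconj_image_iff)
    next
      case False
      have "b \<in> cconj ` F (q - int n) \<inter> G (p + q - int n - 1)"
        using 2 by (auto simp: cconj_image_iff algebra_simps)
      then have "b \<in> (\<Union>j\<in>{0<..}. cconj ` F (q - j) \<inter> G (p + q - j - 1))"
        using False by (intro UN_I[of "int n"]) auto
      then show ?thesis unfolding D_def by (intro cx.span_base) auto
    qed
    have "x' - a \<in> F p" using 1 2 by (simp add: cx.subspace_diff[OF F_subspace])
    moreover have "a \<in> G (p + q)" using 2 by (auto intro: G_mono)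
    then have "x' - a \<in> G (p + q)" using 1 by (simp add: cx.subspace_diff[OF G_subspace])
    moreover have "a \<in> G (p + q - 1)" using 2(3) by (rule G_mono) simp
    then have "(x - x') + a \<in> G (p + q - 1)" using 1 by (intro cx.subspace_add[OF G_subspace])
    then have "x - (x' - a) \<in> G (p + q - 1)" by (simp add: algebra_simps)
    moreover have "y' + b \<in> D" using 1(4) b unfolding D_def by (rule cx.span_add)
    moreover have "x' - a - (y' + b) = c" using 2(1) by (simp add: algebra_simps)
    then have "x' - a - (y' + b) \<in> G (p + q - 1 - int (Suc n))"
      using 2(6) by (simp add: algebra_simps)
    ultimately show ?case by blast
  qed
  from this[of "nat (p + q - 1 - k0)"] obtain x' y' where
    1: "x' \<in> F p" "x' \<in> G (p + q)" "x - x' \<in> G (p + q - 1)" "y' \<in> D"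
      "x' - y' \<in> G (p + q - 1 - int (nat (p + q - 1 - k0)))" by blast
  have "x' - y' = 0" by (rule k0[OF _ 1(5)]) simp
  then have "x' \<in> deligne F W p q"
    using 1 unfolding deligne_def D_def by auto
  then have "x' \<in> I p q"
    using 1 split by (auto simp: hodge_piece_def)
  then show ?thesis using that 1(3) by blast
qed

text \<open>By induction on the weight, and within one weight by descending induction on \<open>p\<close>: purity splits
  off a part in \<open>F\<^sup>p\<^sup>+\<^sup>1\<close>, and what remains has pure type and lifts to a piece modulo lower weight.\<close>

lemma weight_span_pieces: "G k \<subseteq> cx.span (\<Union>p q. I p q)"
proof -
  let ?T = "cx.span (\<Union>p q. I p q)"
  obtain k0 where k0: "\<And>k z. k \<le> k0 \<Longrightarrow> z \<in> G k \<Longrightarrow> z = 0" using G_bottom by metis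
  obtain p0 where p0: "F p0 = cpx V" using F_filtration by (auto simp: dec_filtration_def)
  obtain p1 where p1: "F p1 = {0}" using F_filtration by (auto simp: dec_filtration_def)
  have "G (k0 + int n) \<subseteq> ?T" for n
  proof (induction n)
    case 0
    then show ?case using k0[of k0] cx.span_zero by fastforce
  next
    case (Suc n)
    let ?k = "k0 + int (Suc n)"
    have step: "F p \<inter> G ?k \<subseteq> ?T" if "F (p + 1) \<inter> G ?k \<subseteq> ?T" for p
    proof
      fix x assume x: "x \<in> F p \<inter> G ?k"
      obtain a b c where 1: "x = a + b + c" "a \<in> F (p + 1)" "a \<in> G ?k" "cconj b \<in> F (?k + 1 - (p + 1))"
        "b \<in> G ?k" "c \<in> G (?k - 1)"
        using pure_sum[of x ?k "p + 1"] x by blast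
      have "x - a \<in> F p" using x F_antimono[OF 1(2)] by (intro cx.subspace_diff[OF F_subspace]) auto
      moreover have "x - a \<in> G ?k" using x 1 by (intro cx.subspace_diff[OF G_subspace]) auto
      moreover have "x - a - b = c" using 1 by simp
      ultimately obtain z where z: "z \<in> I p (?k - p)" "x - a - z \<in> G (?k - 1)"
        using deligne_lift[of "x - a" p "?k - p" b] 1 by (auto simp: algebra_simps)
      have "a \<in> ?T" using that 1 by auto
      moreover have "z \<in> ?T" using z by (intro cx.span_base) auto
      moreover have "x - a - z \<in> ?T" using z Suc by auto
      ultimately have "a + z + (x - a - z) \<in> ?T" by (intro cx.span_add)
      then show "x \<in> ?T" by simp
    qed
    have "F (p1 - int i) \<inter> G ?k \<subseteq> ?T" for i
    proof (induction i)
      case 0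
      then show ?case using p1 cx.span_zero by auto
    next
      case (Suc i)
      then show ?case using step[of "p1 - int (Suc i)"] by (simp add: algebra_simps)
    qed
    from this[of "nat (p1 - p0)"] have "F p0 \<inter> G ?k \<subseteq> ?T"
      using F_antimono[of _ p0 "p1 - int (nat (p1 - p0))"]
        F_filtration p0 by (auto simp: dec_filtration_def)
    moreover have "G ?k \<subseteq> F p0"
      using W_filtration unfolding p0 by (intro cpx_mono) (auto simp: inc_filtration_def)
    ultimately show ?case by auto
  qed
  from this[of "nat (k - k0)"] show ?thesis
    by (rule order_trans[rotated]) (auto intro: G_mono)
qed

lemma N_G: "z \<in> G k \<Longrightarrow> (cmap N ^^ l) z \<in> G (k - 2 * int l)"
proof (induction l)
  case (Suc l)
  have "N ` W j \<subseteq> W (j - 2)" for j using wf by (simp add: weight_filtration_def)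
  from this[of "k - 2 * int l"] Suc show ?case
    by (auto simp: cpx_iff cmap_eq algebra_simps)
qed simp

lemma N_F_pow: "z \<in> F p \<Longrightarrow> (cmap N ^^ l) z \<in> F (p - int l)"
proof (induction l)
  case (Suc l)
  then show ?case using N_F[of _ "p - int l"] by (simp add: algebra_simps)
qed simp

lemma N_piece:
  assumes "z \<in> I p q" shows "(cmap N ^^ l) z \<in> I (p - int l) (q - int l)"
  using assms N_F_pow N_G[of z "p + q" l]
  by (auto simp: hodge_piece_def cconj_funpow[OF lin] algebra_simps)

lemma N_inj:
  assumes "z \<in> G (w + int l)" "(cmap N ^^ l) z \<in> G (w - int l - 1)"
  shows "z \<in> G (w + int l - 1)"
  using assms wf
  by (auto simp: weight_filtration_def subquotient_iso_def cpx_iff cmap_funpow cmap_eq)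

lemma N_surj:
  assumes "y \<in> G (w - int l)"
  obtains x where "x \<in> G (w + int l)" "y - (cmap N ^^ l) x \<in> G (w - int l - 1)"
proof -
  have "\<exists>x\<in>W (w + int l). y - (N ^^ l) x \<in> W (w - int l - 1)" if "y \<in> W (w - int l)" for y
    using wf that by (auto simp: weight_filtration_def subquotient_iso_def)
  then obtain x1 x2 where "x1 \<in> W (w + int l)" "fst y - (N ^^ l) x1 \<in> W (w - int l - 1)"
    "x2 \<in> W (w + int l)" "snd y - (N ^^ l) x2 \<in> W (w - int l - 1)"
    using assms by (metis cpx_iff)
  then show ?thesis
    by (intro that[of "(x1, x2)"]) (auto simp: cpx_iff cmap_funpow cmap_eq)
qed

text \<open>The isomorphisms between the graded pieces respect the Hodge decomposition, because an element
  whose Hodge types are off is mapped to one whose types are off, hence to zero.\<close>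

lemma N_surj_filtered:
  assumes x: "x \<in> G (w + int l)" and y: "y \<in> F (p - int l)" "y \<in> G (w - int l)"
    and xy: "y - (cmap N ^^ l) x \<in> G (w - int l - 1)"
  obtains a where "a \<in> F p" "a \<in> G (w + int l)" "x - a \<in> G (w + int l - 1)"
proof -
  note Nl = linear_funpow[OF lin, of l]
  obtain a b c where 1: "x = a + b + c" "a \<in> F p" "a \<in> G (w + int l)"
    "cconj b \<in> F (w + int l + 1 - p)" "b \<in> G (w + int l)" "c \<in> G (w + int l - 1)"
    using pure_sum[OF x, of p] by metis
  let ?f = "cmap N ^^ l"
  have fa: "?f a \<in> F (p - int l)" "?f a \<in> G (w - int l)"
    using N_F_pow[OF 1(2)] N_G[OF 1(3), of l] by auto
  have fb: "?f b \<in> G (w - int l)" using N_G[OF 1(5), of l] by auto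
  have fbc: "cconj (?f b) \<in> F (w - int l + 1 - (p - int l))"
    using N_F_pow[OF 1(4), of l] by (simp add: cconj_funpow[OF lin] algebra_simps)
  have fc: "?f c \<in> G (w - int l - 1)" using N_G[OF 1(6), of l] by (simp add: algebra_simps)
  have "y - ?f a - ?f b = (y - ?f x) + ?f c"
    unfolding 1(1) by (simp add: cmap_funpow cmap_add[OF Nl])
  then have d: "y - ?f a - ?f b \<in> G (w - int l - 1)"
    using cx.subspace_add[OF G_subspace xy fc] by (simp only:)
  have "y - ?f a \<in> G (w - int l - 1)"
    using y fa
    by (intro pure_int[OF _ _ fbc fb d] cx.subspace_diff[OF F_subspace] cx.subspace_diff[OF G_subspace])
  then have "?f b \<in> G (w - int l - 1)"
    using cx.subspace_diff[OF G_subspace _ d, of "y - ?f a"] by simp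
  then have "b \<in> G (w + int l - 1)" by (rule N_inj[OF 1(5)])
  then have "x - a \<in> G (w + int l - 1)"
    using cx.subspace_add[OF G_subspace _ 1(6), of b] 1(1) by (simp add: algebra_simps)
  then show ?thesis using that 1 by blast
qed

text \<open>Surjectivity on graded pieces gives a preimage up to lower weight. By the previous lemma, applied
  to \<open>F\<close> and to its conjugate, the class of the preimage has type \<open>(p, q)\<close>, so it lifts to a piece;
  the remaining error has type \<open>(p - l, q - l)\<close> but too low a weight, so it vanishes.\<close>

lemma N_surj_pieces:
  assumes pq: "p + q = w + int l" and y: "y \<in> I (p - int l) (q - int l)"
  obtains x where "x \<in> I p q" "(cmap N ^^ l) x = y"
proof -
  note Nl = linear_funpow[OF lin, of l]
  have y': "y \<in> F (p - int l)" "cconj y \<in> F (q - int l)" "y \<in> G (w - int l)"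
    using y pq by (auto simp: hodge_piece_def algebra_simps)
  obtain x where x: "x \<in> G (w + int l)" "y - (cmap N ^^ l) x \<in> G (w - int l - 1)"
    using N_surj[OF y'(3)] by metis
  obtain a where a: "a \<in> F p" "a \<in> G (w + int l)" "x - a \<in> G (w + int l - 1)"
    using N_surj_filtered[OF x(1) y'(1,3) x(2)] by metis
  have "cconj y - (cmap N ^^ l) (cconj x) \<in> G (w - int l - 1)"
    using G_cconj[OF x(2)] by (simp add: cconj_diff cconj_funpow[OF lin])
  then obtain b where b: "b \<in> F q" "b \<in> G (w + int l)" "cconj x - b \<in> G (w + int l - 1)"
    using N_surj_filtered[OF G_cconj[OF x(1)] y'(2) G_cconj[OF y'(3)]] by metis
  have "x - cconj b \<in> G (w + int l - 1)"
    using G_cconj[OF b(3)] by (simp add: cconj_diff)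
  from cx.subspace_diff[OF G_subspace this a(3)] have "a - cconj b \<in> G (w + int l - 1)" by simp
  then obtain z where z: "z \<in> I p q" "a - z \<in> G (w + int l - 1)"
    using deligne_lift[of a p q "cconj b"] a b G_cconj[OF b(2)] pq by auto
  have "x - z \<in> G (w + int l - 1)"
    using cx.subspace_add[OF G_subspace a(3) z(2)] by simp
  from N_G[OF this, of l] have "(cmap N ^^ l) x - (cmap N ^^ l) z \<in> G (w - int l - 1)"
    by (simp add: cmap_funpow cmap_diff[OF Nl] algebra_simps)
  from cx.subspace_add[OF G_subspace x(2) this]
  have "y - (cmap N ^^ l) z \<in> G (w - int l - 1)" by simp
  moreover have "y - (cmap N ^^ l) z \<in> I (p - int l) (q - int l)"
    by (intro cx.subspace_diff[OF piece_subspace] y N_piece z)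
  ultimately have "y - (cmap N ^^ l) z = 0"
    using pq by (intro piece_weight[of _ "p - int l" "q - int l" "w - int l - 1"])
      (auto simp: hodge_piece_def)
  then show ?thesis using that[OF z(1)] by simp
qed

text \<open>Lefschetz decomposition, by descending induction on the weight. Below the middle weight every
  vector is in the image of a power of \<open>N\<close>. Above it, \<open>N\<^sup>l\<^sup>+\<^sup>1 z\<close> equals \<open>N\<^sup>l\<^sup>+\<^sup>2 x\<close> for some \<open>x\<close> of higher
  weight, and then \<open>z - N x\<close> is primitive.\<close>

lemma primitive_span:
  "cpx V \<subseteq> cx.span (\<Union>(p, q) \<in> {(p, q). w \<le> p + q}. \<Union>j \<in> {..nat (p + q - w)}.
      (cmap N ^^ j) ` prim_piece F W N w p q)" (is "_ \<subseteq> cx.span ?P")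
proof -
  obtain k1 where k1: "\<And>k. k1 \<le> k \<Longrightarrow> G k = cpx V" using G_top by metis
  have N_T: "cmap N z \<in> cx.span ?P" if "z \<in> cx.span ?P" for z
  proof (rule span_map_stable[OF lin _ that])
    fix g assume "g \<in> ?P"
    then obtain p q j z where g: "w \<le> p + q" "j \<le> nat (p + q - w)" "z \<in> prim_piece F W N w p q"
      "g = (cmap N ^^ j) z" by auto
    show "cmap N g \<in> cx.span ?P"
    proof (cases "Suc j \<le> nat (p + q - w)")
      case True
      have "cmap N g = (cmap N ^^ Suc j) z" using g by simp
      then show ?thesis using g True by (intro cx.span_base) blast
    next
      case False
      then have "Suc j = nat (p + q - w + 1)" using g by auto
      then have "cmap N g = 0"
        using g by (metis (mono_tags, lifting) comp_apply funpow.simps(2) mem_Collect_eq prim_piece_def)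
      then show ?thesis by (simp add: cx.span_zero)
    qed
  qed
  have N_T_pow: "(cmap N ^^ l) z \<in> cx.span ?P" if "z \<in> cx.span ?P" for z l
    by (induction l) (auto simp: that N_T)
  have pieces: "I p q \<subseteq> cx.span ?P" if "nat (k1 - p - q) \<le> n" "n = 0 \<longrightarrow> k1 < p + q" for n p q
    using that
  proof (induction n arbitrary: p q)
    case 0
    show ?case
    proof
      fix z assume z: "z \<in> I p q"
      have "z \<in> G (p + q - 1)" using z k1[of "p + q - 1"] k1[of "p + q"] 0 by (auto simp: hodge_piece_def)
      with z have "z = 0" by (intro piece_weight[of z p q "p + q - 1"]) (auto simp: hodge_piece_def)
      then show "z \<in> cx.span ?P" by (simp add: cx.span_zero)
    qed
  next
    case (Suc n)
    show ?case
    proof (cases "w \<le> p + q")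
      case True
      define l where "l = nat (p + q - w)"
      have pq: "p + q = w + int l" using True by (simp add: l_def)
      then have pq': "p + 1 + (q + 1) = w + int (l + 2)" by simp
      have up: "I (p + 1) (q + 1) \<subseteq> cx.span ?P"
        using Suc.prems by (intro Suc.IH) auto
      show ?thesis
      proof
        fix z assume z: "z \<in> I p q"
        have "(cmap N ^^ (l + 1)) z \<in> I ((p + 1) - int (l + 2)) ((q + 1) - int (l + 2))"
          using N_piece[OF z, of "l + 1"] by (simp add: algebra_simps)
        then obtain x where x: "x \<in> I (p + 1) (q + 1)" "(cmap N ^^ (l + 2)) x = (cmap N ^^ (l + 1)) z"
          by (rule N_surj_pieces[OF pq'])
        have "cmap N x \<in> I p q" using N_piece[OF x(1), of 1] by simp
        then have "z - cmap N x \<in> I p q" using z by (intro cx.subspace_diff[OF piece_subspace])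
        moreover have "(cmap N ^^ (l + 1)) (cmap N x) = (cmap N ^^ (l + 2)) x"
          by (simp add: funpow_swap1)
        then have "(cmap N ^^ (l + 1)) (z - cmap N x) = 0"
          using x(2) by (simp only: cmap_funpow cmap_diff[OF linear_funpow[OF lin]]) simp
        moreover have "nat (p + q - w + 1) = l + 1" using pq by simp
        ultimately have "z - cmap N x \<in> prim_piece F W N w p q" by (simp add: prim_piece_def)
        then have "(cmap N ^^ 0) (z - cmap N x) \<in> cx.span ?P"
          using True by (intro cx.span_base) blast
        then have "z - cmap N x + cmap N x \<in> cx.span ?P"
          using x up by (intro cx.span_add N_T) auto
        then show "z \<in> cx.span ?P" by simp
      qed
    next
      case False
      define l where "l = nat (w - p - q)"
      have l: "p + int l + (q + int l) = w + int l" using False by (simp add: l_def)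
      have "I (p + int l) (q + int l) \<subseteq> cx.span ?P"
        using Suc.prems False by (intro Suc.IH) (auto simp: l_def)
      moreover have "\<exists>x \<in> I (p + int l) (q + int l). (cmap N ^^ l) x = z" if "z \<in> I p q" for z
        using N_surj_pieces[OF l, of z] that by auto
      ultimately show ?thesis using N_T_pow by blast
    qed
  qed
  have "(\<Union>p q. I p q) \<subseteq> cx.span ?P"
  proof (clarify)
    fix z p q assume "z \<in> I p q"
    then show "z \<in> cx.span ?P" using pieces[of p q "Suc (nat (k1 - p - q))"] by auto
  qed
  then have "cx.span (\<Union>p q. I p q) \<subseteq> cx.span ?P" by (intro cx.span_minimal) auto
  moreover have "cpx V \<subseteq> cx.span (\<Union>p q. I p q)" using weight_span_pieces[of k1] k1[of k1] by simp
  ultimately show ?thesis by auto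
qed

end

section \<open>Polarized split mixed Hodge structures\<close>

lemma cmap_funpow_zero:
  assumes "linear f" "(cmap f ^^ n) z = 0" "n \<le> k"
  shows "(cmap f ^^ k) z = 0"
proof -
  have "(cmap f ^^ k) z = (cmap f ^^ (k - n)) ((cmap f ^^ n) z)"
    using assms(3) by (simp flip: funpow_add[THEN fun_cong, unfolded o_def])
  then show ?thesis
    using assms by (simp add: cmap_funpow cmap_zero linear_funpow)
qed

locale split_pmhs =
  fixes V :: "'a::real_vector set" and w :: int and F :: "int \<Rightarrow> ('a \<times> 'a) set"
    and W :: "int \<Rightarrow> 'a set" and N :: "'a \<Rightarrow> 'a" and S :: "'a \<Rightarrow> 'a \<Rightarrow> real"
  assumes pmhs: "pmhs V w F W N S"
    and split_pieces: "z \<in> deligne F W p q \<Longrightarrow> cconj z \<in> F q"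

lemma pmhsD:
  assumes "pmhs V w F W N S"
  shows "mhs V F W" "weight_filtration V N w W" "bilinear S" "nondegenerate_on V S"
    "\<And>x y. x \<in> V \<Longrightarrow> y \<in> V \<Longrightarrow> S y x = (-1) powi w * S x y"
    "linear N" "\<And>x. x \<in> V \<Longrightarrow> N x \<in> V" "nilpotent_on V N"
    "\<And>x y. x \<in> V \<Longrightarrow> y \<in> V \<Longrightarrow> S (N x) y + S x (N y) = 0"
    "\<And>p z. z \<in> F p \<Longrightarrow> cmap N z \<in> F (p - 1)"
    "\<And>p a b. a \<in> F p \<Longrightarrow> b \<in> F (w + 1 - p) \<Longrightarrow> cform S a b = 0"
    "\<And>l p a. a \<in> F_prim F W N w l p \<Longrightarrow> a \<in> cconj ` F_prim F W N w l (w + int l - p) \<Longrightarrow>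
      a \<notin> cpx (W (w + int l - 1)) \<Longrightarrow>
      \<exists>r>0. \<i> powi (2 * p - w - int l) * cform S a ((cmap N ^^ l) (cconj a)) = complex_of_real r"
proof -
  note A = assms[unfolded pmhs_def image_subset_iff]
  show "mhs V F W" by (rule A[THEN conjunct1])
  show "weight_filtration V N w W" by (rule A[THEN conjunct2, THEN conjunct1])
  show "bilinear S" by (rule A[THEN conjunct2, THEN conjunct2, THEN conjunct1])
  show "nondegenerate_on V S" by (rule A[THEN conjunct2, THEN conjunct2, THEN conjunct2, THEN conjunct1])
  show "S y x = (-1) powi w * S x y" if "x \<in> V" "y \<in> V" for x y
    using A[THEN conjunct2, THEN conjunct2, THEN conjunct2, THEN conjunct2, THEN conjunct1] that by blast
  show "linear N" by (rule A[THEN conjunct2, THEN conjunct2, THEN conjunct2, THEN conjunct2, THEN conjunct2, THEN conjunct1])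
  show "N x \<in> V" if "x \<in> V" for x using A[THEN conjunct2, THEN conjunct2, THEN conjunct2, THEN conjunct2, THEN conjunct2, THEN conjunct2, THEN conjunct1] that by blast
  show "nilpotent_on V N" by (rule A[THEN conjunct2, THEN conjunct2, THEN conjunct2, THEN conjunct2, THEN conjunct2, THEN conjunct2, THEN conjunct2, THEN conjunct1])
  show "S (N x) y + S x (N y) = 0" if "x \<in> V" "y \<in> V" for x y
    using A[THEN conjunct2, THEN conjunct2, THEN conjunct2, THEN conjunct2, THEN conjunct2, THEN conjunct2, THEN conjunct2, THEN conjunct2, THEN conjunct1] that by blast
  show "cmap N z \<in> F (p - 1)" if "z \<in> F p" for p z
    using A[THEN conjunct2, THEN conjunct2, THEN conjunct2, THEN conjunct2, THEN conjunct2, THEN conjunct2, THEN conjunct2, THEN conjunct2, THEN conjunct2, THEN conjunct1] that by blast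
  show "cform S a b = 0" if "a \<in> F p" "b \<in> F (w + 1 - p)" for p a b
    using A[THEN conjunct2, THEN conjunct2, THEN conjunct2, THEN conjunct2, THEN conjunct2, THEN conjunct2, THEN conjunct2, THEN conjunct2, THEN conjunct2, THEN conjunct2, THEN conjunct1] that by blast
  show "\<exists>r>0. \<i> powi (2 * p - w - int l) * cform S a ((cmap N ^^ l) (cconj a)) = complex_of_real r"
    if "a \<in> F_prim F W N w l p" "a \<in> cconj ` F_prim F W N w l (w + int l - p)"
      "a \<notin> cpx (W (w + int l - 1))" for l p a
    using A[THEN conjunct2, THEN conjunct2, THEN conjunct2, THEN conjunct2, THEN conjunct2, THEN conjunct2, THEN conjunct2, THEN conjunct2, THEN conjunct2, THEN conjunct2, THEN conjunct2, rule_format, OF IntI[OF that(1,2)] that(3)] .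
qed

sublocale split_pmhs \<subseteq> split_mhs_weight
  by (rule split_mhs_weight.intro) (auto intro: pmhsD[OF pmhs] split_pieces)

context split_pmhs
begin

lemmas bilin = pmhsD(3)[OF pmhs]
lemmas N_V = pmhsD(7)[OF pmhs]

lemma N_cpx: "z \<in> cpx V \<Longrightarrow> (cmap N ^^ k) z \<in> cpx V"
  by (induction k) (auto simp: cpx_iff cmap_eq N_V)

lemma F_cpx: "z \<in> F p \<Longrightarrow> z \<in> cpx V"
  using F_filtration by (auto simp: dec_filtration_def)

lemma cform_F: "a \<in> F p \<Longrightarrow> b \<in> F q \<Longrightarrow> w < p + q \<Longrightarrow> cform S a b = 0"
  using pmhsD(11)[OF pmhs] F_antimono[of b q "w + 1 - p"] by simp

lemma cform_sym: "x \<in> cpx V \<Longrightarrow> y \<in> cpx V \<Longrightarrow> cform S y x = (-1) powi w * cform S x y"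
proof -
  assume "x \<in> cpx V" "y \<in> cpx V"
  then have "S (fst y) (fst x) = (-1) powi w * S (fst x) (fst y)"
    "S (snd y) (snd x) = (-1) powi w * S (snd x) (snd y)"
    "S (fst y) (snd x) = (-1) powi w * S (snd x) (fst y)"
    "S (snd y) (fst x) = (-1) powi w * S (fst x) (snd y)"
    by (auto intro!: pmhsD(5)[OF pmhs] simp: cpx_iff)
  moreover have "((-1) :: real) powi w = 1 \<and> ((-1) :: complex) powi w = 1 \<or>
      ((-1) :: real) powi w = -1 \<and> ((-1) :: complex) powi w = -1"
    by (cases "even w") auto
  ultimately show ?thesis
    by (elim disjE conjE) (simp_all add: cform_def cpx_iff complex_eq_iff)
qed

lemma cform_N:
  assumes "x \<in> cpx V" "y \<in> cpx V"
  shows "cform S (cmap N x) y = - cform S x (cmap N y)"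
proof -
  have "S (N a) b = - S a (N b)" if "a \<in> V" "b \<in> V" for a b
    using pmhsD(9)[OF pmhs that] by simp
  with assms show ?thesis
    by (auto simp: cform_def cpx_iff cmap_eq complex_eq_iff)
qed

lemma cform_N_pow:
  assumes "x \<in> cpx V" "y \<in> cpx V"
  shows "cform S ((cmap N ^^ k) x) y = (-1) ^ k * cform S x ((cmap N ^^ k) y)"
  using assms
proof (induction k arbitrary: y)
  case (Suc k)
  have "cform S ((cmap N ^^ Suc k) x) y = - cform S ((cmap N ^^ k) x) (cmap N y)"
    using cform_N[OF N_cpx[OF Suc.prems(1)] Suc.prems(2)] by simp
  also have "\<dots> = - ((-1) ^ k * cform S x ((cmap N ^^ k) (cmap N y)))"
    using Suc N_cpx[of y 1] by simp
  finally show ?case by (simp add: funpow_swap1)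
qed simp

abbreviation P :: "int \<Rightarrow> int \<Rightarrow> ('a \<times> 'a) set" where "P \<equiv> prim_piece F W N w"

lemma prim_cpx: "z \<in> P p q \<Longrightarrow> z \<in> cpx V"
  by (auto simp: prim_piece_def hodge_piece_def F_cpx)

lemma prim_cconj: "z \<in> P p q \<Longrightarrow> cconj z \<in> P q p"
  by (auto simp: prim_piece_def hodge_piece_def G_cconj add.commute
      simp flip: cconj_funpow[OF lin])

text \<open>The bilinear relations of \<^term>\<open>F\<close> and of its conjugate, together with the lengths of the two
  strings, leave only one possible nonzero pairing.\<close>

lemma prim_pairing:
  assumes a: "a \<in> P p q" "w \<le> p + q" and b: "b \<in> P r s" "w \<le> r + s"
    and nz: "cform S ((cmap N ^^ i) a) ((cmap N ^^ j) b) \<noteq> 0"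
  shows "r = q" "s = p" "int (i + j) = p + q - w"
proof -
  let ?k = "i + j"
  have V: "a \<in> cpx V" "b \<in> cpx V" using a b prim_cpx by auto
  have 1: "cform S a ((cmap N ^^ ?k) b) \<noteq> 0"
    using nz cform_N_pow[OF V(1) N_cpx[OF V(2), of j], of i]
    by (simp add: funpow_add)
  then have 2: "cform S ((cmap N ^^ ?k) a) b \<noteq> 0"
    using cform_N_pow[OF V, of ?k] by simp
  have nza: "(cmap N ^^ ?k) a \<noteq> 0" "(cmap N ^^ ?k) b \<noteq> 0"
    using 1 2 cform_zero_left[OF bilin, of b] cform_zero_right[OF bilin, of a] by metis+
  have "?k < nat (p + q - w + 1)"
    using nza(1) a cmap_funpow_zero[OF lin, of "nat (p + q - w + 1)" a ?k]
    by (force simp: prim_piece_def)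
  moreover have "?k < nat (r + s - w + 1)"
    using nza(2) b cmap_funpow_zero[OF lin, of "nat (r + s - w + 1)" b ?k]
    by (force simp: prim_piece_def)
  moreover have "p + (r - int ?k) \<le> w"
  proof (rule ccontr)
    assume "\<not> ?thesis"
    moreover have "a \<in> F p" "(cmap N ^^ ?k) b \<in> F (r - int ?k)"
      using a b N_F_pow[of b r ?k] by (auto simp: prim_piece_def hodge_piece_def)
    ultimately show False using 1 cform_F by fastforce
  qed
  moreover have "q + (s - int ?k) \<le> w"
  proof (rule ccontr)
    assume "\<not> ?thesis"
    moreover have "cconj a \<in> F q" "cconj ((cmap N ^^ ?k) b) \<in> F (s - int ?k)"
      using a b N_F_pow[of "cconj b" s ?k]
      by (auto simp: prim_piece_def hodge_piece_def cconj_funpow[OF lin])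
    ultimately have "cform S (cconj a) (cconj ((cmap N ^^ ?k) b)) = 0"
      using cform_F by fastforce
    then show False using 1 by (simp add: cform_cconj[OF bilin])
  qed
  ultimately show "r = q" "s = p" "int (i + j) = p + q - w"
    using a(2) b(2) by linarith+
qed

text \<open>The polarization condition is about classes in a graded piece; it applies to primitive vectors
  themselves because a nonzero vector of a piece has a nonzero class.\<close>

lemma prim_positive:
  assumes a: "a \<in> P p q" "a \<noteq> 0" and l: "p + q = w + int l"
  obtains r where "r > 0" "\<i> powi (p - q) * cform S a ((cmap N ^^ l) (cconj a)) = complex_of_real r"
proof -
  have F_prim: "z \<in> F_prim F W N w l p'" if "z \<in> P p' q'" "p' + q' = w + int l" for z p' q'
  proof -
    have z: "z \<in> F p'" "z \<in> G (w + int l)" "(cmap N ^^ (l + 1)) z = 0"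
      using that by (auto simp: prim_piece_def hodge_piece_def nat_add_distrib)
    have "z \<in> F_gr F W (w + int l) p'"
      unfolding F_gr_iff using z cx.subspace_0[OF G_subspace]
      by (intro exI[of _ z] exI[of _ 0]) auto
    with z show ?thesis
      using cx.subspace_0[OF G_subspace] by (simp add: F_prim_def prim_def)
  qed
  have "a \<in> F_prim F W N w l p" using F_prim[OF a(1) l] .
  moreover have "a \<in> cconj ` F_prim F W N w l (w + int l - p)"
  proof -
    have "cconj a \<in> F_prim F W N w l q"
      using F_prim[OF prim_cconj[OF a(1)]] l by (simp add: add.commute)
    moreover have "q = w + int l - p" using l by simp
    ultimately show ?thesis by (simp only: cconj_image_iff)
  qed
  moreover have "a \<notin> G (w + int l - 1)"
    using piece_weight[of a p q "w + int l - 1"] a l by (auto simp: prim_piece_def hodge_piece_def)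
  ultimately have "\<exists>r>0. \<i> powi (2 * p - w - int l) * cform S a ((cmap N ^^ l) (cconj a)) = complex_of_real r"
    by (rule pmhsD(12)[OF pmhs])
  moreover have "2 * p - w - int l = p - q" using l by simp
  ultimately show ?thesis using that by auto
qed

text \<open>Orthogonality for the sesquilinear form that the polarization defines is a symmetric relation, as
  Gram-Schmidt requires.\<close>

lemma cform_N_hermitian:
  assumes "x \<in> cpx V" "y \<in> cpx V" "cform S x ((cmap N ^^ l) (cconj y)) = 0"
  shows "cform S y ((cmap N ^^ l) (cconj x)) = 0"
proof -
  have c: "cconj z \<in> cpx V" if "z \<in> cpx V" for z by (rule cconj_cpx[OF V_subspace that])
  have "cform S ((cmap N ^^ l) y) (cconj x) = (-1) powi w * cform S (cconj x) ((cmap N ^^ l) y)"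
    using assms c by (intro cform_sym N_cpx)
  also have "cform S (cconj x) ((cmap N ^^ l) y) = cnj (cform S x ((cmap N ^^ l) (cconj y)))"
    by (simp add: cconj_funpow[OF lin] flip: cform_cconj[OF bilin])
  finally show ?thesis
    using assms cform_N_pow[OF assms(2) c[OF assms(1)], of l] by simp
qed

end

section \<open>Semisimple and unipotent part\<close>

text \<open>Compatibility with the eigenspace decomposition, phrased without projections.\<close>

definition eigen_graded :: "('a \<Rightarrow> 'a) \<Rightarrow> ('a \<times> 'a::real_vector) set \<Rightarrow> bool" where
  "eigen_graded Ms X \<longleftrightarrow> (\<forall>\<Lambda> c. finite \<Lambda> \<longrightarrow> (\<forall>\<zeta>\<in>\<Lambda>. c \<zeta> \<in> eigsp Ms \<zeta>) \<longrightarrow> sum c \<Lambda> \<in> X \<longrightarrow>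
    (\<forall>\<zeta>\<in>\<Lambda>. c \<zeta> \<in> X))"

lemma eigen_graded_Int:
  "eigen_graded Ms X \<Longrightarrow> eigen_graded Ms Y \<Longrightarrow> eigen_graded Ms (X \<inter> Y)"
  unfolding eigen_graded_def by blast

lemma eigsp_subspace: "linear f \<Longrightarrow> cx.subspace (eigsp f \<zeta>)"
  by (rule cx.subspaceI)
    (auto simp: eigsp_def cmap_zero cmap_add cmap_cscale cx.scale_right_distrib mult.commute)

lemma eigsp_cconj: "linear f \<Longrightarrow> z \<in> eigsp f \<zeta> \<Longrightarrow> cconj z \<in> eigsp f (cnj \<zeta>)"
  by (auto simp: eigsp_def simp flip: cconj_cmap cconj_cscale)

text \<open>A power of \<open>A - \<mu>\<close> removes the component of eigenvalue \<open>\<mu>\<close> without leaving \<open>X\<close>. On the component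
  of eigenvalue \<open>\<zeta> \<noteq> \<mu>\<close> it is a nonzero scalar plus a nilpotent map, so membership in \<open>X\<close> can be
  pulled back along it. The lemma is used for \<open>A = M\<close>, which preserves the weight filtration, and for
  \<open>A = Ms\<close>, which preserves the Hodge filtration.\<close>

lemma eigen_graded_stable:
  assumes lin: "linear A" "linear Ms" and comm: "\<And>x. A (Ms x) = Ms (A x)"
    and nil: "\<And>\<zeta> v. v \<in> eigsp Ms \<zeta> \<Longrightarrow> \<exists>k. ((\<lambda>z. cmap A z - cscale \<zeta> z) ^^ k) v = 0"
    and X: "cx.subspace X" "\<And>x. x \<in> X \<Longrightarrow> cmap A x \<in> X"
  shows "eigen_graded Ms X"
proof -
  define B where "B \<mu> z = cmap A z - cscale \<mu> z" for \<mu> z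
  have B_add: "(B \<mu> ^^ k) (x + y) = (B \<mu> ^^ k) x + (B \<mu> ^^ k) y" for \<mu> k x y
    by (induction k) (simp_all add: B_def cmap_add[OF lin(1)] cx.scale_right_distrib)
  have B_scale: "(B \<mu> ^^ k) (cscale a x) = cscale a ((B \<mu> ^^ k) x)" for \<mu> k a x
    by (induction k) (simp_all add: B_def cmap_cscale[OF lin(1)] cx.scale_right_diff_distrib mult.commute)
  have B_zero: "(B \<mu> ^^ k) 0 = 0" for \<mu> k
    using B_scale[where a = 0 and x = 0] by simp
  have B_sum: "(B \<mu> ^^ k) (sum f T) = (\<Sum>i\<in>T. (B \<mu> ^^ k) (f i))"
    for \<mu> k T and f :: "complex \<Rightarrow> 'a \<times> 'a"
    by (induction T rule: infinite_finite_induct) (simp_all add: B_add B_zero)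
  have B_X: "(B \<mu> ^^ k) x \<in> X" if "x \<in> X" for \<mu> k x
    by (induction k) (auto simp: that B_def intro!: cx.subspace_diff[OF X(1)] cx.subspace_scale[OF X(1)] X(2))
  have A_eig: "cmap A v \<in> eigsp Ms \<zeta>" if "v \<in> eigsp Ms \<zeta>" for v \<zeta>
  proof -
    have "cmap Ms (cmap A v) = cmap A (cmap Ms v)" by (simp add: cmap_eq comm)
    also have "\<dots> = cscale \<zeta> (cmap A v)" using that by (simp add: eigsp_def cmap_cscale[OF lin(1)])
    finally show ?thesis by (simp add: eigsp_def)
  qed
  have B_eig: "(B \<mu> ^^ k) v \<in> eigsp Ms \<zeta>" if "v \<in> eigsp Ms \<zeta>" for \<mu> \<zeta> k v
    by (induction k)
      (auto simp: that B_def intro!: cx.subspace_diff[OF eigsp_subspace[OF lin(2)]]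
        cx.subspace_scale[OF eigsp_subspace[OF lin(2)]] A_eig)
  have peel: "v \<in> X" if v: "v \<in> eigsp Ms \<zeta>" "B \<mu> v \<in> X" "\<mu> \<noteq> \<zeta>" for v \<mu> \<zeta>
  proof -
    obtain K where K: "(B \<zeta> ^^ K) v = 0"
      using nil[OF v(1)] unfolding B_def by auto
    have "(B \<zeta> ^^ (K - n)) v \<in> X" for n
    proof (induction n)
      case 0
      then show ?case using K cx.subspace_0[OF X(1)] by simp
    next
      case (Suc n)
      show ?case
      proof (cases "n < K")
        case True
        define j where "j = K - Suc n"
        have j: "K - n = Suc j" using True by (simp add: j_def)
        have "B \<mu> v = B \<zeta> v + cscale (\<zeta> - \<mu>) v"
          by (simp add: B_def cx.scale_left_diff_distrib)
        then have "(B \<zeta> ^^ j) (B \<mu> v) = (B \<zeta> ^^ Suc j) v + cscale (\<zeta> - \<mu>) ((B \<zeta> ^^ j) v)"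
          by (simp add: B_add B_scale funpow_swap1)
        moreover have "(B \<zeta> ^^ j) (B \<mu> v) \<in> X" by (rule B_X[OF v(2)])
        ultimately have "cscale (\<zeta> - \<mu>) ((B \<zeta> ^^ j) v) \<in> X"
          using Suc cx.subspace_diff[OF X(1), of "(B \<zeta> ^^ j) (B \<mu> v)" "(B \<zeta> ^^ Suc j) v"]
          unfolding j by simp
        from cx.subspace_scale[OF X(1) this, of "inverse (\<zeta> - \<mu>)"] show ?thesis
          using v(3) by (simp add: j_def)
      next
        case False
        then show ?thesis using Suc by (simp add: not_less)
      qed
    qed
    from this[of K] show ?thesis by simp
  qed
  have peels: "v \<in> X" if "v \<in> eigsp Ms \<zeta>" "(B \<mu> ^^ k) v \<in> X" "\<mu> \<noteq> \<zeta>" for v \<mu> \<zeta> k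
    using that(2)
  proof (induction k)
    case (Suc k)
    then show ?case using peel[OF B_eig[OF that(1)] _ that(3)] by simp
  qed simp
  have "y \<in> X" if "finite \<Lambda>" "\<zeta> \<notin> \<Lambda>" "y \<in> eigsp Ms \<zeta>" "\<forall>\<mu>\<in>\<Lambda>. c \<mu> \<in> eigsp Ms \<mu>"
    "y + sum c \<Lambda> \<in> X" for \<Lambda> \<zeta> y c
    using that
  proof (induction \<Lambda> arbitrary: y c rule: finite_induct)
    case (insert \<mu> \<Lambda>)
    obtain k where k: "(B \<mu> ^^ k) (c \<mu>) = 0"
      using nil[of "c \<mu>" \<mu>] insert.prems unfolding B_def by auto
    have "(B \<mu> ^^ k) (y + sum c (insert \<mu> \<Lambda>)) \<in> X" using insert.prems by (intro B_X) auto
    then have "(B \<mu> ^^ k) y + (\<Sum>\<nu>\<in>\<Lambda>. (B \<mu> ^^ k) (c \<nu>)) \<in> X"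
      using insert.hyps k by (simp add: B_add B_sum)
    then have "(B \<mu> ^^ k) y \<in> X"
      using insert.prems by - (rule insert.IH[of _ "\<lambda>\<nu>. (B \<mu> ^^ k) (c \<nu>)"], auto intro: B_eig)
    then show ?case using peels[of y \<zeta> k \<mu>] insert.prems by auto
  qed simp
  note one = this
  have "c \<zeta> \<in> X" if "finite \<Lambda>" "\<forall>\<mu>\<in>\<Lambda>. c \<mu> \<in> eigsp Ms \<mu>" "sum c \<Lambda> \<in> X" "\<zeta> \<in> \<Lambda>" for \<Lambda> c \<zeta>
    by (rule one[of "\<Lambda> - {\<zeta>}" \<zeta> "c \<zeta>" c])
      (use that sum.remove[of \<Lambda> \<zeta> c] in auto)
  then show ?thesis unfolding eigen_graded_def by blast
qed

text \<open>The unipotent part and its nilpotency index are parameters because they enter all arguments about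
  generalized eigenspaces.\<close>

locale jordan_chevalley =
  fixes M Ms N Mu :: "'a::real_vector \<Rightarrow> 'a" and K :: nat
  assumes lin_Ms: "linear Ms" and lin_N: "linear N" and lin_Mu: "linear Mu"
    and semisimple: "semisimple_on UNIV Ms"
    and nilpotent: "((\<lambda>y. Mu y - y) ^^ K) x = 0"
    and M_eq: "M x = Ms (Mu x)" and M_eq': "M x = Mu (Ms x)" and N_eq: "N x = unip_log Mu x"
begin

definition u :: "'a \<Rightarrow> 'a" where "u x = Mu x - x"

lemma lin_u: "linear u"
  unfolding u_def using lin_Mu by (intro linear_compose_sub) (auto intro: linearI)

lemma lin_M: "linear M"
proof -
  have "M = Ms \<circ> Mu" by (simp add: fun_eq_iff M_eq)
  then show ?thesis using linear_compose[OF lin_Mu lin_Ms] by simp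
qed

lemma u_Ms: "u (Ms x) = Ms (u x)"
  using M_eq[of x] M_eq'[of x] by (simp add: u_def linear_diff[OF lin_Ms])

lemma u_pow_Ms: "(u ^^ k) (Ms x) = Ms ((u ^^ k) x)"
  by (induction k) (auto simp: u_Ms)

lemma u_pow_zero: "K \<le> k \<Longrightarrow> (u ^^ k) x = 0"
proof -
  have "(\<lambda>y. Mu y - y) = u" by (simp add: u_def fun_eq_iff)
  then have 0: "(u ^^ K) y = 0" for y using nilpotent by simp
  show ?thesis if "K \<le> k"
    using that funpow_add[of K "k - K" u] by (simp add: 0)
qed

lemma N_sum: "N x = (\<Sum>k=1..K. ((-1) ^ (k + 1) / real k) *\<^sub>R (u ^^ k) x)"
proof -
  have "(\<lambda>y. Mu y - y) = u" by (simp add: u_def fun_eq_iff)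
  moreover have "k \<le> K" if "(u ^^ k) x \<noteq> 0" for k
    using u_pow_zero[of k x] that by (meson nle_le)
  ultimately show ?thesis
    unfolding N_eq unip_log_def
    by (simp only:) (intro sum.mono_neutral_left; auto)
qed

lemma N_Ms: "N (Ms x) = Ms (N x)"
  unfolding N_sum linear_sum[OF lin_Ms] by (simp add: u_pow_Ms linear_scale[OF lin_Ms] linear_neg[OF lin_Ms])

lemma M_Ms: "M (Ms x) = Ms (M x)"
  using M_eq M_eq' by metis

lemma eigsp_stable:
  assumes "linear f" "\<And>x. f (Ms x) = Ms (f x)" "z \<in> eigsp Ms \<zeta>"
  shows "cmap f z \<in> eigsp Ms \<zeta>"
proof -
  have "cmap Ms (cmap f z) = cmap f (cmap Ms z)" by (simp add: cmap_eq assms)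
  also have "\<dots> = cscale \<zeta> (cmap f z)" using assms by (simp add: eigsp_def cmap_cscale)
  finally show ?thesis by (simp add: eigsp_def)
qed

lemma u_eigsp: "z \<in> eigsp Ms \<zeta> \<Longrightarrow> (cmap u ^^ k) z \<in> eigsp Ms \<zeta>"
  by (induction k) (auto intro: eigsp_stable lin_u u_Ms)

lemma N_eigsp: "z \<in> eigsp Ms \<zeta> \<Longrightarrow> (cmap N ^^ k) z \<in> eigsp Ms \<zeta>"
  by (induction k) (auto intro: eigsp_stable lin_N N_Ms)

lemma M_eigsp: "z \<in> eigsp Ms \<zeta> \<Longrightarrow> cmap M z = cscale \<zeta> (z + cmap u z)"
proof -
  assume "z \<in> eigsp Ms \<zeta>"
  then have "z + cmap u z \<in> eigsp Ms \<zeta>"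
    using u_eigsp[of z \<zeta> 1] by (intro cx.subspace_add[OF eigsp_subspace[OF lin_Ms]]) auto
  moreover have "cmap M z = cmap Ms (z + cmap u z)"
    by (simp add: cmap_eq M_eq u_def)
  ultimately show ?thesis by (simp add: eigsp_def)
qed

text \<open>Since \<open>N\<close> is \<open>u\<close> plus higher powers of \<open>u\<close>, this congruence replaces the inversion of the
  logarithm series.\<close>

lemma N_pow_u_pow: "(N ^^ j) x - (u ^^ j) x \<in> span {(u ^^ i) x |i. j < i}"
proof (induction j)
  case 0
  then show ?case by (simp add: span_zero)
next
  case (Suc j)
  let ?T = "span {(u ^^ i) x |i. Suc j < i}"
  have Nu: "N ((u ^^ i) x) = (\<Sum>k=1..K. ((-1) ^ (k + 1) / real k) *\<^sub>R (u ^^ (k + i)) x)" for i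
    by (simp add: N_sum funpow_add)
  have "{(u ^^ i) x |i. j < i} \<subseteq> {y. N y \<in> ?T}"
  proof clarify
    fix i assume "j < i"
    then show "N ((u ^^ i) x) \<in> ?T"
      unfolding Nu by (intro span_sum span_scale span_base) force
  qed
  then have "span {(u ^^ i) x |i. j < i} \<subseteq> {y. N y \<in> ?T}"
    using lin_N by (intro span_minimal subspaceI)
      (auto simp: linear_0 linear_add linear_scale span_zero span_add span_scale)
  then have 1: "N ((N ^^ j) x - (u ^^ j) x) \<in> ?T" using Suc by blast
  have 2: "N ((u ^^ j) x) - (u ^^ Suc j) x \<in> ?T"
  proof (cases "K = 0")
    case True
    then have "(u ^^ k) x = 0" for k using u_pow_zero by simp
    then show ?thesis unfolding Nu by (simp add: span_zero True del: funpow.simps)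
  next
    case False
    then have "N ((u ^^ j) x) = (u ^^ Suc j) x + (\<Sum>k=2..K. ((-1) ^ (k + 1) / real k) *\<^sub>R (u ^^ (k + j)) x)"
      unfolding Nu by (subst sum.atLeast_Suc_atMost) (auto simp: numeral_2_eq_2)
    moreover have "(\<Sum>k=2..K. ((-1) ^ (k + 1) / real k) *\<^sub>R (u ^^ (k + j)) x) \<in> ?T"
      by (intro span_sum span_scale span_base) force
    ultimately show ?thesis by simp
  qed
  show ?case
    using span_add[OF 1 2] by (simp add: linear_diff[OF lin_N])
qed

text \<open>By descending induction on the exponent, starting from the power that vanishes: \<open>N\<^sup>i x\<close> is in
  \<open>X\<close> and differs from \<open>u\<^sup>i x\<close> by higher powers of \<open>u\<close>.\<close>

lemma u_stable:
  assumes X: "subspace X" "\<And>x. x \<in> X \<Longrightarrow> N x \<in> X" and x: "x \<in> X"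
  shows "u x \<in> X"
proof -
  have N: "(N ^^ k) x \<in> X" for k by (induction k) (auto simp: x X)
  have "\<forall>i\<ge>K - n. (u ^^ i) x \<in> X" for n
  proof (induction n)
    case 0
    then show ?case using u_pow_zero subspace_0[OF X(1)] by simp
  next
    case (Suc n)
    show ?case
    proof (intro allI impI)
      fix i assume i: "K - Suc n \<le> i"
      show "(u ^^ i) x \<in> X"
      proof (cases "K - n \<le> i")
        case True
        then show ?thesis using Suc by simp
      next
        case False
        then have "span {(u ^^ i') x |i'. i < i'} \<subseteq> X"
          using i Suc by (intro span_minimal X) auto
        then have "(N ^^ i) x - (u ^^ i) x \<in> X" using N_pow_u_pow by blast
        from subspace_diff[OF X(1) N[of i] this] show ?thesis by simp
      qed
    qed
  qed
  from this[of K, rule_format, of 1] show ?thesis by simp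
qed

lemma cu_pow_zero: "(cmap u ^^ K) z = 0"
  by (simp add: cmap_funpow cmap_eq u_pow_zero zero_prod_def)

lemma graded_M: "cx.subspace X \<Longrightarrow> (\<And>x. x \<in> X \<Longrightarrow> cmap M x \<in> X) \<Longrightarrow> eigen_graded Ms X"
proof (rule eigen_graded_stable[OF lin_M lin_Ms M_Ms])
  fix \<zeta> v assume v: "v \<in> eigsp Ms \<zeta>"
  have "((\<lambda>z. cmap M z - cscale \<zeta> z) ^^ k) v = cscale (\<zeta> ^ k) ((cmap u ^^ k) v)" for k
  proof (induction k)
    case (Suc k)
    have "cscale (\<zeta> ^ k) ((cmap u ^^ k) v) \<in> eigsp Ms \<zeta>"
      by (intro cx.subspace_scale[OF eigsp_subspace[OF lin_Ms]] u_eigsp v)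
    from M_eigsp[OF this] Suc show ?case
      by (simp add: cx.scale_right_distrib cmap_cscale[OF lin_u])
  qed simp
  from this[of K] show "\<exists>k. ((\<lambda>z. cmap M z - cscale \<zeta> z) ^^ k) v = 0"
    by (intro exI[of _ K]) (simp add: cu_pow_zero)
qed

lemma graded_Ms: "cx.subspace X \<Longrightarrow> (\<And>x. x \<in> X \<Longrightarrow> cmap Ms x \<in> X) \<Longrightarrow> eigen_graded Ms X"
  by (rule eigen_graded_stable[OF lin_Ms lin_Ms]) (auto intro!: exI[of _ 1] simp: eigsp_def)

lemma eigen_decomposition:
  obtains \<Lambda> c where "finite \<Lambda>" "\<And>\<zeta>. \<zeta> \<in> \<Lambda> \<Longrightarrow> c \<zeta> \<in> eigsp Ms \<zeta>" "z = sum c \<Lambda>"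
proof -
  let ?T = "{z. \<exists>\<Lambda> c. finite \<Lambda> \<and> (\<forall>\<zeta>. c \<zeta> \<in> eigsp Ms \<zeta>) \<and> z = sum c \<Lambda>}"
  note E = eigsp_subspace[OF lin_Ms]
  have "cx.subspace ?T"
  proof (rule cx.subspaceI)
    show "0 \<in> ?T"
      by (auto intro!: exI[of _ "{}"] exI[of _ "\<lambda>_. 0"] simp: cx.subspace_0[OF E])
    show "cscale a x \<in> ?T" if x: "x \<in> ?T" for a x
    proof -
      obtain \<Lambda> c where "finite \<Lambda>" "\<forall>\<zeta>. c \<zeta> \<in> eigsp Ms \<zeta>" "x = sum c \<Lambda>" using x by blast
      then show ?thesis
        by (auto intro!: exI[of _ \<Lambda>] exI[of _ "\<lambda>\<zeta>. cscale a (c \<zeta>)"]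
            simp: cx.subspace_scale[OF E] cx.scale_sum_right)
    qed
    show "x + y \<in> ?T" if xy: "x \<in> ?T" "y \<in> ?T" for x y
    proof -
      obtain \<Lambda> c where c: "finite \<Lambda>" "\<forall>\<zeta>. c \<zeta> \<in> eigsp Ms \<zeta>" "x = sum c \<Lambda>" using xy by blast
      obtain \<Lambda>' c' where c': "finite \<Lambda>'" "\<forall>\<zeta>. c' \<zeta> \<in> eigsp Ms \<zeta>" "y = sum c' \<Lambda>'" using xy by blast
      define d where "d \<zeta> = (if \<zeta> \<in> \<Lambda> then c \<zeta> else 0) + (if \<zeta> \<in> \<Lambda>' then c' \<zeta> else 0)" for \<zeta>
      have "sum d (\<Lambda> \<union> \<Lambda>') = x + y"
        using c c' by (simp add: d_def sum.distrib sum.If_cases Int_absorb1)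
      moreover have "d \<zeta> \<in> eigsp Ms \<zeta>" for \<zeta>
        using c c' by (auto simp: d_def cx.subspace_0[OF E] cx.subspace_add[OF E])
      ultimately show ?thesis using c c' by (auto intro!: exI[of _ "\<Lambda> \<union> \<Lambda>'"] exI[of _ d])
    qed
  qed
  moreover have "{z \<in> cpx UNIV. \<exists>c. cmap Ms z = cscale c z} \<subseteq> ?T"
  proof clarify
    fix a b \<zeta> assume "cmap Ms (a, b) = cscale \<zeta> (a, b)"
    then show "\<exists>\<Lambda> c. finite \<Lambda> \<and> (\<forall>\<zeta>. c \<zeta> \<in> eigsp Ms \<zeta>) \<and> (a, b) = sum c \<Lambda>"
      by (intro exI[of _ "{\<zeta>}"] exI[of _ "\<lambda>\<mu>. if \<mu> = \<zeta> then (a, b) else 0"])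
        (auto simp: cx.subspace_0[OF E], simp add: eigsp_def)
  qed
  ultimately have "cx.span {z \<in> cpx UNIV. \<exists>c. cmap Ms z = cscale c z} \<subseteq> ?T"
    by (intro cx.span_minimal)
  then have "z \<in> ?T" using semisimple by (auto simp: semisimple_on_def)
  then show ?thesis using that by blast
qed

lemma graded_span:
  assumes "eigen_graded Ms X"
  shows "X \<subseteq> cx.span (\<Union>\<zeta>. X \<inter> eigsp Ms \<zeta>)"
proof
  fix z assume z: "z \<in> X"
  obtain \<Lambda> c where c: "finite \<Lambda>" "\<And>\<zeta>. \<zeta> \<in> \<Lambda> \<Longrightarrow> c \<zeta> \<in> eigsp Ms \<zeta>" "z = sum c \<Lambda>"
    using eigen_decomposition[of z] by metis
  have "\<forall>\<zeta>\<in>\<Lambda>. c \<zeta> \<in> X"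
    using assms c z unfolding eigen_graded_def by blast
  then show "z \<in> cx.span (\<Union>\<zeta>. X \<inter> eigsp Ms \<zeta>)"
    unfolding c(3) using c(2) by (intro cx.span_sum cx.span_base) auto
qed

text \<open>Invariance under \<open>M\<close> expresses \<open>(1 - \<zeta> \<mu>) S(x, y)\<close> by pairings in which \<open>x\<close> or \<open>y\<close> is replaced by
  its image under \<open>u\<close>. These vanish by induction on the sum of the lengths of the Jordan strings.\<close>

lemma eigsp_orthogonal:
  assumes S: "bilinear S" "\<And>x y. S (M x) (M y) = S x y"
    and xy: "x \<in> eigsp Ms \<zeta>" "y \<in> eigsp Ms \<mu>" "\<zeta> * \<mu> \<noteq> 1"
  shows "cform S x y = 0"
proof -
  have M: "cform S (cmap M x) (cmap M y) = cform S x y" for x y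
    by (simp add: cform_def cmap_eq S(2))
  have "cform S x y = 0" if "x \<in> eigsp Ms \<zeta>" "y \<in> eigsp Ms \<mu>" "(cmap u ^^ i) x = 0" "(cmap u ^^ j) y = 0"
    "i + j = n" for x y i j n
    using that
  proof (induction n arbitrary: x y i j rule: less_induct)
    case (less n)
    show ?case
    proof (cases "i = 0 \<or> j = 0")
      case True
      then have "x = 0 \<or> y = 0" using less.prems by auto
      then show ?thesis using cform_zero_left[OF S(1), of y] cform_zero_right[OF S(1), of x] by metis
    next
      case False
      then obtain i' j' where ij: "i = Suc i'" "j = Suc j'" by (auto simp: gr0_conv_Suc)
      have ux: "cmap u x \<in> eigsp Ms \<zeta>" "(cmap u ^^ i') (cmap u x) = 0"
        using less.prems u_eigsp[of x \<zeta> 1] ij by (simp_all add: funpow_swap1)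
      have uy: "cmap u y \<in> eigsp Ms \<mu>" "(cmap u ^^ j') (cmap u y) = 0"
        using less.prems u_eigsp[of y \<mu> 1] ij by (simp_all add: funpow_swap1)
      have 0: "cform S (cmap u x) y = 0" "cform S x (cmap u y) = 0" "cform S (cmap u x) (cmap u y) = 0"
        using less.IH[of "i' + j" "cmap u x" y i' j] less.IH[of "i + j'" x "cmap u y" i j']
          less.IH[of "i' + j'" "cmap u x" "cmap u y" i' j'] less.prems ux uy ij by auto
      have "cform S x y = cform S (cscale \<zeta> (x + cmap u x)) (cscale \<mu> (y + cmap u y))"
        using M[of x y] less.prems by (simp add: M_eigsp)
      also have "\<dots> = \<zeta> * \<mu> * cform S x y"
        using 0 by (simp add: cform_scale_left[OF S(1)] cform_scale_right[OF S(1)]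
            cform_add_left[OF S(1)] cform_add_right[OF S(1)])
      finally show ?thesis using xy(3) by simp
    qed
  qed
  from this[OF xy(1,2) cu_pow_zero cu_pow_zero] show ?thesis by simp
qed

end

section \<open>Split Steenbrink polarized mixed Hodge structures\<close>

lemma deligne_mono:
  assumes "\<And>p. F' p \<subseteq> F p" "\<And>k. W' k \<subseteq> W k"
  shows "deligne F' W' p q \<subseteq> deligne F W p q"
proof -
  have c: "cpx (W' k) \<subseteq> cpx (W k)" "cconj ` F' k \<subseteq> cconj ` F k" for k
    using assms by (simp_all add: cpx_mono image_mono)
  show ?thesis
    unfolding deligne_def using assms(1) c
    by (intro Int_mono cx.span_mono Un_mono UN_mono) auto
qed

locale steenbrink_split = jordan_chevalley M Ms N Mu K
  for M Ms N Mu :: "'a::real_vector \<Rightarrow> 'a" and K :: nat +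
  fixes m :: int and F :: "int \<Rightarrow> ('a \<times> 'a) set" and W :: "int \<Rightarrow> 'a set"
    and S :: "'a \<Rightarrow> 'a \<Rightarrow> real"
  assumes steenbrink: "steenbrink_pmhs m F W M Ms N S"
    and split: "split_mhs F W"
begin

lemma mhs_UNIV: "mhs UNIV F W" and M_bij: "bij M" and M_W: "M ` W k = W k"
  using steenbrink by (auto simp: steenbrink_pmhs_def steenbrink_mhs_def)

lemma Ms_F: "z \<in> F p \<Longrightarrow> cmap Ms z \<in> F p"
proof -
  have "cmap Ms ` F p \<subseteq> F p"
    using steenbrink by (auto simp: steenbrink_pmhs_def steenbrink_mhs_def)
  then show "z \<in> F p \<Longrightarrow> cmap Ms z \<in> F p" by blast
qed

lemma bilin: "bilinear S" and nondeg: "nondegenerate_on UNIV S" and isometry: "S (M x) (M y) = S x y"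
  using steenbrink by (auto simp: steenbrink_pmhs_def)

lemma findim: "findim_subspace (UNIV :: 'a set)"
  using mhs_UNIV by (simp add: mhs_def)

lemma F_subspace: "cx.subspace (F p)"
  using mhs_UNIV by (simp add: mhs_def dec_filtration_def)

lemma W_subspace: "subspace (W k)"
  using mhs_UNIV by (simp add: mhs_def inc_filtration_def)

lemmas eig_subspace = eigsp_subspace[OF lin_Ms]

lemma span_eigsp: "cx.span (\<Union>\<zeta>. eigsp Ms \<zeta>) = UNIV"
  using semisimple by (simp add: semisimple_on_def eigsp_def Collect_ex_eq)

text \<open>The two summands on which the structure is a polarized mixed Hodge structure, as a function of the
  eigenvalue, so that both cases are treated uniformly.\<close>

definition E :: "complex \<Rightarrow> ('a \<times> 'a) set" where
  "E \<zeta> = (if \<zeta> = 1 then eigsp Ms 1 else eigsp_ne1 Ms)"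

abbreviation V :: "complex \<Rightarrow> 'a set" where "V \<zeta> \<equiv> real_pts (E \<zeta>)"

lemma E_subspace: "cx.subspace (E \<zeta>)"
  by (simp add: E_def eigsp_ne1_def eig_subspace)

lemma eigsp_E: "eigsp Ms \<zeta> \<subseteq> E \<zeta>"
  by (auto simp: E_def eigsp_ne1_def intro!: cx.span_base)

lemma E_cong: "(\<zeta> = 1 \<longleftrightarrow> \<mu> = 1) \<Longrightarrow> E \<zeta> = E \<mu>"
  by (simp add: E_def)

lemma theta_cong: "(\<zeta> = 1 \<longleftrightarrow> \<mu> = 1) \<Longrightarrow> theta \<zeta> = theta \<mu>"
  by (simp add: theta_def)

lemma cnj_eq_1: "cnj \<zeta> = 1 \<longleftrightarrow> \<zeta> = 1"
  by (metis complex_cnj_cnj complex_cnj_one)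

lemma E_conj: "conj_stable (E \<zeta>)"
proof (cases "\<zeta> = 1")
  case True
  then show ?thesis
    using eigsp_cconj[OF lin_Ms, of _ 1] by (auto simp: E_def conj_stable_def)
next
  case False
  have "conj_stable (eigsp_ne1 Ms)"
    unfolding eigsp_ne1_def
  proof (rule span_conj_stable)
    fix g assume "g \<in> (\<Union>\<zeta>\<in>-{1}. eigsp Ms \<zeta>)"
    then obtain \<zeta> where z: "\<zeta> \<noteq> 1" "g \<in> eigsp Ms \<zeta>" by auto
    have "cnj \<zeta> \<in> -{1}" using z(1) cnj_eq_1 by auto
    then show "cconj g \<in> cx.span (\<Union>\<zeta>\<in>-{1}. eigsp Ms \<zeta>)"
      using eigsp_cconj[OF lin_Ms z(2)] by (intro cx.span_base) blast
  qed
  with False show ?thesis by (simp add: E_def)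
qed

lemma cpx_V: "cpx (V \<zeta>) = E \<zeta>"
  by (rule cpx_real_pts[OF E_subspace E_conj])

lemma E_Ms: "z \<in> E \<zeta> \<Longrightarrow> cmap Ms z \<in> E \<zeta>"
proof -
  have eig: "cmap Ms g \<in> eigsp Ms \<mu>" if "g \<in> eigsp Ms \<mu>" for g \<mu>
    by (rule eigsp_stable[OF lin_Ms refl that])
  show "z \<in> E \<zeta> \<Longrightarrow> cmap Ms z \<in> E \<zeta>"
  proof (cases "\<zeta> = 1")
    case False
    assume "z \<in> E \<zeta>"
    then have "z \<in> cx.span (\<Union>\<zeta>\<in>-{1}. eigsp Ms \<zeta>)" using False by (simp add: E_def eigsp_ne1_def)
    then have "cmap Ms z \<in> cx.span (\<Union>\<zeta>\<in>-{1}. eigsp Ms \<zeta>)"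
    proof (rule span_map_stable[OF lin_Ms, rotated])
      fix g assume "g \<in> (\<Union>\<zeta>\<in>-{1}. eigsp Ms \<zeta>)"
      then have "cmap Ms g \<in> (\<Union>\<zeta>\<in>-{1}. eigsp Ms \<zeta>)" using eig by blast
      then show "cmap Ms g \<in> cx.span (\<Union>\<zeta>\<in>-{1}. eigsp Ms \<zeta>)" by (rule cx.span_base)
    qed
    then show ?thesis using False by (simp add: E_def eigsp_ne1_def)
  qed (use eig in \<open>simp add: E_def\<close>)
qed

lemma eigsp_pairing: "x \<in> eigsp Ms \<zeta> \<Longrightarrow> y \<in> eigsp Ms \<mu> \<Longrightarrow> \<zeta> * \<mu> \<noteq> 1 \<Longrightarrow> cform S x y = 0"
  by (rule eigsp_orthogonal[OF bilin isometry])

lemma E_orthogonal: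
  assumes "x \<in> E \<zeta>" "y \<in> E \<mu>" "\<zeta> = 1 \<longleftrightarrow> \<mu> \<noteq> 1"
  shows "cform S x y = 0"
proof (rule cform_span_zero[OF bilin])
  let ?A = "\<lambda>\<zeta>. if \<zeta> = 1 then eigsp Ms 1 else \<Union>\<zeta>\<in>-{1}. eigsp Ms \<zeta>"
  show "x \<in> cx.span (?A \<zeta>)" "y \<in> cx.span (?A \<mu>)"
    using assms(1,2) by (auto simp: E_def eigsp_ne1_def intro: cx.span_base split: if_splits)
  show "cform S a b = 0" if "a \<in> ?A \<zeta>" "b \<in> ?A \<mu>" for a b
    using that assms(3) by (auto split: if_splits intro: eigsp_pairing)
qed

lemma cform_nondeg:
  assumes "\<And>\<zeta> g. g \<in> eigsp Ms \<zeta> \<Longrightarrow> cform S z g = 0"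
  shows "z = 0"
proof -
  have "cform S z y = 0" for y
    using cform_span_zero[OF bilin, of "{z}" "\<Union>\<zeta>. eigsp Ms \<zeta>" z y] assms span_eigsp
    by (auto intro: cx.span_base)
  from this[of "(y, 0)" for y] have "S (fst z) y = 0 \<and> S (snd z) y = 0" for y
    by (simp add: cform_def bilinear_rzero[OF bilin] complex_eq_iff)
  then have "fst z = 0" "snd z = 0"
    using nondeg by (auto simp: nondegenerate_on_def)
  then show ?thesis by (simp add: prod_eq_iff)
qed

text \<open>Such a vector lies in both summands, so it is orthogonal to the eigenvectors of both.\<close>

lemma E_eigsp_zero:
  assumes "z \<in> E \<zeta>" "z \<in> eigsp Ms \<mu>" "\<zeta> = 1 \<longleftrightarrow> \<mu> \<noteq> 1"
  shows "z = 0"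
proof (rule cform_nondeg)
  fix \<nu> g assume g: "g \<in> eigsp Ms \<nu>"
  show "cform S z g = 0"
  proof (cases "\<zeta> = 1 \<longleftrightarrow> \<nu> \<noteq> 1")
    case True
    then show ?thesis using E_orthogonal assms(1) g eigsp_E by blast
  next
    case False
    then have "\<mu> = 1 \<longleftrightarrow> \<nu> \<noteq> 1" using assms(3) by blast
    then show ?thesis using E_orthogonal[of z \<mu> g \<nu>] assms(2) g eigsp_E by blast
  qed
qed

subsection \<open>The primitive parts of Deligne's subspaces\<close>

lemma deligne_conj: "z \<in> deligne F W p q \<Longrightarrow> cconj z \<in> F q"
proof -
  assume "z \<in> deligne F W p q"
  then have "cconj z \<in> cconj ` deligne F W p q" by (rule imageI)
  also have "\<dots> = deligne F W q p"
    using split unfolding split_mhs_def by metis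
  finally show ?thesis by (simp add: deligne_def)
qed

lemma deligne_eq: "deligne F W p q = hodge_piece F W p q"
proof
  show "deligne F W p q \<subseteq> hodge_piece F W p q"
    using deligne_conj by (auto simp: hodge_piece_def deligne_def)
  show "hodge_piece F W p q \<subseteq> deligne F W p q"
    by (auto simp: hodge_piece_def deligne_def cconj_image_iff intro!: cx.span_base)
qed

abbreviation PV :: "complex \<Rightarrow> int \<Rightarrow> int \<Rightarrow> ('a \<times> 'a) set" where
  "PV \<zeta> \<equiv> prim_piece (\<lambda>p. F p \<inter> cpx (V \<zeta>)) (\<lambda>k. W k \<inter> V \<zeta>) N (m + theta \<zeta>)"

lemma split_pmhs_V:
  "split_pmhs (V \<zeta>) (m + theta \<zeta>) (\<lambda>p. F p \<inter> cpx (V \<zeta>)) (\<lambda>k. W k \<inter> V \<zeta>) N S"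
proof (rule split_pmhs.intro)
  show "pmhs (V \<zeta>) (m + theta \<zeta>) (\<lambda>p. F p \<inter> cpx (V \<zeta>)) (\<lambda>k. W k \<inter> V \<zeta>) N S"
    using steenbrink
    by (cases "\<zeta> = 1") (simp_all add: steenbrink_pmhs_def pmhs_restriction_def E_def theta_def)
  fix z p q assume z: "z \<in> deligne (\<lambda>p. F p \<inter> cpx (V \<zeta>)) (\<lambda>k. W k \<inter> V \<zeta>) p q"
  then have "z \<in> deligne F W p q"
    using deligne_mono[of "\<lambda>p. F p \<inter> cpx (V \<zeta>)" F "\<lambda>k. W k \<inter> V \<zeta>" W p q] by blast
  moreover have "z \<in> E \<zeta>" using z by (simp add: deligne_def cpx_V)
  ultimately show "cconj z \<in> F q \<inter> cpx (V \<zeta>)"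
    using deligne_conj E_conj by (auto simp: cpx_V conj_stable_def)
qed

abbreviation D :: "int \<Rightarrow> int \<Rightarrow> complex \<Rightarrow> ('a \<times> 'a) set" where
  "D \<equiv> deligne0 m F W Ms N"

lemma PV_iff: "z \<in> PV \<zeta> p q \<longleftrightarrow> z \<in> F p \<and> cconj z \<in> F q \<and> z \<in> E \<zeta> \<and> z \<in> cpx (W (p + q)) \<and>
    (cmap N ^^ nat (p + q - (m + theta \<zeta>) + 1)) z = 0"
proof -
  have "z \<in> cpx (W k \<inter> V \<zeta>) \<longleftrightarrow> z \<in> cpx (W k) \<and> z \<in> E \<zeta>" for k
    using cpx_iff[of z "V \<zeta>"] unfolding cpx_V by (auto simp: cpx_iff)
  then show ?thesis
    using E_conj[of \<zeta>] by (auto simp: prim_piece_def hodge_piece_def cpx_V conj_stable_def)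
qed

lemma D_eq: "D p q \<zeta> = PV \<zeta> p q \<inter> eigsp Ms \<zeta>"
proof -
  have "p + q - (m + theta \<zeta>) + 1 = ell m p q \<zeta> + 1" by (simp add: ell_def)
  then show ?thesis
    using eigsp_E[of \<zeta>]
    by (auto simp: deligne0_def PV_iff deligne_eq hodge_piece_def)
qed

text \<open>Each of the five conditions that define the piece is stable under \<open>Ms\<close> or under \<open>M\<close>.\<close>

lemma PV_graded: "eigen_graded Ms (PV \<zeta> p q)"
proof -
  let ?k = "nat (p + q - (m + theta \<zeta>) + 1)"
  have eq: "PV \<zeta> p q = F p \<inter> (cconj ` F q \<inter> (E \<zeta> \<inter> (cpx (W (p + q)) \<inter> {z. cmap (N ^^ ?k) z \<in> {0}})))"
    by (auto simp: PV_iff cconj_image_iff cmap_funpow)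
  have 1: "eigen_graded Ms (F p)" by (rule graded_Ms[OF F_subspace Ms_F])
  have 2: "eigen_graded Ms (cconj ` F q)"
    using Ms_F by (intro graded_Ms subspace_cconj F_subspace) (auto simp: cconj_image_iff cconj_cmap[OF lin_Ms])
  have 3: "eigen_graded Ms (E \<zeta>)" by (rule graded_Ms[OF E_subspace E_Ms])
  have 4: "eigen_graded Ms (cpx (W (p + q)))"
    using M_W by (intro graded_M subspace_cpx W_subspace) (auto simp: cpx_iff cmap_eq)
  have comm: "(N ^^ k) (Ms x) = Ms ((N ^^ k) x)" for k x
    by (induction k) (auto simp: N_Ms)
  have 5: "eigen_graded Ms {z. cmap (N ^^ ?k) z \<in> {0}}"
    by (intro graded_Ms subspace_vimage linear_funpow lin_N cx.subspace_single_0)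
      (auto simp: cmap_eq comm linear_0[OF lin_Ms] zero_prod_def)
  show ?thesis unfolding eq by (intro eigen_graded_Int 1 2 3 4 5)
qed

lemma D_subspace: "cx.subspace (D p q \<zeta>)"
proof -
  interpret V: split_pmhs "V \<zeta>" "m + theta \<zeta>" "\<lambda>p. F p \<inter> cpx (V \<zeta>)" "\<lambda>k. W k \<inter> V \<zeta>" N S
    by (rule split_pmhs_V)
  let ?k = "nat (p + q - (m + theta \<zeta>) + 1)"
  have "D p q \<zeta> = V.I p q \<inter> {z. cmap (N ^^ ?k) z \<in> {0}} \<inter> eigsp Ms \<zeta>"
    by (auto simp: D_eq prim_piece_def cmap_funpow)
  then show ?thesis
    by (simp only:) (intro cx.subspace_inter V.piece_subspace eig_subspace subspace_vimage
        linear_funpow lin_N cx.subspace_single_0)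
qed

lemma D_zero: "0 \<in> D p q \<zeta>"
  by (rule cx.subspace_0[OF D_subspace])

lemma D_eigsp: "a \<in> D p q \<zeta> \<Longrightarrow> (cmap N ^^ j) a \<in> eigsp Ms \<zeta>"
  by (intro N_eigsp) (simp add: D_eq)

lemma D_E: "a \<in> D p q \<zeta> \<Longrightarrow> (cmap N ^^ j) a \<in> E \<zeta>"
  using D_eigsp eigsp_E by blast

lemma D_cconj: "a \<in> D p q \<zeta> \<Longrightarrow> cconj a \<in> D q p (cnj \<zeta>)"
proof -
  interpret V: split_pmhs "V \<zeta>" "m + theta \<zeta>" "\<lambda>p. F p \<inter> cpx (V \<zeta>)" "\<lambda>k. W k \<inter> V \<zeta>" N S
    by (rule split_pmhs_V)
  have "PV (cnj \<zeta>) = PV \<zeta>"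
    using E_cong[of "cnj \<zeta>" \<zeta>] theta_cong[of "cnj \<zeta>" \<zeta>] by (simp add: cnj_eq_1)
  then show "a \<in> D p q \<zeta> \<Longrightarrow> cconj a \<in> D q p (cnj \<zeta>)"
    using V.prim_cconj eigsp_cconj[OF lin_Ms] by (simp add: D_eq)
qed

lemma D_cconj_image: "D q p (cnj \<zeta>) = cconj ` D p q \<zeta>"
  using D_cconj[of _ p q \<zeta>] D_cconj[of _ q p "cnj \<zeta>"] by (auto simp: cconj_image_iff)

lemma ell_cnj: "ell m q p (cnj \<zeta>) = ell m p q \<zeta>"
  by (simp add: ell_def theta_def cnj_eq_1)

lemma D_string_end: "a \<in> D p q \<zeta> \<Longrightarrow> ell m p q \<zeta> < int j \<Longrightarrow> (cmap N ^^ j) a = 0"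
  by (rule cmap_funpow_zero[OF lin_N, of "nat (ell m p q \<zeta> + 1)"]) (auto simp: deligne0_def)

text \<open>A nonzero pairing makes the eigenvalues inverse to each other, hence both equal to \<open>1\<close> or both
  different from it. The vectors then lie in the same summand, where the Hodge types can be compared.\<close>

lemma D_pairing:
  assumes a: "a \<in> D p q \<zeta>" "0 \<le> ell m p q \<zeta>" and b: "b \<in> D r s \<mu>" "0 \<le> ell m r s \<mu>"
    and nz: "cform S ((cmap N ^^ i) a) ((cmap N ^^ j) b) \<noteq> 0"
  shows "r = q" "s = p" "\<zeta> * \<mu> = 1" "int (i + j) = ell m p q \<zeta>"
proof -
  interpret V: split_pmhs "V \<zeta>" "m + theta \<zeta>" "\<lambda>p. F p \<inter> cpx (V \<zeta>)" "\<lambda>k. W k \<inter> V \<zeta>" N S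
    by (rule split_pmhs_V)
  show z: "\<zeta> * \<mu> = 1"
    using eigsp_pairing[OF D_eigsp[OF a(1)] D_eigsp[OF b(1)]] nz by blast
  then have "\<zeta> = 1 \<longleftrightarrow> \<mu> = 1" by auto
  then have eq: "PV \<mu> = PV \<zeta>" "theta \<mu> = theta \<zeta>"
    using E_cong[of \<mu> \<zeta>] theta_cong[of \<mu> \<zeta>] by simp_all
  have "a \<in> PV \<zeta> p q" "b \<in> PV \<zeta> r s" using a b eq by (simp_all add: D_eq)
  with V.prim_pairing[of a p q b r s i j] nz a(2) b(2) eq
  show "r = q" "s = p" "int (i + j) = ell m p q \<zeta>" by (simp_all add: ell_def)
qed

lemma D_positive:
  assumes a: "a \<in> D p q \<zeta>" "a \<noteq> 0" and l: "ell m p q \<zeta> = int l"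
  obtains r where "r > 0" "\<i> powi (p - q) * cform S a ((cmap N ^^ l) (cconj a)) = complex_of_real r"
proof -
  interpret V: split_pmhs "V \<zeta>" "m + theta \<zeta>" "\<lambda>p. F p \<inter> cpx (V \<zeta>)" "\<lambda>k. W k \<inter> V \<zeta>" N S
    by (rule split_pmhs_V)
  have "a \<in> PV \<zeta> p q" using a by (simp add: D_eq)
  moreover have "p + q = m + theta \<zeta> + int l" using l by (simp add: ell_def)
  ultimately show ?thesis using V.prim_positive[of a p q l] a(2) that by metis
qed

text \<open>The number \<open>S(a, N\<^sup>l b)\<close>, for \<open>b\<close> the conjugate of \<open>a\<close>, is nonzero by the polarization; the
  eigenvalues \<open>\<zeta>\<close> and \<open>cnj \<zeta>\<close> can only pair if they are inverse to each other.\<close>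

lemma D_unit_circle:
  assumes "D p q \<zeta> \<noteq> {0}" "0 \<le> ell m p q \<zeta>"
  shows "cmod \<zeta> = 1"
proof -
  obtain a where a: "a \<in> D p q \<zeta>" "a \<noteq> 0" using assms(1) D_zero[of p q \<zeta>] by blast
  obtain l where l: "ell m p q \<zeta> = int l" using assms(2) zero_le_imp_eq_int by blast
  obtain r where r: "r > 0" "\<i> powi (p - q) * cform S a ((cmap N ^^ l) (cconj a)) = complex_of_real r"
    using D_positive[OF a l] by metis
  then have "cform S ((cmap N ^^ 0) a) ((cmap N ^^ l) (cconj a)) \<noteq> 0" by auto
  from D_pairing(3)[OF a(1) assms(2) D_cconj[OF a(1)] _ this] have "\<zeta> * cnj \<zeta> = 1"
    using assms(2) by (simp add: ell_cnj)
  then have "(cmod \<zeta>)\<^sup>2 = 1" by (metis complex_mod_mult_cnj norm_one)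
  then show ?thesis using norm_ge_zero[of \<zeta>] by (simp add: power2_eq_1_iff)
qed

definition strings :: "int \<Rightarrow> int \<Rightarrow> complex \<Rightarrow> ('a \<times> 'a) set" where
  "strings p q \<zeta> = (\<Union>j\<in>{..nat (ell m p q \<zeta>)}. (cmap N ^^ j) ` D p q \<zeta>)"

lemma strings_span: "cx.span (\<Union>(p, q, \<zeta>)\<in>{(p, q, \<zeta>). 0 \<le> ell m p q \<zeta>}. strings p q \<zeta>) = UNIV"
proof -
  let ?T = "cx.span (\<Union>(p, q, \<zeta>)\<in>{(p, q, \<zeta>). 0 \<le> ell m p q \<zeta>}. strings p q \<zeta>)"
  have str: "strings p q \<zeta> \<subseteq> ?T" if "0 \<le> ell m p q \<zeta>" for p q \<zeta>
    using that by (intro subset_trans[OF _ cx.span_superset] UN_upper[of "(p, q, \<zeta>)" _ "\<lambda>(p, q, \<zeta>). strings p q \<zeta>", simplified]) auto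
  have "E \<zeta> \<subseteq> ?T" for \<zeta>
  proof -
    interpret V: split_pmhs "V \<zeta>" "m + theta \<zeta>" "\<lambda>p. F p \<inter> cpx (V \<zeta>)" "\<lambda>k. W k \<inter> V \<zeta>" N S
      by (rule split_pmhs_V)
    let ?P = "\<Union>(p, q)\<in>{(p, q). m + theta \<zeta> \<le> p + q}. \<Union>j\<in>{..nat (p + q - (m + theta \<zeta>))}.
        (cmap N ^^ j) ` PV \<zeta> p q"
    have "?P \<subseteq> ?T"
    proof
      fix z assume "z \<in> ?P"
      then obtain p q j x where pq: "m + theta \<zeta> \<le> p + q" "j \<le> nat (p + q - (m + theta \<zeta>))"
        and x: "x \<in> PV \<zeta> p q" and z: "z = (cmap N ^^ j) x" by blast
      let ?X = "{z. cmap (N ^^ j) z \<in> ?T}"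
      have "cx.subspace ?X" by (intro subspace_vimage linear_funpow lin_N cx.subspace_span)
      moreover have "PV \<zeta> p q \<inter> eigsp Ms \<mu> \<subseteq> ?X" for \<mu>
      proof (cases "\<zeta> = 1 \<longleftrightarrow> \<mu> = 1")
        case True
        have eq: "PV \<zeta> = PV \<mu>" "theta \<zeta> = theta \<mu>"
          using E_cong[OF True] theta_cong[OF True] by simp_all
        have "0 \<le> ell m p q \<mu>" using pq eq by (simp add: ell_def)
        moreover have "(cmap N ^^ j) z \<in> strings p q \<mu>" if "z \<in> D p q \<mu>" for z
          using that pq(2) unfolding strings_def ell_def eq(2) by (auto simp: algebra_simps)
        ultimately show ?thesis
          using str[of p q \<mu>] eq(1) by (auto simp: D_eq cmap_funpow)
      next
        case False
        then have "z = 0" if "z \<in> PV \<zeta> p q \<inter> eigsp Ms \<mu>" for z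
          using E_eigsp_zero[of z \<zeta> \<mu>] that by (auto simp: PV_iff)
        then show ?thesis
          using cmap_zero[OF linear_funpow[OF lin_N, of j]] cx.span_zero by fastforce
      qed
      ultimately have "cx.span (\<Union>\<mu>. PV \<zeta> p q \<inter> eigsp Ms \<mu>) \<subseteq> ?X"
        by (intro cx.span_minimal UN_least)
      then have "x \<in> ?X" using graded_span[OF PV_graded] x by blast
      then show "z \<in> ?T" by (simp add: z cmap_funpow)
    qed
    then have "cx.span ?P \<subseteq> ?T" by (intro cx.span_minimal cx.subspace_span)
    then show ?thesis using V.primitive_span by (simp add: cpx_V)
  qed
  then have "(\<Union>\<zeta>. eigsp Ms \<zeta>) \<subseteq> ?T" using eigsp_E by blast
  then have "cx.span (\<Union>\<zeta>. eigsp Ms \<zeta>) \<subseteq> ?T" by (intro cx.span_minimal cx.subspace_span)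
  then show ?thesis by (auto simp: span_eigsp)
qed

subsection \<open>Subspaces stable under the monodromy\<close>

text \<open>These conditions make the real points of the span stable under \<open>M\<close>, with \<open>Ms\<close> and \<open>N\<close> as the
  semisimple part and the logarithm of the restriction.\<close>

definition monodromic :: "('a \<times> 'a) set \<Rightarrow> bool" where
  "monodromic G \<longleftrightarrow> (\<forall>g\<in>G. (\<exists>\<zeta>. g \<in> eigsp Ms \<zeta>) \<and> cmap N g \<in> cx.span G \<and> cconj g \<in> cx.span G)"

context
  fixes G :: "('a \<times> 'a) set"
  assumes mono: "monodromic G"
begin

lemma monodromic_conj: "conj_stable (cx.span G)"
  using mono by (intro span_conj_stable) (simp add: monodromic_def)

lemma monodromic_cpx: "cpx (real_pts (cx.span G)) = cx.span G"
  by (intro cpx_real_pts monodromic_conj cx.subspace_span)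

lemma monodromic_real_subspace: "subspace (real_pts (cx.span G))"
  by (intro subspace_real_pts cx.subspace_span)

lemma real_pts_map:
  assumes "linear f" "\<And>g. g \<in> G \<Longrightarrow> cmap f g \<in> cx.span G" "x \<in> real_pts (cx.span G)"
  shows "f x \<in> real_pts (cx.span G)"
  using span_map_stable[OF assms(1,2), of "(x, 0)"] assms(3)
  by (simp add: real_pts_iff cmap_eq linear_0[OF assms(1)])

lemma monodromic_N: "x \<in> real_pts (cx.span G) \<Longrightarrow> N x \<in> real_pts (cx.span G)"
  using mono by (intro real_pts_map[OF lin_N]) (simp_all add: monodromic_def)

lemma monodromic_u: "x \<in> real_pts (cx.span G) \<Longrightarrow> u x \<in> real_pts (cx.span G)"
  by (rule u_stable[OF monodromic_real_subspace monodromic_N])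

lemma monodromic_Ms: "x \<in> real_pts (cx.span G) \<Longrightarrow> Ms x \<in> real_pts (cx.span G)"
proof (rule real_pts_map[OF lin_Ms])
  fix g assume "g \<in> G"
  then obtain \<zeta> where "g \<in> eigsp Ms \<zeta>" using mono by (auto simp: monodromic_def)
  with \<open>g \<in> G\<close> show "cmap Ms g \<in> cx.span G"
    by (simp add: eigsp_def cx.span_scale cx.span_base)
qed

lemma monodromic_Mu: "x \<in> real_pts (cx.span G) \<Longrightarrow> Mu x \<in> real_pts (cx.span G)"
  using subspace_add[OF monodromic_real_subspace, of x "u x"] monodromic_u[of x]
  by (simp add: u_def)

lemma monodromic_parts: "monodromy_parts (real_pts (cx.span G)) M Ms N"
  unfolding monodromy_parts_def
proof (intro conjI lin_Ms lin_N exI[of _ Mu] lin_Mu)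
  show "Ms ` real_pts (cx.span G) \<subseteq> real_pts (cx.span G)" using monodromic_Ms by blast
  show "Mu ` real_pts (cx.span G) \<subseteq> real_pts (cx.span G)" using monodromic_Mu by blast
  show "nilpotent_on (real_pts (cx.span G)) (\<lambda>x. Mu x - x)"
    using nilpotent by (auto simp: nilpotent_on_def)
  show "\<forall>x\<in>real_pts (cx.span G). M x = Ms (Mu x) \<and> M x = Mu (Ms x) \<and> N x = unip_log Mu x"
    by (simp add: N_eq flip: M_eq M_eq')
  show "semisimple_on (real_pts (cx.span G)) Ms"
    unfolding semisimple_on_def monodromic_cpx
  proof
    show "cx.span {z \<in> cx.span G. \<exists>c. cmap Ms z = cscale c z} \<subseteq> cx.span G"
      by (intro cx.span_minimal) auto
    show "cx.span G \<subseteq> cx.span {z \<in> cx.span G. \<exists>c. cmap Ms z = cscale c z}"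
      using mono by (intro cx.span_mono) (auto simp: monodromic_def eigsp_def cx.span_base)
  qed
qed

lemma cmap_u_span:
  assumes "z \<in> cx.span G" shows "cmap u z \<in> cx.span G"
proof -
  have "z \<in> cpx (real_pts (cx.span G))" using assms by (simp only: monodromic_cpx)
  then have "cmap u z \<in> cpx (real_pts (cx.span G))"
    using monodromic_u by (simp add: cpx_iff cmap_eq)
  then show ?thesis by (simp only: monodromic_cpx)
qed

text \<open>On an eigenvector \<open>M\<close> is a nonzero multiple of a unipotent map, whose inverse is a polynomial in
  \<open>Mu - id\<close>.\<close>

lemma monodromic_M: "M ` real_pts (cx.span G) = real_pts (cx.span G)"
proof
  show "M ` real_pts (cx.span G) \<subseteq> real_pts (cx.span G)"
    using monodromic_Ms monodromic_Mu by (auto simp: M_eq)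
  have sub: "cx.subspace (cmap M ` cx.span G)"
  proof (rule cx.subspaceI)
    show "0 \<in> cmap M ` cx.span G"
      by (intro image_eqI[of _ _ 0]) (simp_all add: cmap_zero[OF lin_M] cx.span_zero)
    show "x + y \<in> cmap M ` cx.span G" if "x \<in> cmap M ` cx.span G" "y \<in> cmap M ` cx.span G" for x y
    proof -
      obtain x' y' where "x' \<in> cx.span G" "x = cmap M x'" "y' \<in> cx.span G" "y = cmap M y'"
        using \<open>x \<in> cmap M ` cx.span G\<close> \<open>y \<in> cmap M ` cx.span G\<close> by blast
      then show ?thesis
        by (intro image_eqI[of _ _ "x' + y'"]) (simp_all add: cmap_add[OF lin_M] cx.span_add)
    qed
    show "cscale c x \<in> cmap M ` cx.span G" if "x \<in> cmap M ` cx.span G" for c x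
    proof -
      obtain y where "y \<in> cx.span G" "x = cmap M y" using \<open>x \<in> cmap M ` cx.span G\<close> by blast
      then show ?thesis by (intro image_eqI[of _ _ "cscale c y"]) (simp_all add: cmap_cscale[OF lin_M] cx.span_scale)
    qed
  qed
  have "g \<in> cmap M ` cx.span G" if g: "g \<in> G" for g
  proof (cases "g = 0")
    case True
    then show ?thesis using cx.subspace_0[OF sub] by simp
  next
    case False
    obtain \<zeta> where \<zeta>: "g \<in> eigsp Ms \<zeta>" using g mono by (auto simp: monodromic_def)
    have "\<zeta> \<noteq> 0"
    proof
      assume "\<zeta> = 0"
      then have "cmap M g = cmap M 0" using M_eigsp[OF \<zeta>] by (simp add: cmap_zero[OF lin_M])
      then have "g = 0" using M_bij by (simp add: cmap_eq prod_eq_iff bij_def inj_eq)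
      with False show False ..
    qed
    have span: "(cmap u ^^ j) g \<in> cx.span G" for j
      by (induction j) (auto simp: cx.span_base g cmap_u_span)
    have "(cmap u ^^ (K - n)) g \<in> cmap M ` cx.span G" for n
    proof (induction n)
      case 0
      then show ?case using cx.subspace_0[OF sub] by (simp add: cu_pow_zero)
    next
      case (Suc n)
      show ?case
      proof (cases "n < K")
        case True
        define j where "j = K - Suc n"
        have j: "K - n = Suc j" using True by (simp add: j_def)
        have "cmap M ((cmap u ^^ j) g) = cscale \<zeta> ((cmap u ^^ j) g + (cmap u ^^ Suc j) g)"
          using M_eigsp[OF u_eigsp[OF \<zeta>]] by simp
        then have "(cmap u ^^ j) g =
            cscale (inverse \<zeta>) (cmap M ((cmap u ^^ j) g)) - (cmap u ^^ Suc j) g"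
          using \<open>\<zeta> \<noteq> 0\<close> by simp
        also have "\<dots> \<in> cmap M ` cx.span G"
          using Suc span unfolding j
          by (intro cx.subspace_diff[OF sub] cx.subspace_scale[OF sub]) blast+
        finally show ?thesis by (simp add: j_def)
      next
        case False
        then show ?thesis using Suc by (simp add: not_less)
      qed
    qed
    from this[of K] show ?thesis by simp
  qed
  then have "cx.span G \<subseteq> cmap M ` cx.span G" by (intro cx.span_minimal sub subsetI)
  then show "real_pts (cx.span G) \<subseteq> M ` real_pts (cx.span G)"
  proof (intro subsetI)
    fix x assume "cx.span G \<subseteq> cmap M ` cx.span G" "x \<in> real_pts (cx.span G)"
    then obtain z where "z \<in> cx.span G" "(x, 0) = cmap M z" by (auto simp: real_pts_iff)
    then show "x \<in> M ` real_pts (cx.span G)"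
      using conj_stable_parts(1)[OF cx.subspace_span monodromic_conj] by (auto simp: cmap_eq)
  qed
qed

lemma monodromic_triple:
  assumes "cx.span G \<subseteq> E \<zeta>" and nd: "cnondeg S (cx.span G)"
  shows "isometric_triple (real_pts (cx.span G)) M S"
  unfolding isometric_triple_def
proof (intro conjI bilin lin_M monodromic_M)
  show "findim_subspace (real_pts (cx.span G))"
    by (rule findim_subset[OF findim monodromic_real_subspace])
  show "\<forall>x\<in>real_pts (cx.span G). \<forall>y\<in>real_pts (cx.span G). S (M x) (M y) = S x y"
    by (simp add: isometry)
  show "nondegenerate_on (real_pts (cx.span G)) S"
    unfolding nondegenerate_on_def
  proof (intro ballI impI)
    fix x assume x: "x \<in> real_pts (cx.span G)" "\<forall>y\<in>real_pts (cx.span G). S x y = 0"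
    have "cform S (x, 0) y = 0" if "y \<in> cx.span G" for y
      using x(2) conj_stable_parts[OF cx.subspace_span monodromic_conj that]
      by (simp add: cform_def bilinear_lzero[OF bilin] complex_eq_iff)
    then show "x = 0"
      using nd x(1) by (auto simp: cnondeg_def real_pts_iff zero_prod_def)
  qed
  have sym: "S y x = (-1) powi (m + theta \<zeta>) * S x y"
    if "x \<in> real_pts (cx.span G)" "y \<in> real_pts (cx.span G)" for x y
    using that assms(1)
    by (intro pmhsD(5)[OF split_pmhs.pmhs[OF split_pmhs_V]]) (auto simp: real_pts_iff)
  show "(\<forall>x\<in>real_pts (cx.span G). \<forall>y\<in>real_pts (cx.span G). S y x = S x y) \<or>
    (\<forall>x\<in>real_pts (cx.span G). \<forall>y\<in>real_pts (cx.span G). S y x = - S x y)"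
  proof (cases "even (m + theta \<zeta>)")
    case True
    then have "S y x = S x y" if "x \<in> real_pts (cx.span G)" "y \<in> real_pts (cx.span G)" for x y
      using sym[OF that] by simp
    then show ?thesis by blast
  next
    case False
    then have "S y x = - S x y" if "x \<in> real_pts (cx.span G)" "y \<in> real_pts (cx.span G)" for x y
      using sym[OF that] by simp
    then show ?thesis by blast
  qed
qed

end

end

section \<open>Signs\<close>

text \<open>The two conditions say that \<open>\<alpha>\<close> is determined modulo \<open>1\<close> by \<open>\<zeta>\<close> and lies in the half-open
  interval from \<open>m - p - 1\<close> (excluded) to \<open>m - p\<close> (included).\<close>

lemma ceiling_alpha:
  assumes "cmod \<zeta> = 1"
  shows "\<lceil>alpha m p \<zeta>\<rceil> = m - p"
proof -
  let ?P = "\<lambda>\<alpha>. exp (- 2 * of_real pi * \<i> * of_real \<alpha>) = \<zeta> \<and> \<lfloor>of_int m - \<alpha>\<rfloor> = p"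
  have "\<exists>!\<alpha>. ?P \<alpha>"
  proof (rule ex_ex1I)
    define \<beta> where "\<beta> = - Arg \<zeta> / (2 * pi)"
    \<comment> \<open>\<beta> has the right exponential; the integer shift adjusts the floor\<close>
    define \<alpha> where "\<alpha> = \<beta> + of_int (\<lfloor>of_int m - \<beta>\<rfloor> - p)"
    have "exp (- 2 * of_real pi * \<i> * of_real \<alpha>) =
        exp (\<i> * of_real (Arg \<zeta>)) * exp (of_int (p - \<lfloor>of_int m - \<beta>\<rfloor>) * (2 * of_real pi * \<i>))"
      by (simp add: \<alpha>_def \<beta>_def algebra_simps flip: exp_add)
    also have "exp (of_int (p - \<lfloor>of_int m - \<beta>\<rfloor>) * (2 * of_real pi * \<i>)) = 1"
      by (auto simp: exp_eq_1 intro!: exI[of _ "p - \<lfloor>of_int m - \<beta>\<rfloor>"])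
    also have "exp (\<i> * of_real (Arg \<zeta>)) = \<zeta>"
      using Arg_eq[of \<zeta>] assms by force
    finally have "exp (- 2 * of_real pi * \<i> * of_real \<alpha>) = \<zeta>" by simp
    moreover have "of_int m - \<alpha> = of_int m - \<beta> + of_int (p - \<lfloor>of_int m - \<beta>\<rfloor>)"
      by (simp add: \<alpha>_def)
    then have "\<lfloor>of_int m - \<alpha>\<rfloor> = p" by (simp only: floor_add_int[symmetric])
    ultimately show "\<exists>\<alpha>. ?P \<alpha>" by blast
  next
    fix \<alpha> \<alpha>' assume 1: "?P \<alpha>" and 2: "?P \<alpha>'"
    then have "exp (- 2 * of_real pi * \<i> * of_real \<alpha>) = exp (- 2 * of_real pi * \<i> * of_real \<alpha>')"
      by simp
    then obtain n :: int where n: "- 2 * of_real pi * \<i> * of_real \<alpha> =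
        - 2 * of_real pi * \<i> * of_real \<alpha>' + of_int (2 * n) * pi * \<i>"
      unfolding exp_eq by blast
    have "- 2 * pi * \<alpha> = - 2 * pi * \<alpha>' + 2 * n * pi"
      using arg_cong[OF n, of Im] by simp
    then have "pi * (\<alpha>' - \<alpha> - n) = 0" by (simp add: algebra_simps)
    then have "of_int m - \<alpha> = of_int m - \<alpha>' + of_int n" by simp
    then have "\<lfloor>of_int m - \<alpha>\<rfloor> = \<lfloor>of_int m - \<alpha>'\<rfloor> + n" by (simp only: floor_add_int)
    with 1 2 have "n = 0" by simp
    with \<open>of_int m - \<alpha> = of_int m - \<alpha>' + of_int n\<close> show "\<alpha> = \<alpha>'" by simp
  qed
  from theI'[OF this] have "\<lfloor>of_int m - alpha m p \<zeta>\<rfloor> = p"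
    unfolding alpha_def by blast
  then show ?thesis by linarith
qed

lemma signA_cases: "signA m p \<zeta> \<in> {1, -1}"
proof -
  have "(-1 :: real) powi k \<in> {1, -1}" for k :: int
    by (cases "even k") auto
  then show ?thesis unfolding signA_def by blast
qed

text \<open>The left side is the pairing of the ends of a string that the normal form prescribes, the right
  side is the value that the polarization prescribes. All exponents of \<open>\<i>\<close> add up, because
  \<open>2 (m - p - 1) + l + 2 + \<theta> - m = q - p\<close>.\<close>

lemma sign_type2:
  assumes "cmod \<zeta> = 1" "ell m p q \<zeta> = int l"
  shows "\<i> ^ (l + 1 + nat ((m + theta \<zeta>) mod 2) + 1) * of_real (signA m p \<zeta>) = \<i> powi (q - p)"
proof -
  define \<mu> where "\<mu> = (m + theta \<zeta>) mod 2"
  define x where "x = m - p - 1 - (m - theta \<zeta> + \<mu>) div 2"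
  have "even (m - theta \<zeta> + \<mu>)" unfolding \<mu>_def by presburger
  then have 2: "2 * ((m - theta \<zeta> + \<mu>) div 2) = m - theta \<zeta> + \<mu>" by simp
  have "\<mu> \<ge> 0" by (simp add: \<mu>_def)
  have i2: "(\<i> powi 2) powi x = \<i> powi (2 * x)" by (simp only: power_int_mult)
  have "of_real (signA m p \<zeta>) = (-1 :: complex) powi x"
    unfolding signA_def ceiling_alpha[OF assms(1)] x_def \<mu>_def by (simp add: of_real_power_int)
  also have "\<dots> = \<i> powi (2 * x)" using i2 by simp
  finally have "\<i> ^ (l + 1 + nat \<mu> + 1) * of_real (signA m p \<zeta>) =
      \<i> powi (int (l + 1 + nat \<mu> + 1)) * \<i> powi (2 * x)" by (simp only: power_int_of_nat)
  also have "\<dots> = \<i> powi (int (l + 1 + nat \<mu> + 1) + 2 * x)" by (simp add: power_int_add)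
  also have "int (l + 1 + nat \<mu> + 1) + 2 * x = q - p"
    using 2 assms(2) \<open>\<mu> \<ge> 0\<close> unfolding x_def ell_def by (simp add: algebra_simps)
  finally show ?thesis unfolding \<mu>_def .
qed

lemma signB_eq: "cmod \<zeta> = 1 \<Longrightarrow> signB m p \<zeta> = 1"
proof -
  assume "cmod \<zeta> = 1"
  moreover have "m - theta \<zeta> - ell m p p \<zeta> = 2 * (m - p)" by (simp add: ell_def)
  then have "(m - theta \<zeta> - ell m p p \<zeta>) div 2 = m - p" by presburger
  ultimately show ?thesis unfolding signB_def by (simp only: ceiling_alpha) simp
qed

lemma cnj_of_unit: "cmod \<zeta> = 1 \<Longrightarrow> \<zeta> * \<mu> = 1 \<Longrightarrow> \<mu> = cnj \<zeta>"
proof -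
  assume "cmod \<zeta> = 1" and *: "\<zeta> * \<mu> = 1"
  then have "\<zeta> * cnj \<zeta> = 1" by (simp flip: complex_norm_square)
  then have "cnj \<zeta> * (\<zeta> * \<mu>) = \<mu>" by (metis mult.assoc mult.commute mult_1)
  then show ?thesis using * by simp
qed

lemma real_cnj: "cnj \<zeta> = \<zeta> \<longleftrightarrow> \<zeta> \<in> \<real>"
  using Reals_cnj_iff by blast

lemma unit_real: "cmod \<zeta> = 1 \<Longrightarrow> \<zeta> \<in> \<real> \<Longrightarrow> \<zeta> \<in> {1, -1}"
  by (auto elim!: Reals_cases simp: abs_if split: if_splits)

section \<open>Isometric triples from strings\<close>

context steenbrink_split
begin

text \<open>The conjugate string is included to make the span conjugation stable; for a real \<open>e\<close> the two
  strings coincide.\<close>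

definition string :: "('a \<times> 'a) \<Rightarrow> nat \<Rightarrow> ('a \<times> 'a) set" where
  "string e l = (\<Union>j\<in>{..l}. {(cmap N ^^ j) e, (cmap N ^^ j) (cconj e)})"

lemma cx_finite_basis:
  assumes "cx.subspace (C :: ('a \<times> 'a) set)"
  obtains B where "finite B" "C = cx.span B"
proof -
  obtain B0 where B0: "finite B0" "(UNIV :: 'a set) = span B0"
    using findim by (auto simp: findim_subspace_def)
  let ?G = "(\<lambda>b. (b, 0 :: 'a)) ` B0"
  have G: "UNIV = cx.span ?G" using cx_span_real_basis[OF B0(2)] by simp
  obtain B where B: "B \<subseteq> C" "cx.independent B" "C \<subseteq> cx.span B" "card B = cx.dim C"
    by (rule cx.basis_exists)
  have "finite B"
    using cx.independent_span_bound[of ?G B] B0(1) B(2) by (simp flip: G)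
  moreover have "C = cx.span B"
    using B cx.span_minimal[OF B(1) assms] by auto
  ultimately show ?thesis by (rule that)
qed

lemma string_subspace_E: "e \<in> D p q \<zeta> \<Longrightarrow> cx.span (string e l) \<subseteq> E \<zeta>"
proof (intro cx.span_minimal E_subspace subsetI)
  fix x assume e: "e \<in> D p q \<zeta>" and "x \<in> string e l"
  then obtain j where "x = (cmap N ^^ j) e \<or> x = (cmap N ^^ j) (cconj e)" by (auto simp: string_def)
  then show "x \<in> E \<zeta>"
    using D_E[OF e, of j] D_E[OF D_cconj[OF e], of j] E_cong[of "cnj \<zeta>" \<zeta>] by (auto simp: cnj_eq_1)
qed

lemma string_monodromic:
  assumes e: "e \<in> D p q \<zeta>" and l: "ell m p q \<zeta> = int l"
  shows "monodromic (string e l)"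
  unfolding monodromic_def
proof
  fix g assume "g \<in> string e l"
  then obtain j f \<mu> where g: "j \<le> l" "g = (cmap N ^^ j) f" and f: "f = e \<and> \<mu> = \<zeta> \<or> f = cconj e \<and> \<mu> = cnj \<zeta>"
    unfolding string_def by blast
  have 1: "g \<in> eigsp Ms \<mu>" using f D_eigsp[OF e] D_eigsp[OF D_cconj[OF e]] g by auto
  have "cconj g \<in> string e l"
    using g f by (auto simp: string_def cconj_funpow[OF lin_N])
  then have 2: "cconj g \<in> cx.span (string e l)" by (rule cx.span_base)
  have "cmap N g \<in> cx.span (string e l)"
  proof (cases "Suc j \<le> l")
    case True
    have "(cmap N ^^ Suc j) f \<in> string e l" using f True unfolding string_def by blast
    then show ?thesis using g by (simp add: cx.span_base)
  next
    case False
    then have "(cmap N ^^ Suc j) f = 0"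
      using f D_string_end[OF e, of "Suc j"] D_string_end[OF D_cconj[OF e], of "Suc j"] l
      by (auto simp: ell_cnj simp del: funpow.simps)
    then show ?thesis using g by (simp add: cx.span_zero)
  qed
  with 1 2 show "(\<exists>\<zeta>. g \<in> eigsp Ms \<zeta>) \<and> cmap N g \<in> cx.span (string e l) \<and> cconj g \<in> cx.span (string e l)"
    by blast
qed

lemma string_pairing:
  assumes e: "e \<in> D p q \<zeta>" and f: "f \<in> D p q \<zeta>" and l: "ell m p q \<zeta> = int l"
  shows "cform S ((cmap N ^^ i) e) ((cmap N ^^ j) (cconj f)) =
    (if i + j = l then (-1) ^ i * cform S e ((cmap N ^^ l) (cconj f)) else 0)"
proof (cases "i + j = l")
  case True
  interpret V: split_pmhs "V \<zeta>" "m + theta \<zeta>" "\<lambda>p. F p \<inter> cpx (V \<zeta>)" "\<lambda>k. W k \<inter> V \<zeta>" N S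
    by (rule split_pmhs_V)
  have "e \<in> E \<zeta>" using D_E[OF e, of 0] by simp
  moreover have "(cmap N ^^ j) (cconj f) \<in> E \<zeta>"
    using D_E[OF D_cconj[OF f], of j] E_cong[of "cnj \<zeta>" \<zeta>] by (simp add: cnj_eq_1)
  ultimately have "cform S ((cmap N ^^ i) e) ((cmap N ^^ j) (cconj f)) =
      (-1) ^ i * cform S e ((cmap N ^^ i) ((cmap N ^^ j) (cconj f)))"
    by (intro V.cform_N_pow) (simp_all add: cpx_V)
  also have "(cmap N ^^ i) ((cmap N ^^ j) (cconj f)) = (cmap N ^^ l) (cconj f)"
    using True by (simp flip: True add: funpow_add)
  finally show ?thesis using True by simp
next
  case False
  have "ell m q p (cnj \<zeta>) = int l" using l by (simp add: ell_cnj)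
  then have "cform S ((cmap N ^^ i) e) ((cmap N ^^ j) (cconj f)) = 0"
    using D_pairing(4)[OF e _ D_cconj[OF f], of i j] False l by auto
  with False show ?thesis by simp
qed

lemma string_null:
  assumes e: "e \<in> D p q \<zeta>" and f: "f \<in> D p q \<zeta>" and l: "ell m p q \<zeta> = int l"
    and ne: "(p, \<zeta>) \<noteq> (q, cnj \<zeta>)"
  shows "cform S ((cmap N ^^ i) e) ((cmap N ^^ j) f) = 0"
proof (rule ccontr)
  assume nz: "cform S ((cmap N ^^ i) e) ((cmap N ^^ j) f) \<noteq> 0"
  then have "(cmap N ^^ i) e \<noteq> 0" using cform_zero_left[OF bilin] by metis
  then have "e \<noteq> 0" using cmap_zero[OF linear_funpow[OF lin_N]] by (metis cmap_funpow)
  then have "cmod \<zeta> = 1" using D_unit_circle[of p q \<zeta>] e l by auto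
  with D_pairing[OF e _ f _ nz] l cnj_of_unit have "p = q" "\<zeta> = cnj \<zeta>" by auto
  with ne show False by simp
qed

lemma index_reflect: "1 \<le> (k::nat) \<Longrightarrow> k \<le> n \<Longrightarrow> j + (n + 1 - k) = n + 1 \<longleftrightarrow> j = k"
  by auto

text \<open>The basis is \<open>a\<^sub>k = N\<^sup>k\<^sup>-\<^sup>1 e\<close>. Up to a nonzero factor the dual basis vector of \<open>a\<^sub>k\<close> is the
  conjugate of \<open>a\<^sub>n\<^sub>+\<^sub>1\<^sub>-\<^sub>k\<close>, and the type excludes pairings of the string with itself.\<close>

lemma string_Tr2:
  assumes e: "e \<in> D p q \<zeta>" and l: "ell m p q \<zeta> = int l"
    and ne: "(p, \<zeta>) \<noteq> (q, cnj \<zeta>)"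
    and norm: "\<i> powi (p - q) * cform S e ((cmap N ^^ l) (cconj e)) = 1"
  shows "cnondeg S (cx.span (string e l))"
    "is_Tr2 (real_pts (cx.span (string e l))) M S \<zeta> (l + 1) (nat ((m + theta \<zeta>) mod 2)) (signA m p \<zeta>)"
proof -
  define n where "n = l + 1"
  define \<mu> where "\<mu> = nat ((m + theta \<zeta>) mod 2)"
  define \<epsilon> where "\<epsilon> = signA m p \<zeta>"
  define a where "a k = (cmap N ^^ (k - 1)) e" for k
  define c where "c = \<i> ^ (n + \<mu> + 1) * complex_of_real \<epsilon>"
  have "e \<noteq> 0"
    using norm cform_zero_left[OF bilin, of "(cmap N ^^ l) (cconj e)"] by auto
  then have unit: "cmod \<zeta> = 1" using D_unit_circle[of p q \<zeta>] e l by auto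
  have "cform S e ((cmap N ^^ l) (cconj e)) = \<i> powi (q - p)"
  proof -
    have "\<i> powi (q - p) * \<i> powi (p - q) = 1" by (simp flip: power_int_add)
    then show ?thesis using norm by (metis mult.assoc mult.commute mult.right_neutral)
  qed
  also have "\<dots> = c"
    using sign_type2[OF unit l] by (simp add: c_def n_def \<mu>_def \<epsilon>_def)
  finally have ce: "cform S e ((cmap N ^^ l) (cconj e)) = c" .
  have c0: "c \<noteq> 0" using norm ce by auto
  have ca: "cconj (a k) = (cmap N ^^ (k - 1)) (cconj e)" for k
    by (simp add: a_def cconj_funpow[OF lin_N])
  have p1: "cform S (a j) (cconj (a k)) = c * of_real (Eper n j k)" if "j \<in> {1..n}" "k \<in> {1..n}" for j k
    using that string_pairing[OF e e l, of "j - 1" "k - 1"]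
    unfolding ca by (auto simp: a_def ce Eper_def n_def)
  have p2: "cform S (a j) (a k) = 0" for j k
    unfolding a_def by (rule string_null[OF e e l ne])
  have p3: "cform S (cconj (a j)) (cconj (a k)) = 0" for j k
    by (simp add: cform_cconj[OF bilin] p2)
  have p4: "cform S (cconj (a j)) (a k) = cnj c * of_real (Eper n j k)" if "j \<in> {1..n}" "k \<in> {1..n}" for j k
    using cform_cconj[OF bilin, of "a j" "cconj (a k)"] p1[OF that] by simp
  let ?K = "(UNIV :: bool set) \<times> {1..n}"
  define g where "g = (\<lambda>(b, k). if b then a k else cconj (a k))"
  define h where "h = (\<lambda>(b, k). g (\<not> b, n + 1 - k))"
  define d where "d = (\<lambda>(b, k). (if b then c else cnj c) * of_real (Eper n k (n + 1 - k)))"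
  have gK: "g ` ?K = a ` {1..n} \<union> cconj ` a ` {1..n}"
    by (auto simp: g_def image_iff split: if_splits) (metis (full_types) atLeastAtMost_iff)+
  have ran: "a ` {1..n} = (\<lambda>j. (cmap N ^^ j) e) ` {..l}"
  proof -
    have "{1..n} = Suc ` {..l}" by (simp add: n_def image_Suc_atMost)
    then show ?thesis by (simp add: image_image a_def)
  qed
  then have str: "string e l = g ` ?K"
    unfolding gK string_def by (auto simp: image_image cconj_funpow[OF lin_N])
  have dual: "cform S (g k) (h k') = (if k = k' then d k else 0)" if k: "k \<in> ?K" "k' \<in> ?K" for k k'
  proof -
    obtain b i b' i' where bi: "k = (b, i)" "k' = (b', i')" "i \<in> {1..n}" "i' \<in> {1..n}"
      using k by auto
    then have i': "n + 1 - i' \<in> {1..n}" by auto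
    have "Eper n i (n + 1 - i') = 0" if "i \<noteq> i'"
      using that bi index_reflect[of i' n i] by (simp add: Eper_def)
    then show ?thesis
      using p1[OF bi(3) i'] p2 p3 p4[OF bi(3) i'] by (auto simp: g_def h_def d_def bi(1,2))
  qed
  have d0: "d k \<noteq> 0" if "k \<in> ?K" for k
    using that c0 by (auto simp: d_def Eper_def split: if_splits)
  have hK: "h k \<in> g ` ?K" if "k \<in> ?K" for k
    using that unfolding h_def by (auto intro!: imageI)
  note lin1 = cform_add_left[OF bilin] cform_scale_left[OF bilin]
  have fin: "finite ?K" by simp
  note dual_family = cx.dual_family[of ?K "\<lambda>k x. cform S x (h k)" g d, OF fin lin1]
  have dual_g: "inj_on g ?K" "cx.independent (g ` ?K)"
    and dual_zero: "\<And>z. z \<in> cx.span (g ` ?K) \<Longrightarrow> (\<And>k. k \<in> ?K \<Longrightarrow> cform S z (h k) = 0) \<Longrightarrow> z = 0"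
    by (rule dual_family; (rule dual d0)?; assumption)+
  show nd: "cnondeg S (cx.span (string e l))"
    unfolding cnondeg_def str
  proof (intro ballI impI)
    fix z assume z: "z \<in> cx.span (g ` ?K)" "\<forall>y\<in>cx.span (g ` ?K). cform S z y = 0"
    then have "cform S z (h k) = 0" if "k \<in> ?K" for k
      using cx.span_base[OF hK[OF that]] by blast
    then show "z = 0" using dual_zero[OF z(1)] by simp
  qed
  have mono: "monodromic (string e l)" by (rule string_monodromic[OF e l])
  have iso: "isometric_triple (real_pts (cx.span (string e l))) M S"
    by (rule monodromic_triple[OF mono string_subspace_E[OF e] nd])
  have ga: "g (b, k) = (if b then a k else cconj (a k))" for b k by (simp add: g_def)
  have inj_a: "inj_on a {1..n}"
  proof (rule inj_onI)
    fix j k assume "j \<in> {1..n}" "k \<in> {1..n}" "a j = a k"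
    then show "j = k" using inj_onD[OF dual_g(1), of "(True, j)" "(True, k)"] by (simp add: ga)
  qed
  have ind_a: "cx.independent (a ` {1..n})"
    using dual_g(2) cx.independent_mono[of "g ` ?K" "a ` {1..n}"] gK by auto
  have dimV: "dim (real_pts (cx.span (string e l))) = 2 * n"
  proof -
    have "dim (real_pts (cx.span (string e l))) = cx.dim (cx.span (string e l))"
      using dim_cpx[OF monodromic_real_subspace[OF mono]] monodromic_cpx[OF mono] by simp
    also have "\<dots> = card (g ` ?K)"
      unfolding str using dual_g(2) by (simp add: cx.dim_eq_card_independent)
    also have "\<dots> = card ?K" using dual_g(1) by (intro card_image) auto
    finally show ?thesis by (simp add: card_cartesian_product)
  qed
  define H where "H = cx.span (a ` {1..n})"
  have cH: "cconj ` H = cx.span (cconj ` a ` {1..n})" by (simp add: H_def cconj_span)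
  have sum: "H + cconj ` H = cpx (real_pts (cx.span (string e l)))"
    unfolding monodromic_cpx[OF mono] cH unfolding H_def str gK cx.span_Un set_plus_def by blast
  have H0: "H \<inter> cconj ` H = {0}"
  proof
    show "H \<inter> cconj ` H \<subseteq> {0}"
    proof
      fix z assume z: "z \<in> H \<inter> cconj ` H"
      have "cx.span (a ` {1..n}) \<subseteq> cx.span (g ` ?K)" unfolding gK by (rule cx.span_mono) simp
      then have zs: "z \<in> cx.span (g ` ?K)"
        using z unfolding H_def by blast
      have "cform S z (a k) = 0" for k
        by (rule cform_span_zero[OF bilin, of "a ` {1..n}" "{a k}"])
          (use z p2 in \<open>auto simp: H_def cx.span_base\<close>)
      moreover have "cform S z (cconj (a k)) = 0" for k
        by (rule cform_span_zero[OF bilin, of "cconj ` a ` {1..n}" "{cconj (a k)}"])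
          (use IntD2[OF z[unfolded cH]] p3 in \<open>auto simp: cx.span_base\<close>)
      ultimately have "cform S z (h k) = 0" for k by (cases k) (simp add: h_def g_def)
      then have "z = 0" using dual_zero[OF zs] by simp
      then show "z \<in> {0}" by simp
    qed
    show "{0} \<subseteq> H \<inter> cconj ` H" unfolding cH by (simp add: H_def cx.span_zero)
  qed
  have H_eig: "H \<subseteq> eigsp Ms \<zeta>"
    unfolding H_def using D_eigsp[OF e] by (intro cx.span_minimal eig_subspace) (auto simp: a_def)
  have Na: "cmap N (a k) = (if k < n then a (k + 1) else 0)" if "k \<in> {1..n}" for k
  proof -
    have "cmap N (a k) = (cmap N ^^ Suc (k - 1)) e" by (simp add: a_def)
    moreover have "Suc (k - 1) = k" using that by simp
    ultimately have "cmap N (a k) = (cmap N ^^ k) e" by simp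
    moreover have "(cmap N ^^ k) e = 0" if "\<not> k < n"
      using that D_string_end[OF e, of k] l by (simp add: n_def)
    ultimately show ?thesis by (simp add: a_def)
  qed
  have Nca: "cmap N (cconj (a k)) = (if k < n then cconj (a (k + 1)) else 0)" if "k \<in> {1..n}" for k
    using Na[OF that] by (simp flip: cconj_cmap[OF lin_N])
  have cc: "cnj c = \<i> ^ (n + \<mu> + 1) * of_real (\<epsilon> * (-1) ^ (n + \<mu> + 1))"
  proof -
    have "(-\<i>) ^ k = \<i> ^ k * (-1) ^ k" for k by (simp flip: power_mult_distrib)
    then show ?thesis by (simp add: c_def)
  qed
  show "is_Tr2 (real_pts (cx.span (string e l))) M S \<zeta> (l + 1) (nat ((m + theta \<zeta>) mod 2)) (signA m p \<zeta>)"
    unfolding is_Tr2_def n_def[symmetric] \<mu>_def[symmetric] \<epsilon>_def[symmetric]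
  proof (intro conjI iso unit dimV; (rule exI[of _ Ms], rule exI[of _ N], rule exI[of _ H],
        rule exI[of _ a], intro conjI monodromic_parts[OF mono] sum H0 inj_a ind_a)?)
    show "\<mu> \<in> {0, 1}" by (auto simp: \<mu>_def)
    show "\<epsilon> \<in> {1, -1}" unfolding \<epsilon>_def by (rule signA_cases)
    show "1 \<le> n" by (simp add: n_def)
    show "cx.subspace H" by (simp add: H_def)
    show "cx.span (a ` {1..n}) = H" by (simp add: H_def)
    show "\<forall>z\<in>H. cmap Ms z = cscale \<zeta> z" using H_eig by (auto simp: eigsp_def)
    show "\<forall>z\<in>cconj ` H. cmap Ms z = cscale (cnj \<zeta>) z"
      using H_eig eigsp_cconj[OF lin_Ms] by (fastforce simp: eigsp_def)
    show "\<forall>k\<in>{1..n}. cmap N (a k) = (if k < n then a (k + 1) else 0) \<and>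
        cmap N (cconj (a k)) = (if k < n then cconj (a (k + 1)) else 0)"
      using Na Nca by blast
    show "\<forall>j\<in>{1..n}. \<forall>k\<in>{1..n}.
        cform S (a j) (a k) = 0 \<and> cform S (cconj (a j)) (cconj (a k)) = 0 \<and>
        cform S (a j) (cconj (a k)) = \<i> ^ (n + \<mu> + 1) * of_real (\<epsilon> * Eper n j k) \<and>
        cform S (cconj (a j)) (a k) =
          \<i> ^ (n + \<mu> + 1) * of_real (\<epsilon> * (-1) ^ (n + \<mu> + 1) * Eper n j k)"
    proof (intro ballI conjI p2 p3)
      fix j k assume jk: "j \<in> {1..n}" "k \<in> {1..n}"
      show "cform S (a j) (cconj (a k)) = \<i> ^ (n + \<mu> + 1) * of_real (\<epsilon> * Eper n j k)"
        unfolding p1[OF jk] c_def by simp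
      show "cform S (cconj (a j)) (a k) =
          \<i> ^ (n + \<mu> + 1) * of_real (\<epsilon> * (-1) ^ (n + \<mu> + 1) * Eper n j k)"
        unfolding p4[OF jk] cc by simp
    qed
  qed
qed

text \<open>Here \<open>e\<close> is its own conjugate, so the string pairs with itself and its vectors are a real basis.\<close>

lemma string_Tr1:
  assumes e: "(v, 0) \<in> D p p \<zeta>" and l: "ell m p p \<zeta> = int l" and \<zeta>: "\<zeta> \<in> {1, -1}"
    and norm: "S v ((N ^^ l) v) = 1"
  shows "cnondeg S (cx.span (string (v, 0) l))"
    "is_Tr1 (real_pts (cx.span (string (v, 0) l))) M S (Re \<zeta>) (l + 1) (signB m p \<zeta>)"
proof -
  define n where "n = l + 1"
  define a where "a k = (N ^^ (k - 1)) v" for k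
  let ?r = "\<lambda>b :: 'a. (b, 0 :: 'a)"
  have cr: "cconj (?r x) = ?r x" for x by (simp add: cconj_def)
  have Nr: "(cmap N ^^ k) (?r x) = ?r ((N ^^ k) x)" for k x
    by (simp add: cmap_funpow cmap_eq linear_0[OF linear_funpow[OF lin_N]])
  have p1: "S (a j) (a k) = Eper n j k" if "j \<in> {1..n}" "k \<in> {1..n}" for j k
  proof -
    have "complex_of_real (S (a j) (a k)) =
        (if j - 1 + (k - 1) = l then (-1) ^ (j - 1) * complex_of_real (S v ((N ^^ l) v)) else 0)"
      using string_pairing[OF e e l, of "j - 1" "k - 1"]
      unfolding a_def by (cases "j - 1 + (k - 1) = l") (simp_all add: cr Nr cform_real[OF bilin])
    also have "\<dots> = complex_of_real (Eper n j k)"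
      using that by (auto simp: norm Eper_def n_def)
    finally show ?thesis by (simp only: of_real_eq_iff)
  qed
  define d where "d k = Eper n k (n + 1 - k)" for k
  have dual: "S (a k) (a (n + 1 - k')) = (if k = k' then d k else 0)" if k: "k \<in> {1..n}" "k' \<in> {1..n}" for k k'
  proof -
    have "n + 1 - k' \<in> {1..n}" using k by auto
    then show ?thesis
      using p1[OF k(1), of "n + 1 - k'"] k index_reflect[of k' n k] by (auto simp: d_def Eper_def)
  qed
  have d0: "d k \<noteq> 0" if "k \<in> {1..n}" for k using that by (simp add: d_def Eper_def)
  note real_dual = real_vector.dual_family[where \<phi> = "\<lambda>k x. S x (a (n + 1 - k))" and c = d and g = a
      and K = "{1..n}"]
  have add: "S (x + y) z = S x z + S y z" "S (r *\<^sub>R x) z = r * S x z" for x y z r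
    by (simp_all add: bilinear_ladd[OF bilin] bilinear_lmul[OF bilin])
  have inj_a: "inj_on a {1..n}" and ind_a: "independent (a ` {1..n})"
    using real_dual(1,2) add dual d0 by auto
  have "{1..n} = Suc ` {..l}" by (simp add: n_def image_Suc_atMost)
  then have ran: "a ` {1..n} = (\<lambda>j. (N ^^ j) v) ` {..l}" by (simp add: image_image a_def)
  have str: "string (v, 0) l = ?r ` a ` {1..n}"
    unfolding ran string_def by (auto simp: cr Nr)
  have span_eq: "cx.span (string (v, 0) l) = cpx (span (a ` {1..n}))"
    unfolding str by (rule cx_span_real_basis[OF refl, symmetric])
  have V: "real_pts (cx.span (string (v, 0) l)) = span (a ` {1..n})"
    unfolding span_eq by (rule real_pts_cpx) simp
  have dualc: "cform S (?r (a k)) (?r (a (n + 1 - k'))) = (if k = k' then of_real (d k) else 0)"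
    if "k \<in> {1..n}" "k' \<in> {1..n}" for k k'
    using dual[OF that] by (simp add: cform_real[OF bilin])
  show nd: "cnondeg S (cx.span (string (v, 0) l))"
    unfolding cnondeg_def
  proof (intro ballI impI)
    fix z assume z: "z \<in> cx.span (string (v, 0) l)" "\<forall>y\<in>cx.span (string (v, 0) l). cform S z y = 0"
    show "z = 0"
    proof (rule cx.dual_family(3)[where \<phi> = "\<lambda>k x. cform S x (?r (a (n + 1 - k)))"
          and c = "\<lambda>k. of_real (d k)" and g = "\<lambda>k. ?r (a k)" and K = "{1..n}"])
      show "z \<in> cx.span ((\<lambda>k. ?r (a k)) ` {1..n})" using z(1) by (simp add: str image_image)
      show "cform S z (?r (a (n + 1 - k))) = 0" if "k \<in> {1..n}" for k
      proof -
        have "?r (a (n + 1 - k)) \<in> string (v, 0) l" unfolding str using that by (intro imageI) auto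
        then show ?thesis using z(2) cx.span_base by blast
      qed
    qed (use dualc d0 in \<open>auto simp: cform_add_left[OF bilin] cform_scale_left[OF bilin]\<close>)
  qed
  have mono: "monodromic (string (v, 0) l)" by (rule string_monodromic[OF e l])
  have iso: "isometric_triple (real_pts (cx.span (string (v, 0) l))) M S"
    by (rule monodromic_triple[OF mono string_subspace_E[OF e] nd])
  have "cx.span (string (v, 0) l) \<subseteq> eigsp Ms \<zeta>"
    unfolding str using D_eigsp[OF e]
    by (intro cx.span_minimal eig_subspace) (auto simp: a_def Nr)
  then have Ms: "Ms x = Re \<zeta> *\<^sub>R x" if "x \<in> real_pts (cx.span (string (v, 0) l))" for x
    using that by (auto simp: real_pts_iff eigsp_def cmap_eq cscale_def)
  have Na: "N (a k) = (if k < n then a (k + 1) else 0)" if "k \<in> {1..n}" for k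
  proof -
    have "N (a k) = (N ^^ Suc (k - 1)) v" by (simp add: a_def)
    moreover have "Suc (k - 1) = k" using that by simp
    ultimately have "N (a k) = (N ^^ k) v" by simp
    moreover have "(N ^^ k) v = 0" if "\<not> k < n"
      using that D_string_end[OF e, of k] l by (simp add: n_def Nr zero_prod_def)
    ultimately show ?thesis by (simp add: a_def)
  qed
  have unit: "cmod \<zeta> = 1" using \<zeta> by auto
  show "is_Tr1 (real_pts (cx.span (string (v, 0) l))) M S (Re \<zeta>) (l + 1) (signB m p \<zeta>)"
    unfolding is_Tr1_def n_def[symmetric] signB_eq[OF unit]
  proof (intro conjI iso; (rule exI[of _ Ms], rule exI[of _ N], rule exI[of _ a],
        intro conjI monodromic_parts[OF mono] inj_a ind_a)?)
    show "Re \<zeta> \<in> {1, -1}" using \<zeta> by auto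
    show "(1::real) \<in> {1, -1}" by simp
    show "1 \<le> n" by (simp add: n_def)
    show "span (a ` {1..n}) = real_pts (cx.span (string (v, 0) l))" by (rule V[symmetric])
    show "\<forall>x\<in>real_pts (cx.span (string (v, 0) l)). Ms x = Re \<zeta> *\<^sub>R x" using Ms by blast
    show "\<forall>k\<in>{1..n}. N (a k) = (if k < n then a (k + 1) else 0)" using Na by blast
    show "\<forall>j\<in>{1..n}. \<forall>k\<in>{1..n}. S (a j) (a k) = 1 * Eper n j k" using p1 by simp
  qed
qed

end

section \<open>The decomposition\<close>

lemma orth_decomp_cong:
  assumes "\<And>i. i \<in> I \<Longrightarrow> U i = U' i"
  shows "orth_decomp V M S I U = orth_decomp V M S I U'"
proof -
  have "(\<Union>i\<in>I. U i) = (\<Union>i\<in>I. U' i)" using assms by auto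
  then show ?thesis unfolding orth_decomp_def by (simp add: assms cong: ball_cong)
qed

context steenbrink_split
begin

text \<open>The generators of the summand that belongs to the type \<open>(p, q, \<zeta>)\<close> and to the conjugate type.\<close>

definition block :: "int \<Rightarrow> int \<Rightarrow> complex \<Rightarrow> ('a \<times> 'a) set" where
  "block p q \<zeta> = strings p q \<zeta> \<union> strings q p (cnj \<zeta>)"

lemma spaceA_eq: "spaceA m F W Ms N p q \<zeta> = cx.span (block p q \<zeta>)"
  by (simp add: spaceA_def block_def strings_def ell_cnj)

lemma spaceB_eq: "cnj \<zeta> = \<zeta> \<Longrightarrow> spaceB m F W Ms N p \<zeta> = cx.span (block p p \<zeta>)"
  by (simp add: spaceB_def block_def strings_def)

lemma block_commute: "block q p (cnj \<zeta>) = block p q \<zeta>"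
  by (auto simp: block_def)

lemma strings_iff: "x \<in> strings p q \<zeta> \<longleftrightarrow> (\<exists>j a. j \<le> nat (ell m p q \<zeta>) \<and> a \<in> D p q \<zeta> \<and> x = (cmap N ^^ j) a)"
  by (auto simp: strings_def)

lemma strings_cconj: "x \<in> strings p q \<zeta> \<Longrightarrow> cconj x \<in> strings q p (cnj \<zeta>)"
proof -
  assume "x \<in> strings p q \<zeta>"
  then obtain j a where a: "j \<le> nat (ell m p q \<zeta>)" "a \<in> D p q \<zeta>" "x = (cmap N ^^ j) a"
    unfolding strings_iff by blast
  then show ?thesis
    unfolding strings_iff ell_cnj
    by (intro exI[of _ j] exI[of _ "cconj a"]) (simp add: D_cconj cconj_funpow[OF lin_N])
qed

lemma strings_monodromic:
  assumes "0 \<le> ell m p q \<zeta>" "x \<in> strings p q \<zeta>"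
  shows "x \<in> eigsp Ms \<zeta>" "cmap N x \<in> insert 0 (strings p q \<zeta>)"
proof -
  obtain j a where a: "j \<le> nat (ell m p q \<zeta>)" "a \<in> D p q \<zeta>" "x = (cmap N ^^ j) a"
    using assms(2) unfolding strings_iff by blast
  show "x \<in> eigsp Ms \<zeta>" using a D_eigsp by simp
  have Nx: "cmap N x = (cmap N ^^ Suc j) a" using a by simp
  show "cmap N x \<in> insert 0 (strings p q \<zeta>)"
  proof (cases "Suc j \<le> nat (ell m p q \<zeta>)")
    case True
    then have "cmap N x \<in> strings p q \<zeta>" unfolding strings_iff Nx using a(2) by metis
    then show ?thesis by simp
  next
    case False
    then have "cmap N x = 0" unfolding Nx by (intro D_string_end[OF a(2)]) auto
    then show ?thesis by simp
  qed
qed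

lemma block_monodromic:
  assumes "0 \<le> ell m p q \<zeta>"
  shows "monodromic (block p q \<zeta>)"
  unfolding monodromic_def
proof
  fix g assume g: "g \<in> block p q \<zeta>"
  then obtain r s \<mu> where r: "(r, s, \<mu>) = (p, q, \<zeta>) \<or> (r, s, \<mu>) = (q, p, cnj \<zeta>)" "g \<in> strings r s \<mu>"
    by (auto simp: block_def)
  have "0 \<le> ell m r s \<mu>" using r(1) assms ell_cnj by auto
  note 1 = strings_monodromic[OF this r(2)]
  have "insert 0 (strings r s \<mu>) \<subseteq> cx.span (block p q \<zeta>)"
    using r(1) by (auto simp: block_def cx.span_zero intro!: cx.span_base)
  moreover have "cconj g \<in> block p q \<zeta>"
    using strings_cconj[OF r(2)] r(1) by (auto simp: block_def)
  ultimately show "(\<exists>\<zeta>. g \<in> eigsp Ms \<zeta>) \<and> cmap N g \<in> cx.span (block p q \<zeta>) \<and>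
      cconj g \<in> cx.span (block p q \<zeta>)"
    using 1 cx.span_base by blast
qed

lemma block_E: "cx.span (block p q \<zeta>) \<subseteq> E \<zeta>"
proof (intro cx.span_minimal E_subspace subsetI)
  fix x assume "x \<in> block p q \<zeta>"
  then show "x \<in> E \<zeta>"
    using D_E E_cong[of "cnj \<zeta>" \<zeta>] by (fastforce simp: block_def strings_iff cnj_eq_1)
qed

text \<open>Applying powers of \<open>N\<close> and conjugation to a basis of the primitive space generates the whole
  summand, so an orthogonal basis gives an orthogonal decomposition into strings.\<close>

lemma block_decomposition:
  fixes e :: "nat \<Rightarrow> 'a \<times> 'a"
  assumes e: "\<And>i. i < d \<Longrightarrow> e i \<in> D p q \<zeta>" "cx.span (e ` {..<d}) = D p q \<zeta>"
    and l: "ell m p q \<zeta> = int l"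
    and nd: "\<And>i. i < d \<Longrightarrow> cnondeg S (cx.span (string (e i) l))"
    and orth: "\<And>i j a b. i < d \<Longrightarrow> j < d \<Longrightarrow> i \<noteq> j \<Longrightarrow>
        cform S ((cmap N ^^ a) (e i)) ((cmap N ^^ b) (e j)) = 0"
      "\<And>i j a b. i < d \<Longrightarrow> j < d \<Longrightarrow> i \<noteq> j \<Longrightarrow>
        cform S ((cmap N ^^ a) (e i)) ((cmap N ^^ b) (cconj (e j))) = 0"
  shows "cnondeg S (cx.span (block p q \<zeta>))"
    "orth_decomp (real_pts (cx.span (block p q \<zeta>))) M S {..<d} (\<lambda>i. real_pts (cx.span (string (e i) l)))"
proof -
  let ?C = "\<lambda>i. cx.span (string (e i) l)"
  let ?T = "cx.span (\<Union>i\<in>{..<d}. ?C i)"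
  have mono: "monodromic (string (e i) l)" if "i < d" for i
    by (rule string_monodromic[OF e(1)[OF that] l])
  have orthC: "cform S x y = 0" if ij: "i \<in> {..<d}" "j \<in> {..<d}" "i \<noteq> j" "x \<in> ?C i" "y \<in> ?C j" for i j x y
  proof (rule cform_span_zero[OF bilin _ ij(4,5)])
    fix x y assume "x \<in> string (e i) l" "y \<in> string (e j) l"
    then obtain a b where ab: "x = (cmap N ^^ a) (e i) \<or> x = cconj ((cmap N ^^ a) (e i))"
      "y = (cmap N ^^ b) (e j) \<or> y = cconj ((cmap N ^^ b) (e j))"
      by (auto simp: string_def cconj_funpow[OF lin_N])
    have 1: "cform S ((cmap N ^^ a) (e i)) ((cmap N ^^ b) (e j)) = 0"
      "cform S ((cmap N ^^ a) (e i)) (cconj ((cmap N ^^ b) (e j))) = 0"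
      using orth[of i j a b] ij by (simp_all add: cconj_funpow[OF lin_N])
    have 2: "cform S (cconj ((cmap N ^^ a) (e i))) z = cnj (cform S ((cmap N ^^ a) (e i)) (cconj z))" for z
      by (simp flip: cform_cconj[OF bilin])
    show "cform S x y = 0" using ab 1 by (auto simp: 2)
  qed
  have TD: "(cmap N ^^ j) x \<in> ?T \<and> (cmap N ^^ j) (cconj x) \<in> ?T" if j: "j \<le> l" and x: "x \<in> D p q \<zeta>" for j x
  proof -
    let ?X = "{z. cmap (N ^^ j) z \<in> ?T}"
    have sub: "cx.subspace ?X"
      by (intro subspace_vimage linear_funpow lin_N cx.subspace_span)
    have gen: "e i \<in> ?X \<and> cconj (e i) \<in> ?X" if "i < d" for i
    proof -
      have "string (e i) l \<subseteq> ?T"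
        using that cx.span_superset[of "string (e i) l"] cx.span_superset[of "\<Union>i\<in>{..<d}. ?C i"] by blast
      then show ?thesis
        using j unfolding string_def by (auto simp flip: cmap_funpow)
    qed
    have "cx.span (e ` {..<d}) \<subseteq> ?X"
      by (rule cx.span_minimal[OF _ sub]) (use gen in blast)
    moreover have "cx.span (e ` {..<d}) \<subseteq> cconj ` ?X"
      by (rule cx.span_minimal[OF _ subspace_cconj[OF sub]]) (use gen in \<open>auto simp: cconj_image_iff\<close>)
    ultimately have "x \<in> ?X" "x \<in> cconj ` ?X" using x unfolding e(2) by blast+
    then show ?thesis by (auto simp: cconj_image_iff cmap_funpow)
  qed
  have eq: "cx.span (block p q \<zeta>) = ?T"
  proof
    have "block p q \<zeta> \<subseteq> ?T"
    proof
      fix x assume "x \<in> block p q \<zeta>"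
      then obtain j y where y: "j \<le> l" "y \<in> D p q \<zeta>" "x = (cmap N ^^ j) y \<or> x = (cmap N ^^ j) (cconj y)"
        using l by (auto simp: block_def strings_iff ell_cnj D_cconj_image)
      show "x \<in> ?T" using TD[OF y(1,2)] y(3) by (elim disjE) (simp_all only:)
    qed
    then show "cx.span (block p q \<zeta>) \<subseteq> ?T" by (intro cx.span_minimal cx.subspace_span)
    have "string (e i) l \<subseteq> block p q \<zeta>" if "i < d" for i
    proof -
      have "nat (ell m p q \<zeta>) = l" using l by simp
      then have "(cmap N ^^ j) (e i) \<in> strings p q \<zeta> \<and> (cmap N ^^ j) (cconj (e i)) \<in> strings q p (cnj \<zeta>)"
        if "j \<le> l" for j
        unfolding strings_iff ell_cnj using that e(1)[OF \<open>i < d\<close>] D_cconj[OF e(1)[OF \<open>i < d\<close>]] by metis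
      then show ?thesis unfolding string_def block_def by blast
    qed
    then show "?T \<subseteq> cx.span (block p q \<zeta>)"
      by (intro cx.span_minimal cx.subspace_span UN_least cx.span_mono) auto
  qed
  show "cnondeg S (cx.span (block p q \<zeta>))"
    unfolding eq using nd orthC by (intro cnondeg_span_Union[OF bilin]) auto
  show "orth_decomp (real_pts (cx.span (block p q \<zeta>))) M S {..<d} (\<lambda>i. real_pts (?C i))"
  proof (rule orth_decompI[OF bilin _ _ _ _ _ eq])
    show "isometric_triple (real_pts (?C i)) M S" if "i \<in> {..<d}" for i
      using that nd by (intro monodromic_triple[OF mono string_subspace_E[OF e(1)]]) auto
  qed (use orthC monodromic_conj[OF mono] in auto)
qed

lemma string_hermitian:
  assumes "x \<in> D p q \<zeta>" "y \<in> D p q \<zeta>" "cform S x ((cmap N ^^ l) (cconj y)) = 0"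
  shows "cform S y ((cmap N ^^ l) (cconj x)) = 0"
  using split_pmhs.cform_N_hermitian[OF split_pmhs_V, of x \<zeta> y l] assms
    D_E[OF assms(1), of 0] D_E[OF assms(2), of 0] by (simp add: cpx_V)

text \<open>Triples of type 2 come from a basis of the primitive space that is orthonormal for the hermitian
  form given by the polarization.\<close>

lemma blockA_decomposition:
  assumes ell: "0 \<le> ell m p q \<zeta>" and ne: "(p, \<zeta>) \<noteq> (q, cnj \<zeta>)"
  shows "cnondeg S (cx.span (block p q \<zeta>))"
    "\<exists>U. orth_decomp (real_pts (cx.span (block p q \<zeta>))) M S {..<cx.dim (D p q \<zeta>)} U \<and>
      (\<forall>i<cx.dim (D p q \<zeta>). is_Tr2 (U i) M S \<zeta> (nat (ell m p q \<zeta>) + 1)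
        (nat ((m + theta \<zeta>) mod 2)) (signA m p \<zeta>))"
proof -
  obtain l where l: "ell m p q \<zeta> = int l" using ell zero_le_imp_eq_int by blast
  let ?d = "cx.dim (D p q \<zeta>)"
  define h where "h x y = \<i> powi (p - q) * cform S x ((cmap N ^^ l) (cconj y))" for x y
  obtain B where B: "finite B" "D p q \<zeta> = cx.span B" by (rule cx_finite_basis[OF D_subspace])
  obtain e where e: "\<And>i. i < ?d \<Longrightarrow> e i \<in> D p q \<zeta>" "cx.span (e ` {..<?d}) = D p q \<zeta>"
    "\<And>i j. i < ?d \<Longrightarrow> j < ?d \<Longrightarrow> h (e i) (e j) = (if i = j then 1 else 0)"
  proof (rule cx.orthonormal_basis[OF B, of h])
    show "h (x + y) z = h x z + h y z" "h (cscale a x) z = a * h x z" for x y z a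
      by (simp_all add: h_def cform_add_left[OF bilin] cform_scale_left[OF bilin] algebra_simps)
    show "h y x = 0" if "x \<in> D p q \<zeta>" "y \<in> D p q \<zeta>" "h x y = 0" for x y
      using string_hermitian[OF that(1,2), of l] that(3) by (simp add: h_def)
    show "\<exists>a. h (cscale a x) (cscale a x) = 1" if x: "x \<in> D p q \<zeta>" "x \<noteq> 0" for x
    proof -
      obtain r where r: "r > 0" "h x x = complex_of_real r"
        using D_positive[OF x l] unfolding h_def by metis
      \<comment> \<open>\<open>h x x\<close> is a positive real number, so division by its square root normalizes \<open>x\<close>\<close>
      have "h (cscale a x) (cscale a x) = a * cnj a * h x x" for a
        by (simp add: h_def cconj_cscale cmap_funpow cmap_cscale[OF linear_funpow[OF lin_N]]
            cform_scale_left[OF bilin] cform_scale_right[OF bilin])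
      then have "h (cscale (of_real (1 / sqrt r)) x) (cscale (of_real (1 / sqrt r)) x) =
          of_real (1 / sqrt r * (1 / sqrt r) * r)"
        by (simp only: r(2) complex_cnj_complex_of_real of_real_mult)
      also have "1 / sqrt r * (1 / sqrt r) * r = 1" using r(1) by simp
      finally show ?thesis by auto
    qed
  qed (rule that)
  have orth: "cform S ((cmap N ^^ a) (e i)) ((cmap N ^^ b) (cconj (e j))) = 0"
    if "i < ?d" "j < ?d" "i \<noteq> j" for i j a b
    using string_pairing[OF e(1)[OF that(1)] e(1)[OF that(2)] l, of a b] e(3)[OF that(1,2)] that(3)
    by (simp add: h_def)
  have Tr: "cnondeg S (cx.span (string (e i) l))"
    "is_Tr2 (real_pts (cx.span (string (e i) l))) M S \<zeta> (l + 1) (nat ((m + theta \<zeta>) mod 2)) (signA m p \<zeta>)"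
    if "i < ?d" for i
    using string_Tr2[OF e(1)[OF that] l ne] e(3)[OF that that] by (simp_all add: h_def)
  have dec: "cnondeg S (cx.span (block p q \<zeta>))"
    "orth_decomp (real_pts (cx.span (block p q \<zeta>))) M S {..<?d} (\<lambda>i. real_pts (cx.span (string (e i) l)))"
    using block_decomposition[OF e(1,2) l Tr(1) string_null[OF e(1) e(1) l ne] orth] by blast+
  show "cnondeg S (cx.span (block p q \<zeta>))" by (rule dec(1))
  have "nat (ell m p q \<zeta>) = l" using l by simp
  with dec(2) Tr(2)
  show "\<exists>U. orth_decomp (real_pts (cx.span (block p q \<zeta>))) M S {..<?d} U \<and>
      (\<forall>i<?d. is_Tr2 (U i) M S \<zeta> (nat (ell m p q \<zeta>) + 1)
        (nat ((m + theta \<zeta>) mod 2)) (signA m p \<zeta>))"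
    by (intro exI[of _ "\<lambda>i. real_pts (cx.span (string (e i) l))"]) simp
qed

text \<open>For \<open>p = q\<close> and a real eigenvalue the primitive space is defined over the reals, and the
  hermitian form restricts to a scalar product on its real points.\<close>

lemma blockB_decomposition:
  assumes ell: "0 \<le> ell m p p \<zeta>" and \<zeta>: "\<zeta> \<in> {1, -1}"
  shows "cnondeg S (cx.span (block p p \<zeta>))"
    "\<exists>U. orth_decomp (real_pts (cx.span (block p p \<zeta>))) M S {..<cx.dim (D p p \<zeta>)} U \<and>
      (\<forall>i<cx.dim (D p p \<zeta>). is_Tr1 (U i) M S (Re \<zeta>) (nat (ell m p p \<zeta>) + 1) (signB m p \<zeta>))"
proof -
  obtain l where l: "ell m p p \<zeta> = int l" using ell zero_le_imp_eq_int by blast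
  have cnj: "cnj \<zeta> = \<zeta>" using \<zeta> by auto
  have cr: "cconj (x, 0 :: 'a) = (x, 0)" for x by (simp add: cconj_def)
  have Nr: "(cmap N ^^ k) (x, 0) = ((N ^^ k) x, 0)" for k x
    by (simp add: cmap_funpow cmap_eq linear_0[OF linear_funpow[OF lin_N]])
  define U where "U = real_pts (D p p \<zeta>)"
  have subU: "subspace U" unfolding U_def by (rule subspace_real_pts[OF D_subspace])
  have UD: "cpx U = D p p \<zeta>"
    unfolding U_def using D_cconj[of _ p p \<zeta>] cnj
    by (intro cpx_real_pts D_subspace) (auto simp: conj_stable_def)
  have dim: "dim U = cx.dim (D p p \<zeta>)" using dim_cpx[OF subU] UD by simp
  define h where "h x y = S x ((N ^^ l) y)" for x y
  have hc: "cform S (x, 0) ((cmap N ^^ l) (cconj (y, 0))) = of_real (h x y)" for x y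
    by (simp add: h_def cr Nr cform_real[OF bilin])
  obtain B where B: "finite B" "U = span B"
    using findim_subset[OF findim subU] by (auto simp: findim_subspace_def)
  obtain e where e: "\<And>i. i < dim U \<Longrightarrow> e i \<in> U" "span (e ` {..<dim U}) = U"
    "\<And>i j. i < dim U \<Longrightarrow> j < dim U \<Longrightarrow> h (e i) (e j) = (if i = j then 1 else 0)"
  proof (rule real_vector.orthonormal_basis[OF B, of h])
    show "h (x + y) z = h x z + h y z" "h (a *\<^sub>R x) z = a * h x z" for x y z a
      by (simp_all add: h_def bilinear_ladd[OF bilin] bilinear_lmul[OF bilin])
    show "h y x = 0" if "x \<in> U" "y \<in> U" "h x y = 0" for x y
      using string_hermitian[of "(x, 0)" p p \<zeta> "(y, 0)" l] that unfolding U_def hc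
      by (simp add: real_pts_iff)
    show "\<exists>a. h (a *\<^sub>R x) (a *\<^sub>R x) = 1" if x: "x \<in> U" "x \<noteq> 0" for x
    proof -
      have "(x, 0) \<in> D p p \<zeta>" "(x, 0) \<noteq> 0" using x by (simp_all add: U_def real_pts_iff zero_prod_def)
      then obtain r where r: "r > 0" "h x x = r"
        using D_positive[OF _ _ l, of "(x, 0)"] unfolding hc by auto
      have "h (a *\<^sub>R x) (a *\<^sub>R x) = a * a * h x x" for a
        by (simp add: h_def linear_scale[OF linear_funpow[OF lin_N]] bilinear_lmul[OF bilin]
            bilinear_rmul[OF bilin])
      then have "h ((1 / sqrt r) *\<^sub>R x) ((1 / sqrt r) *\<^sub>R x) = 1 / sqrt r * (1 / sqrt r) * r"
        using r(2) by simp
      also have "\<dots> = 1" using r(1) by simp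
      finally show ?thesis by auto
    qed
  qed (rule that)
  let ?d = "cx.dim (D p p \<zeta>)"
  let ?e = "\<lambda>i. (e i, 0 :: 'a)"
  have eD: "?e i \<in> D p p \<zeta>" if "i < ?d" for i
    using e(1) that dim by (simp add: U_def real_pts_iff)
  have eS: "cx.span (?e ` {..<?d}) = D p p \<zeta>"
    using cx_span_real_basis[OF e(2)[symmetric]] UD dim by (simp add: image_image)
  have orth: "cform S ((cmap N ^^ a) (?e i)) ((cmap N ^^ b) (cconj (?e j))) = 0"
    if "i < ?d" "j < ?d" "i \<noteq> j" for i j a b
    using string_pairing[OF eD[OF that(1)] eD[OF that(2)] l, of a b] e(3)[of i j] that dim
    unfolding hc by simp
  then have orth': "cform S ((cmap N ^^ a) (?e i)) ((cmap N ^^ b) (?e j)) = 0"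
    if "i < ?d" "j < ?d" "i \<noteq> j" for i j a b
    using that by (simp add: cr)
  have Tr: "cnondeg S (cx.span (string (?e i) l))"
    "is_Tr1 (real_pts (cx.span (string (?e i) l))) M S (Re \<zeta>) (l + 1) (signB m p \<zeta>)"
    if "i < ?d" for i
    using string_Tr1[OF eD[OF that] l \<zeta>] e(3)[of i i] that dim by (simp_all add: h_def)
  have dec: "cnondeg S (cx.span (block p p \<zeta>))"
    "orth_decomp (real_pts (cx.span (block p p \<zeta>))) M S {..<?d} (\<lambda>i. real_pts (cx.span (string (?e i) l)))"
    using block_decomposition[OF eD eS l Tr(1) orth' orth] by blast+
  show "cnondeg S (cx.span (block p p \<zeta>))" by (rule dec(1))
  have "nat (ell m p p \<zeta>) = l" using l by simp
  with dec(2) Tr(2)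
  show "\<exists>U. orth_decomp (real_pts (cx.span (block p p \<zeta>))) M S {..<?d} U \<and>
      (\<forall>i<?d. is_Tr1 (U i) M S (Re \<zeta>) (nat (ell m p p \<zeta>) + 1) (signB m p \<zeta>))"
    by (intro exI[of _ "\<lambda>i. real_pts (cx.span (string (?e i) l))"]) simp
qed

text \<open>The types that occur; conjugation acts on them as an involution.\<close>

definition types :: "(int \<times> int \<times> complex) set" where
  "types = {(p, q, \<zeta>). 0 \<le> ell m p q \<zeta> \<and> D p q \<zeta> \<noteq> {0}}"

lemma types_unit: "(p, q, \<zeta>) \<in> types \<Longrightarrow> cmod \<zeta> = 1"
  using D_unit_circle by (auto simp: types_def)

lemma types_cnj: "(p, q, \<zeta>) \<in> types \<Longrightarrow> (q, p, cnj \<zeta>) \<in> types"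
proof -
  have "A = {0}" if "cconj ` A = {0}" for A :: "('a \<times> 'a) set"
    using arg_cong[OF that, of "(`) cconj"] by (simp add: image_image)
  then have "cconj ` D p q \<zeta> \<noteq> {0}" if "D p q \<zeta> \<noteq> {0}"
    using that by blast
  then show "(p, q, \<zeta>) \<in> types \<Longrightarrow> (q, p, cnj \<zeta>) \<in> types"
    by (simp add: types_def ell_cnj D_cconj_image)
qed

lemma strings_orthogonal:
  assumes X: "(p, q, \<zeta>) \<in> types" and Y: "(r, s, \<mu>) \<in> types" "(r, s, \<mu>) \<noteq> (q, p, cnj \<zeta>)"
    and xy: "x \<in> strings p q \<zeta>" "y \<in> strings r s \<mu>"
  shows "cform S x y = 0"
proof (rule ccontr)
  assume nz: "cform S x y \<noteq> 0"
  obtain i a j b where ab: "a \<in> D p q \<zeta>" "x = (cmap N ^^ i) a" "b \<in> D r s \<mu>" "y = (cmap N ^^ j) b"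
    using xy by (auto simp: strings_iff)
  have "0 \<le> ell m p q \<zeta>" "0 \<le> ell m r s \<mu>" using X Y by (auto simp: types_def)
  from D_pairing[OF ab(1) this(1) ab(3) this(2)] nz ab
  have "r = q" "s = p" "\<zeta> * \<mu> = 1" by auto
  with Y(2) cnj_of_unit[OF types_unit[OF X]] show False by auto
qed

lemma block_orthogonal:
  assumes X: "(p, q, \<zeta>) \<in> types" and Y: "(r, s, \<mu>) \<in> types"
    and ne: "(r, s, \<mu>) \<noteq> (p, q, \<zeta>)" "(r, s, \<mu>) \<noteq> (q, p, cnj \<zeta>)"
    and xy: "x \<in> cx.span (block p q \<zeta>)" "y \<in> cx.span (block r s \<mu>)"
  shows "cform S x y = 0"
proof (rule cform_span_zero[OF bilin _ xy])
  have ne': "(s, r, cnj \<mu>) \<noteq> (p, q, \<zeta>)" "(s, r, cnj \<mu>) \<noteq> (q, p, cnj \<zeta>)" using ne by auto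
  fix x y assume "x \<in> block p q \<zeta>" "y \<in> block r s \<mu>"
  then show "cform S x y = 0"
    unfolding block_def
    using strings_orthogonal[OF X Y, of x y] strings_orthogonal[OF X types_cnj[OF Y], of x y]
      strings_orthogonal[OF types_cnj[OF X] Y, of x y]
      strings_orthogonal[OF types_cnj[OF X] types_cnj[OF Y], of x y] ne ne' by auto
qed

text \<open>Nonzero primitive vectors of different types have a dual family, so there are at most as many
  types as the dimension.\<close>

lemma finite_types: "finite types"
proof (rule ccontr)
  assume "infinite types"
  obtain G where G: "finite G" "(UNIV :: ('a \<times> 'a) set) = cx.span G"
    using cx_finite_basis[OF cx.subspace_UNIV] by metis
  obtain T where T: "finite T" "card T = Suc (card G)" "T \<subseteq> types"
    using infinite_arbitrarily_large[OF \<open>infinite types\<close>] by blast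
  have "\<forall>x\<in>types. \<exists>a. a \<noteq> 0 \<and> (case x of (p, q, \<zeta>) \<Rightarrow> a \<in> D p q \<zeta>)"
    using D_zero by (fastforce simp: types_def)
  then obtain e where e: "\<And>p q \<zeta>. (p, q, \<zeta>) \<in> types \<Longrightarrow> e (p, q, \<zeta>) \<noteq> 0 \<and> e (p, q, \<zeta>) \<in> D p q \<zeta>"
    by (metis (no_types, lifting) case_prodD prod.simps(2))
  define f where "f = (\<lambda>(p, q, \<zeta>). (cmap N ^^ nat (ell m p q \<zeta>)) (cconj (e (p, q, \<zeta>))))"
  have dual: "cform S (e x) (f y) = 0" if "x \<in> types" "y \<in> types" "x \<noteq> y" for x y
  proof -
    obtain p q \<zeta> r s \<mu> where xy: "x = (p, q, \<zeta>)" "y = (r, s, \<mu>)" by (metis prod_cases3)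
    have "(cmap N ^^ 0) (e x) \<in> strings p q \<zeta>"
      using e that xy unfolding strings_iff by blast
    moreover have "f y \<in> strings s r (cnj \<mu>)"
    proof -
      have "cconj (e (r, s, \<mu>)) \<in> D s r (cnj \<mu>)" using e[of r s \<mu>] that xy D_cconj by simp
      then show ?thesis unfolding strings_iff ell_cnj f_def xy prod.case by blast
    qed
    ultimately show ?thesis
      using strings_orthogonal[of p q \<zeta> s r "cnj \<mu>" "e x" "f y"] that xy types_cnj by auto
  qed
  have nz: "cform S (e x) (f x) \<noteq> 0" if "x \<in> types" for x
  proof -
    obtain p q \<zeta> where x: "x = (p, q, \<zeta>)" by (metis prod_cases3)
    have "0 \<le> ell m p q \<zeta>" using that x by (simp add: types_def)
    then have "ell m p q \<zeta> = int (nat (ell m p q \<zeta>))" by simp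
    moreover have "e x \<in> D p q \<zeta>" "e x \<noteq> 0" using e that x by simp_all
    ultimately obtain r where "r > 0"
      "\<i> powi (p - q) * cform S (e x) ((cmap N ^^ nat (ell m p q \<zeta>)) (cconj (e x))) = complex_of_real r"
      using D_positive by blast
    then show ?thesis by (auto simp: f_def x)
  qed
  define c where "c x = cform S (e x) (f x)" for x
  have dual': "cform S (e x) (f y) = (if x = y then c x else 0)" if "x \<in> T" "y \<in> T" for x y
    using dual[of x y] that T(3) by (auto simp: c_def)
  have c: "c x \<noteq> 0" if "x \<in> T" for x using nz[of x] that T(3) by (auto simp: c_def)
  note dual_family = cx.dual_family[of T "\<lambda>y x. cform S x (f y)" e c, OF T(1)
      cform_add_left[OF bilin] cform_scale_left[OF bilin]]
  have "inj_on e T" "cx.independent (e ` T)"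
    by (rule dual_family; (rule dual' c)?; assumption)+
  then have "card (e ` T) \<le> card G" "card (e ` T) = card T"
    using cx.independent_span_bound[OF G(1), of "e ` T"] by (simp_all add: card_image flip: G(2))
  then show False using T(2) by simp
qed

text \<open>A vector of one summand is orthogonal to the other, so the form stays nondegenerate on each.\<close>

lemma eigenspace_triple: "isometric_triple (V \<zeta>) M S"
proof -
  let ?G = "\<Union>\<mu>\<in>(if \<zeta> = 1 then {1} else -{1}). eigsp Ms \<mu>"
  have G: "cx.span ?G = E \<zeta>"
    using eig_subspace by (auto simp: E_def eigsp_ne1_def cx.span_eq_iff[THEN iffD2])
  have "monodromic ?G"
    unfolding monodromic_def G
  proof
    fix g assume g: "g \<in> ?G"
    then obtain \<mu> where mu: "g \<in> eigsp Ms \<mu>" "\<mu> = 1 \<longleftrightarrow> \<zeta> = 1" by (auto split: if_splits)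
    note mu = mu(1) E_cong[OF mu(2)]
    have "g \<in> E \<zeta>" using mu eigsp_E by blast
    then show "(\<exists>\<zeta>. g \<in> eigsp Ms \<zeta>) \<and> cmap N g \<in> E \<zeta> \<and> cconj g \<in> E \<zeta>"
      using N_eigsp[OF mu(1), of 1] eigsp_E[of \<mu>] mu E_conj[of \<zeta>] by (auto simp: conj_stable_def)
  qed
  moreover have "cnondeg S (E \<zeta>)"
    unfolding cnondeg_def
  proof (intro ballI impI)
    fix z assume z: "z \<in> E \<zeta>" "\<forall>y\<in>E \<zeta>. cform S z y = 0"
    show "z = 0"
    proof (rule cform_nondeg)
      fix \<mu> g assume g: "g \<in> eigsp Ms \<mu>"
      \<comment> \<open>either \<open>g\<close> lies in \<open>E \<zeta>\<close>, or in the other summand, which is orthogonal to \<open>z\<close>\<close>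
      show "cform S z g = 0"
        using z E_cong[of \<zeta> \<mu>] E_orthogonal[of z \<zeta> g \<mu>] g eigsp_E by blast
    qed
  qed
  ultimately show ?thesis
    using monodromic_triple[of ?G \<zeta>] unfolding G by blast
qed

lemma eigenspace_decomposition:
  "orth_decomp UNIV M S {False, True} (\<lambda>b. if b then real_pts (eigsp Ms 1) else real_pts (eigsp_ne1 Ms))"
proof -
  let ?z = "\<lambda>b. if b then 1 else (0 :: complex)"
  have "orth_decomp (real_pts UNIV) M S {False, True} (\<lambda>b. real_pts (E (?z b)))"
  proof (rule orth_decompI[OF bilin])
    have "eigsp Ms \<mu> \<subseteq> E 0 \<union> E 1" for \<mu>
      using eigsp_E[of \<mu>] E_cong[of \<mu> 0] by (cases "\<mu> = 1") auto
    then have "cx.span (\<Union>\<mu>. eigsp Ms \<mu>) \<subseteq> cx.span (\<Union>b\<in>{False, True}. E (?z b))"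
      by (intro cx.span_mono) auto
    then show "UNIV = cx.span (\<Union>b\<in>{False, True}. E (?z b))" by (auto simp: span_eigsp)
    show "cform S x y = 0" if "i \<noteq> j" "x \<in> E (?z i)" "y \<in> E (?z j)" for i j x y
      using that by (intro E_orthogonal[OF that(2,3)]) auto
  qed (auto intro: E_subspace E_conj eigenspace_triple)
  moreover have "(\<lambda>b. real_pts (E (?z b))) =
      (\<lambda>b. if b then real_pts (eigsp Ms 1) else real_pts (eigsp_ne1 Ms))"
    by (auto simp: E_def fun_eq_iff)
  ultimately show ?thesis by (simp add: real_pts_def)
qed

lemma indexA_iff: "(p, q, \<zeta>) \<in> indexA m F W Ms N \<longleftrightarrow>
    (p, q, \<zeta>) \<in> types \<and> (p, \<zeta>) \<noteq> (q, cnj \<zeta>) \<and> 0 \<le> Im ((-1) powi (m + 1) * \<zeta>)"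
  by (auto simp: indexA_def types_def)

lemma indexB_iff: "(p, \<zeta>) \<in> indexB m F W Ms N \<longleftrightarrow> (p, p, \<zeta>) \<in> types \<and> cnj \<zeta> = \<zeta>"
  using types_unit[of p p \<zeta>] unit_real[of \<zeta>] real_cnj[of \<zeta>] by (auto simp: indexB_def types_def)

lemma Im_sign: "Im ((-1) powi (m + 1) * \<zeta>) = (-1) powi (m + 1) * Im \<zeta>"
  by (cases "even (m + 1)") auto

lemma Im_sign_cnj: "Im ((-1) powi (m + 1) * cnj \<zeta>) = - Im ((-1) powi (m + 1) * \<zeta>)"
  unfolding Im_sign by simp

lemma Im_sign_zero: "Im ((-1) powi (m + 1) * \<zeta>) = 0 \<longleftrightarrow> \<zeta> \<in> \<real>"
  unfolding Im_sign by (simp add: complex_is_Real_iff)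

lemma indexA_real:
  "(p, q, \<zeta>) \<in> indexA m F W Ms N \<Longrightarrow> \<zeta> \<in> \<real> \<Longrightarrow> (q, p, \<zeta>) \<in> indexA m F W Ms N"
  using types_cnj[of p q \<zeta>] real_cnj[of \<zeta>] by (auto simp: indexA_iff)

text \<open>For a nonreal eigenvalue the imaginary part selects one of two conjugate types, for a real one the
  order of \<open>p\<close> and \<open>q\<close> does.\<close>

lemma types_cover:
  assumes "(p, q, \<zeta>) \<in> types"
  shows "(p, q, \<zeta>) \<in> indexA_once m F W Ms N \<or> (q, p, cnj \<zeta>) \<in> indexA_once m F W Ms N \<or>
    p = q \<and> (p, \<zeta>) \<in> indexB m F W Ms N"
proof (cases "\<zeta> \<in> \<real>")
  case True
  then show ?thesis
    using assms types_cnj[OF assms] real_cnj[of \<zeta>] Im_sign_zero[THEN iffD2, OF True]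
    by (cases p q rule: linorder_cases) (auto simp: indexA_once_def indexA_iff indexB_iff)
next
  case False
  then have "cnj \<zeta> \<noteq> \<zeta>" "cnj \<zeta> \<notin> \<real>" using real_cnj[of \<zeta>] real_cnj[of "cnj \<zeta>"] by auto
  with False show ?thesis
    using assms types_cnj[OF assms] Im_sign_cnj[of \<zeta>]
    by (cases "0 \<le> Im ((-1) powi (m + 1) * \<zeta>)") (auto simp: indexA_once_def indexA_iff)
qed

text \<open>A common conjugate type would force \<open>\<zeta>\<close> to be real, by the condition on the imaginary part, and
  then \<open>p < q\<close> and \<open>q < p\<close>.\<close>

lemma indexA_once_distinct:
  assumes "(p, q, \<zeta>) \<in> indexA_once m F W Ms N" "(r, s, \<mu>) \<in> indexA_once m F W Ms N"
  shows "(r, s, \<mu>) \<noteq> (q, p, cnj \<zeta>)"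
proof
  assume *: "(r, s, \<mu>) = (q, p, cnj \<zeta>)"
  have "0 \<le> Im ((-1) powi (m + 1) * \<zeta>)" "0 \<le> Im ((-1) powi (m + 1) * cnj \<zeta>)"
    using assms * by (auto simp: indexA_once_def indexA_iff)
  then have "Im ((-1) powi (m + 1) * \<zeta>) = 0" using Im_sign_cnj[of \<zeta>] by linarith
  then have "\<zeta> \<in> \<real>" by (rule Im_sign_zero[THEN iffD1])
  moreover from this have "\<mu> \<in> \<real>" using * real_cnj[of \<zeta>] by auto
  ultimately have "p < q" "r < s" using assms by (auto simp: indexA_once_def)
  with * show False by simp
qed

lemma indexA_indexB_distinct:
  assumes "(p, q, \<zeta>) \<in> indexA m F W Ms N" "(r, \<mu>) \<in> indexB m F W Ms N"
  shows "(r, r, \<mu>) \<noteq> (p, q, \<zeta>)" "(r, r, \<mu>) \<noteq> (q, p, cnj \<zeta>)"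
  using assms by (auto simp: indexA_iff indexB_iff)

lemma block_triple:
  assumes "(p, q, \<zeta>) \<in> types" "(p, \<zeta>) \<noteq> (q, cnj \<zeta>) \<or> \<zeta> \<in> {1, -1}"
  shows "isometric_triple (real_pts (cx.span (block p q \<zeta>))) M S"
proof -
  have ell: "0 \<le> ell m p q \<zeta>" using assms(1) by (simp add: types_def)
  have "cnondeg S (cx.span (block p q \<zeta>))"
  proof (cases "(p, \<zeta>) = (q, cnj \<zeta>)")
    case True
    then show ?thesis using blockB_decomposition(1)[of p \<zeta>] ell assms(2) by auto
  next
    case False
    then show ?thesis using blockA_decomposition(1)[OF ell] by simp
  qed
  then show ?thesis by (rule monodromic_triple[OF block_monodromic[OF ell] block_E])
qed

text \<open>The indices of both kinds are mapped to types by \<open>t\<close>; up to conjugation this map is injective and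
  hits every type.\<close>

lemma block_orth_decomp:
  "orth_decomp UNIV M S (indexA_once m F W Ms N <+> indexB m F W Ms N)
     (case_sum (\<lambda>(p, q, \<zeta>). real_pts (spaceA m F W Ms N p q \<zeta>))
               (\<lambda>(p, \<zeta>). real_pts (spaceB m F W Ms N p \<zeta>)))"
proof -
  let ?I = "indexA_once m F W Ms N <+> indexB m F W Ms N"
  define t where "t = case_sum (\<lambda>x :: int \<times> int \<times> complex. x) (\<lambda>(p, \<zeta>). (p, p, \<zeta>))"
  define C where "C i = (case t i of (p, q, \<zeta>) \<Rightarrow> cx.span (block p q \<zeta>))" for i
  have tI: "t i \<in> types" if "i \<in> ?I" for i
    using that by (auto simp: t_def indexA_once_def indexA_iff indexB_iff)
  have t_inj: "(r, s, \<mu>) \<noteq> (p, q, \<zeta>) \<and> (r, s, \<mu>) \<noteq> (q, p, cnj \<zeta>)"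
    if "i \<in> ?I" "j \<in> ?I" "i \<noteq> j" "t i = (p, q, \<zeta>)" "t j = (r, s, \<mu>)" for i j p q \<zeta> r s \<mu>
  proof (cases i; cases j)
    fix x y assume ij: "i = Inl x" "j = Inl y"
    then show ?thesis using that indexA_once_distinct[of p q \<zeta> r s \<mu>] by (auto simp: t_def)
  next
    fix x y assume ij: "i = Inl x" "j = Inr y"
    then show ?thesis
      using that indexA_indexB_distinct[of p q \<zeta> r \<mu>] by (auto simp: t_def indexA_once_def)
  next
    fix x y assume ij: "i = Inr x" "j = Inl y"
    then show ?thesis
      using that indexA_indexB_distinct[of r s \<mu> p \<zeta>] by (auto simp: t_def indexA_once_def)
  next
    fix x y assume ij: "i = Inr x" "j = Inr y"
    then show ?thesis using that by (auto simp: t_def indexB_iff)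
  qed
  have "orth_decomp (real_pts UNIV) M S ?I (\<lambda>i. real_pts (C i))"
  proof (rule orth_decompI[OF bilin])
    have "finite (indexA_once m F W Ms N)"
      by (rule finite_subset[OF _ finite_types]) (auto simp: indexA_once_def indexA_iff)
    moreover have "finite (indexB m F W Ms N)"
      by (rule finite_subset[OF _ finite_imageI[OF finite_types, of "\<lambda>(p, q, \<zeta>). (p, \<zeta>)"]])
        (force simp: indexB_iff)
    ultimately show "finite ?I" by simp
    fix i assume i: "i \<in> ?I"
    obtain p q \<zeta> where t: "t i = (p, q, \<zeta>)" by (metis prod_cases3)
    have ty: "(p, q, \<zeta>) \<in> types" using tI[OF i] t by simp
    then have ell: "0 \<le> ell m p q \<zeta>" by (simp add: types_def)
    show "cx.subspace (C i)" by (simp add: C_def t)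
    show "conj_stable (C i)" using monodromic_conj[OF block_monodromic[OF ell]] by (simp add: C_def t)
    have "(p, \<zeta>) \<noteq> (q, cnj \<zeta>) \<or> \<zeta> \<in> {1, -1}"
      using i t by (auto simp: t_def indexA_once_def indexA_iff indexB_def)
    then show "isometric_triple (real_pts (C i)) M S" using block_triple[OF ty] by (simp add: C_def t)
  next
    fix i j x y assume ij: "i \<in> ?I" "j \<in> ?I" "i \<noteq> j" "x \<in> C i" "y \<in> C j"
    obtain p q \<zeta> r s \<mu> where t: "t i = (p, q, \<zeta>)" "t j = (r, s, \<mu>)" by (metis prod_cases3)
    show "cform S x y = 0"
      using t_inj[OF ij(1-3) t] tI[OF ij(1)] tI[OF ij(2)] ij(4,5)
      by (intro block_orthogonal[of p q \<zeta> r s \<mu>]) (auto simp: C_def t)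
  next
    let ?T = "cx.span (\<Union>i\<in>?I. C i)"
    have "strings p q \<zeta> \<subseteq> ?T" if "0 \<le> ell m p q \<zeta>" for p q \<zeta>
    proof (cases "D p q \<zeta> = {0}")
      case True
      then show ?thesis
        using cmap_zero[OF linear_funpow[OF lin_N]] by (auto simp: strings_iff cmap_funpow cx.span_zero)
    next
      case False
      then have "(p, q, \<zeta>) \<in> types" using that by (simp add: types_def)
      from types_cover[OF this] obtain i where "i \<in> ?I" "C i = cx.span (block p q \<zeta>)"
      proof (elim disjE conjE)
        assume "(p, q, \<zeta>) \<in> indexA_once m F W Ms N"
        then show thesis by (intro that[of "Inl (p, q, \<zeta>)"]) (auto simp: C_def t_def)
      next
        assume "(q, p, cnj \<zeta>) \<in> indexA_once m F W Ms N"
        then show thesis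
          by (intro that[of "Inl (q, p, cnj \<zeta>)"]) (auto simp: C_def t_def block_commute)
      next
        assume "p = q" "(p, \<zeta>) \<in> indexB m F W Ms N"
        then show thesis by (intro that[of "Inr (p, \<zeta>)"]) (auto simp: C_def t_def)
      qed
      then have "cx.span (block p q \<zeta>) \<subseteq> ?T" using cx.span_superset[of "\<Union>i\<in>?I. C i"] by blast
      then show ?thesis using cx.span_superset[of "block p q \<zeta>"] by (auto simp: block_def)
    qed
    then have "cx.span (\<Union>(p, q, \<zeta>)\<in>{(p, q, \<zeta>). 0 \<le> ell m p q \<zeta>}. strings p q \<zeta>) \<subseteq> ?T"
      by (intro cx.span_minimal cx.subspace_span) auto
    then show "UNIV = ?T" by (auto simp: strings_span)
  qed
  moreover have "real_pts (C i) = case_sum (\<lambda>(p, q, \<zeta>). real_pts (spaceA m F W Ms N p q \<zeta>))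
      (\<lambda>(p, \<zeta>). real_pts (spaceB m F W Ms N p \<zeta>)) i" if "i \<in> ?I" for i
    using that by (auto simp: C_def t_def spaceA_eq indexB_iff spaceB_eq)
  moreover have "real_pts UNIV = (UNIV :: 'a set)" by (simp add: real_pts_def)
  ultimately show ?thesis
    using orth_decomp_cong[of ?I "\<lambda>i. real_pts (C i)" "case_sum (\<lambda>(p, q, \<zeta>). real_pts (spaceA m F W Ms N p q \<zeta>))
      (\<lambda>(p, \<zeta>). real_pts (spaceB m F W Ms N p \<zeta>))" UNIV M S] by simp
qed

end

theorem theorem3p8:
  fixes F :: "int \<Rightarrow> ('a::real_vector \<times> 'a) set" and W :: "int \<Rightarrow> 'a set"
    and M Ms N :: "'a \<Rightarrow> 'a" and S :: "'a \<Rightarrow> 'a \<Rightarrow> real" and m :: int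
  assumes "steenbrink_pmhs m F W M Ms N S"
    and "split_mhs F W"
  shows
    "\<comment> \<open>(a)\<close>
     isometric_triple (real_pts (eigsp_ne1 Ms)) M S \<and>
     isometric_triple (real_pts (eigsp Ms 1)) M S \<and>
     orth_decomp UNIV M S {False, True}
       (\<lambda>b. if b then real_pts (eigsp Ms 1) else real_pts (eigsp_ne1 Ms)) \<and>
     (\<forall>(p, q, \<zeta>) \<in> indexA m F W Ms N.
        cpx (real_pts (spaceA m F W Ms N p q \<zeta>)) = spaceA m F W Ms N p q \<zeta> \<and>
        real_pts (spaceA m F W Ms N p q \<zeta>)
          \<subseteq> real_pts (if \<zeta> = 1 then eigsp Ms 1 else eigsp_ne1 Ms) \<and>
        (\<zeta> \<in> \<real> \<longrightarrow> (q, p, \<zeta>) \<in> indexA m F W Ms N \<and>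
                  spaceA m F W Ms N q p \<zeta> = spaceA m F W Ms N p q \<zeta>)) \<and>
     (\<forall>(p, \<zeta>) \<in> indexB m F W Ms N.
        cpx (real_pts (spaceB m F W Ms N p \<zeta>)) = spaceB m F W Ms N p \<zeta> \<and>
        real_pts (spaceB m F W Ms N p \<zeta>)
          \<subseteq> real_pts (if \<zeta> = 1 then eigsp Ms 1 else eigsp_ne1 Ms)) \<and>
     orth_decomp UNIV M S (indexA_once m F W Ms N <+> indexB m F W Ms N)
       (case_sum (\<lambda>(p, q, \<zeta>). real_pts (spaceA m F W Ms N p q \<zeta>))
                 (\<lambda>(p, \<zeta>). real_pts (spaceB m F W Ms N p \<zeta>))) \<and>
     \<comment> \<open>(b)\<close>
     (\<forall>(p, q, \<zeta>) \<in> indexA m F W Ms N.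
        \<exists>V. orth_decomp (real_pts (spaceA m F W Ms N p q \<zeta>)) M S
              {..<cx.dim (deligne0 m F W Ms N p q \<zeta>)} V \<and>
            (\<forall>i<cx.dim (deligne0 m F W Ms N p q \<zeta>).
               is_Tr2 (V i) M S \<zeta> (nat (ell m p q \<zeta>) + 1) (nat ((m + theta \<zeta>) mod 2)) (signA m p \<zeta>))) \<and>
     (\<forall>(p, \<zeta>) \<in> indexB m F W Ms N.
        (\<exists>V. orth_decomp (real_pts (spaceB m F W Ms N p \<zeta>)) M S
               {..<cx.dim (deligne0 m F W Ms N p p \<zeta>)} V \<and>
             (\<forall>i<cx.dim (deligne0 m F W Ms N p p \<zeta>).
                is_Tr1 (V i) M S (Re \<zeta>) (nat (ell m p p \<zeta>) + 1) (signB m p \<zeta>))) \<and>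
        (-1) powi (m + 1) * \<zeta> = (-1) powi (ell m p p \<zeta>))"
proof -
  have "monodromy_parts UNIV M Ms N"
    using assms(1) by (simp add: steenbrink_pmhs_def steenbrink_mhs_def)
  then obtain Mu K where "jordan_chevalley M Ms N Mu K"
    by (auto simp: monodromy_parts_def nilpotent_on_def jordan_chevalley_def)
  then interpret steenbrink_split M Ms N Mu K m F W S
    by (intro steenbrink_split.intro steenbrink_split_axioms.intro assms)
  have E: "(if \<zeta> = 1 then eigsp Ms 1 else eigsp_ne1 Ms) = E \<zeta>" for \<zeta> by (simp add: E_def)
  have A: "(p, q, \<zeta>) \<in> types" "(p, \<zeta>) \<noteq> (q, cnj \<zeta>)" "0 \<le> ell m p q \<zeta>"
    if "(p, q, \<zeta>) \<in> indexA m F W Ms N" for p q \<zeta>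
    using that by (simp_all add: indexA_iff types_def)
  have B: "\<zeta> \<in> {1, -1}" "0 \<le> ell m p p \<zeta>" "spaceB m F W Ms N p \<zeta> = cx.span (block p p \<zeta>)"
    if i: "(p, \<zeta>) \<in> indexB m F W Ms N" for p \<zeta>
  proof -
    show "\<zeta> \<in> {1, -1}" "0 \<le> ell m p p \<zeta>" using i by (simp_all add: indexB_def)
    show "spaceB m F W Ms N p \<zeta> = cx.span (block p p \<zeta>)" using i by (simp add: indexB_iff spaceB_eq)
  qed
  have sub: "real_pts (cx.span (block p q \<zeta>)) \<subseteq> real_pts (E \<zeta>)" for p q \<zeta>
    using block_E[of p q \<zeta>] by (auto simp: real_pts_iff)
  have sym: "block q p \<zeta> = block p q \<zeta>" if "\<zeta> \<in> \<real>" for p q \<zeta>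
    using block_commute[of q p \<zeta>] real_cnj[of \<zeta>] that by simp
  have parity: "(-1) powi (m + 1) * \<zeta> = (-1) powi (ell m p p \<zeta>)" if "\<zeta> \<in> {1, -1}" for p and \<zeta> :: complex
    using that by (cases "even m") (auto simp: ell_def theta_def)
  show ?thesis
    unfolding E
  proof (intro conjI eigenspace_decomposition block_orth_decomp)
    show "isometric_triple (real_pts (eigsp_ne1 Ms)) M S" "isometric_triple (real_pts (eigsp Ms 1)) M S"
      using eigenspace_triple[of 0] eigenspace_triple[of 1] by (simp_all add: E_def)
  next
    show "\<forall>(p, q, \<zeta>) \<in> indexA m F W Ms N.
        cpx (real_pts (spaceA m F W Ms N p q \<zeta>)) = spaceA m F W Ms N p q \<zeta> \<and>
        real_pts (spaceA m F W Ms N p q \<zeta>) \<subseteq> real_pts (E \<zeta>) \<and>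
        (\<zeta> \<in> \<real> \<longrightarrow> (q, p, \<zeta>) \<in> indexA m F W Ms N \<and>
                  spaceA m F W Ms N q p \<zeta> = spaceA m F W Ms N p q \<zeta>)"
    proof (clarify, goal_cases)
      case i: (1 p q \<zeta>)
      show ?case
        unfolding spaceA_eq using monodromic_cpx[OF block_monodromic[OF A(3)[OF i]]] sub indexA_real[OF i] sym
        by auto
    qed
    show "\<forall>(p, \<zeta>) \<in> indexB m F W Ms N.
        cpx (real_pts (spaceB m F W Ms N p \<zeta>)) = spaceB m F W Ms N p \<zeta> \<and>
        real_pts (spaceB m F W Ms N p \<zeta>) \<subseteq> real_pts (E \<zeta>)"
    proof (clarify, goal_cases)
      case i: (1 p \<zeta>)
      show ?case
        unfolding B(3)[OF i] using monodromic_cpx[OF block_monodromic[OF B(2)[OF i]]] sub by blast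
    qed
    show "\<forall>(p, q, \<zeta>) \<in> indexA m F W Ms N.
        \<exists>V. orth_decomp (real_pts (spaceA m F W Ms N p q \<zeta>)) M S
              {..<cx.dim (deligne0 m F W Ms N p q \<zeta>)} V \<and>
            (\<forall>i<cx.dim (deligne0 m F W Ms N p q \<zeta>).
               is_Tr2 (V i) M S \<zeta> (nat (ell m p q \<zeta>) + 1) (nat ((m + theta \<zeta>) mod 2)) (signA m p \<zeta>))"
      unfolding spaceA_eq using blockA_decomposition(2) A by blast
    show "\<forall>(p, \<zeta>) \<in> indexB m F W Ms N.
        (\<exists>V. orth_decomp (real_pts (spaceB m F W Ms N p \<zeta>)) M S
               {..<cx.dim (deligne0 m F W Ms N p p \<zeta>)} V \<and>
             (\<forall>i<cx.dim (deligne0 m F W Ms N p p \<zeta>).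
                is_Tr1 (V i) M S (Re \<zeta>) (nat (ell m p p \<zeta>) + 1) (signB m p \<zeta>))) \<and>
        (-1) powi (m + 1) * \<zeta> = (-1) powi (ell m p p \<zeta>)"
    proof (clarify, goal_cases)
      case i: (1 p \<zeta>)
      show ?case
        unfolding B(3)[OF i]
        using blockB_decomposition(2)[OF B(2)[OF i] B(1)[OF i]] parity[OF B(1)[OF i]] by blast
    qed
  qed
qed

end
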